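(* Let $N\ge 2$ and $1\le q<2^*$. For every nonempty open bounded convex set $\Omega\subset\mathbb{R}^N$ we have $$\lambda_{2,q}(\Omega)\,|\Omega|^{\frac{2-q}{q}}\le \frac{\omega_N^{\frac{2-q}{q}}\,\lambda_{2,q}(B_1)}{R_\Omega^2},$$ and equality holds if and only if $\Omega$ is a ball. Moreover, if $2\le q<2^*$, the inequality holds for every nonempty open bounded set $\Omega\subset\mathbb{R}^N$, without the convexity assumption.
   Context: $N\ge 2$ is the dimension. $2^*=\frac{2N}{N-2}$ if $N\ge 3$ and $2^*=+\infty$ if $N=2$. For $1\le q<2^*$ and an open set $\Omega\subset\mathbb{R}^N$, $$\lambda_{2,q}(\Omega)=\inf_{\varphi\in C^\infty_0(\Omega)\setminus\{0\}} \frac{\int_\Omega |\nabla \varphi|^2\,dx}{\left(\int_\Omega |\varphi|^q\,dx\right)^{2/q}},$$ where $C^\infty_0(\Omega)$ denotes smooth functions with compact support in $\Omega$. $|\Omega|$ is the $N$-dimensional Lebesgue measure of $\Omega$. $R_\Omega$ is the inradius of $\Omega$, i.e. the radius of the largest open ball contained in $\Omega$. $B_1$ is the open unit ball of $\mathbb{R}^N$ centered at the origin and $\omega_N=|B_1|$. *)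

theory Defs
  imports "HOL-Analysis.Analysis"
begin

text \<open>
  \<open>R^N\<close> is rendered as an arbitrary Euclidean space \<open>'a\<close> with \<open>N = DIM('a)\<close>.
\<close>

text \<open>Class \<open>C^k\<close> on the whole space, by recursion over all directional derivatives.\<close>

primrec Ck :: "nat \<Rightarrow> ('a::euclidean_space \<Rightarrow> real) \<Rightarrow> bool" where
  "Ck 0 f \<longleftrightarrow> continuous_on UNIV f"
| "Ck (Suc k) f \<longleftrightarrow>
     (\<forall>x. f differentiable (at x)) \<and> (\<forall>v. Ck k (\<lambda>x. frechet_derivative f (at x) v))"

definition smooth :: "('a::euclidean_space \<Rightarrow> real) \<Rightarrow> bool" where
  "smooth f \<longleftrightarrow> (\<forall>k. Ck k f)"

text \<open>
  An element of \<open>C_0^\<infinity>(\<Omega>)\<close> is represented by its extension by zero to the whole space.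
\<close>

definition test_functions :: "'a::euclidean_space set \<Rightarrow> ('a \<Rightarrow> real) set" where
  "test_functions \<Omega> =
     {\<phi>. smooth \<phi> \<and> compact (closure {x. \<phi> x \<noteq> 0}) \<and> closure {x. \<phi> x \<noteq> 0} \<subseteq> \<Omega>}"

definition grad :: "('a::euclidean_space \<Rightarrow> real) \<Rightarrow> 'a \<Rightarrow> 'a" where
  "grad f x = (\<Sum>b\<in>Basis. frechet_derivative f (at x) b *\<^sub>R b)"

definition critical_exponent :: "nat \<Rightarrow> ereal" where
  "critical_exponent N = (if N = 2 then \<infinity> else ereal (2 * real N / (real N - 2)))"

text \<open>
  The infimum is taken in \<open>real\<close>. This is harmless for nonempty open \<open>\<Omega>\<close>: the quotients are
  nonnegative, and there are nonzero test functions.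
\<close>

definition lambda2 :: "real \<Rightarrow> 'a::euclidean_space set \<Rightarrow> real" where
  "lambda2 q \<Omega> =
     (INF \<phi>\<in>test_functions \<Omega> - {\<lambda>x. 0}.
        (LINT x:\<Omega>|lebesgue. (norm (grad \<phi> x))\<^sup>2) /
        (LINT x:\<Omega>|lebesgue. \<bar>\<phi> x\<bar> powr q) powr (2 / q))"

text \<open>
  For nonempty bounded open \<open>\<Omega>\<close> the supremum is attained, so that it is the radius of a largest
  ball in \<open>\<Omega>\<close>; see \<open>ball_inradius\<close>. The condition \<open>0 < r\<close> excludes empty balls.
\<close>

definition inradius :: "'a::euclidean_space set \<Rightarrow> real" where
  "inradius \<Omega> = Sup {r. 0 < r \<and> (\<exists>x. ball x r \<subseteq> \<Omega>)}"

lemma inradius_bdd_above: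
  fixes \<Omega> :: "'a::euclidean_space set"
  assumes "bounded \<Omega>"
  shows "bdd_above {r. 0 < r \<and> (\<exists>x. ball x r \<subseteq> \<Omega>)}"
proof (rule bdd_aboveI)
  fix r assume "r \<in> {r. 0 < r \<and> (\<exists>x. ball x r \<subseteq> \<Omega>)}"
  then obtain x where r: "0 < r" and sub: "ball x r \<subseteq> \<Omega>" by auto
  have "2 * r = diameter (ball x r)" using r by simp
  also have "\<dots> \<le> diameter \<Omega>" by (rule diameter_subset[OF sub assms])
  finally show "r \<le> diameter \<Omega> / 2" by simp
qed

lemma ball_inradius:
  fixes \<Omega> :: "'a::euclidean_space set"
  assumes "open \<Omega>" "bounded \<Omega>" "\<Omega> \<noteq> {}"
  shows "0 < inradius \<Omega>"
    and "\<exists>x. ball x (inradius \<Omega>) \<subseteq> \<Omega>"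
    and "\<And>x r. 0 < r \<Longrightarrow> ball x r \<subseteq> \<Omega> \<Longrightarrow> r \<le> inradius \<Omega>"
proof -
  let ?S = "{r. 0 < r \<and> (\<exists>x. ball x r \<subseteq> \<Omega>)}"
  note bdd = inradius_bdd_above[OF assms(2)]
  show upper: "r \<le> inradius \<Omega>" if "0 < r" "ball x r \<subseteq> \<Omega>" for x r
    unfolding inradius_def by (rule cSup_upper[OF _ bdd]) (use that in auto)
  obtain x0 e where e: "0 < e" "ball x0 e \<subseteq> \<Omega>"
    using assms(1,3) by (meson ex_in_conv openE)
  show "0 < inradius \<Omega>" using upper[OF e] e(1) by linarith
  have ne: "?S \<noteq> {}" using e by auto
  have "\<exists>r\<in>?S. inradius \<Omega> - 1 / real (Suc n) < r" for n
    unfolding inradius_def by (rule less_cSupD[OF ne]) simp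
  then have "\<exists>x r. 0 < r \<and> ball x r \<subseteq> \<Omega> \<and> inradius \<Omega> - 1 / real (Suc n) < r" for n
    by blast
  then obtain X r where Xr: "\<And>n. 0 < r n" "\<And>n. ball (X n) (r n) \<subseteq> \<Omega>"
      "\<And>n. inradius \<Omega> - 1 / real (Suc n) < r n"
    by metis
  have "range X \<subseteq> \<Omega>" using Xr(1,2) by (metis centre_in_ball image_subsetI subsetD)
  then have "bounded (range X)" using assms(2) bounded_subset by blast
  then obtain l and s :: "nat \<Rightarrow> nat" where s: "strict_mono s" and lim: "(X \<circ> s) \<longlonglongrightarrow> l"
    using bounded_imp_convergent_subsequence[of X] by auto
  have "y \<in> \<Omega>" if y: "y \<in> ball l (inradius \<Omega>)" for y
  proof -
    have 1: "(\<lambda>n. dist ((X \<circ> s) n) y) \<longlonglongrightarrow> dist l y"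
      by (intro tendsto_intros lim)
    have "((\<lambda>n. inradius \<Omega> - inverse (real (Suc n))) \<circ> s) \<longlonglongrightarrow> inradius \<Omega> - 0"
      by (rule LIMSEQ_subseq_LIMSEQ[OF _ s]) (intro tendsto_intros LIMSEQ_inverse_real_of_nat)
    from tendsto_diff[OF this 1]
    have "(\<lambda>n. inradius \<Omega> - inverse (real (Suc (s n))) - dist (X (s n)) y)
        \<longlonglongrightarrow> inradius \<Omega> - dist l y"
      by (simp add: o_def)
    then have "\<forall>\<^sub>F n in sequentially. 0 < inradius \<Omega> - inverse (real (Suc (s n))) - dist (X (s n)) y"
      by (rule order_tendstoD) (use y in auto)
    then obtain n where "0 < inradius \<Omega> - inverse (real (Suc (s n))) - dist (X (s n)) y"
      using eventually_happens by fastforce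
    then have "dist (X (s n)) y < r (s n)"
      using Xr(3)[of "s n"] by (simp add: inverse_eq_divide)
    then show ?thesis using Xr(2)[of "s n"] by auto
  qed
  then show "\<exists>x. ball x (inradius \<Omega>) \<subseteq> \<Omega>" by blast
qed

end

theory Submission
  imports Defs "HOL-Computational_Algebra.Polynomial"
begin

text \<open>
  For \<open>q \<ge> 2\<close> compare with a largest inscribed ball \<open>B\<close>: \<open>\<lambda>(\<Omega>) \<le> \<lambda>(B)\<close>, and \<open>|\<Omega>|\<close> enters with
  a nonpositive exponent. If \<open>q > 2\<close>, equality forces \<open>|\<Omega>| = |B|\<close> because \<open>\<lambda>(B) > 0\<close>, which is a
  subcritical Sobolev inequality, obtained from the Riesz potential of the gradient and Young's inequality.

  For \<open>q \<le> 2\<close> and convex \<open>\<Omega>\<close>, place the centre of \<open>B\<close> at the origin and let \<open>j\<close> be the Minkowski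
  gauge of \<open>\<Omega>\<close>, which is Lipschitz with constant \<open>1 / R\<close>. A test function \<open>\<phi>\<close> of the unit ball yields,
  for every direction \<open>e\<close>, the competitor \<open>x \<mapsto> \<phi> (j x e)\<close> on \<open>\<Omega>\<close>, and averaging over \<open>e\<close> with Jensen's
  inequality compares \<open>\<lambda>(\<Omega>)\<close> with the Rayleigh quotient of \<open>\<phi>\<close>, so no symmetrisation and no minimiser
  is needed. If \<open>\<Omega>\<close> is not a ball, the estimate becomes strict after cutting off a small cap of \<open>\<Omega>\<close>
  near a point farthest from the origin.
\<close>

subsection \<open>Calculus of \<open>C\<^sup>k\<close> functions\<close>

text \<open>For a gauge with sublevel set D, averaging gives \<lambda>(D) |D|^(2/q) \<omega>^(1 -
  2/q) \<le> g \<lambda>(B_1), with \<open>g\<close> the integral over D of the square of a local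
  Lipschitz bound of the gauge. For D = \<Omega> the global bound 1 / R would give g = |\<Omega>| /
  R^2, which explains the constant of the theorem. Since no extremal function is available,
  strictness cannot come from discussing when equality holds in each step; it has to be a gain in
  \<open>g\<close> that is the same for all test functions. Cutting off a cap produces an explicit
  open cone on which the new gauge is linear, so that the gain is computed by hand and no almost
  everywhere derivative of \<open>j\<close> is involved. The gain survives the infimum because
  \<lambda>(B_1) > 0, so the Sobolev bound serves q \<le> 2 as well. For q \<le> 2 the weak
  inequality is not shown separately: a ball gives equality by scaling, every other convex set gives
  the strict inequality. In the convex claim q = 2 belongs to this case, since the power of
  |\<Omega>| is then 0 and comparing volumes detects nothing.\<close>

lemma Ck_SucI:
  assumes "\<And>x. (f has_derivative f' x) (at x)" "\<And>v. Ck n (\<lambda>x. f' x v)"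
  shows "Ck (Suc n) f"
proof -
  have "frechet_derivative f (at x) = f' x" for x
    using frechet_derivative_at[OF assms(1)] by simp
  then show ?thesis using assms by (auto simp: differentiable_def)
qed

lemma Ck_SucD:
  assumes "Ck (Suc n) f"
  shows "(f has_derivative frechet_derivative f (at x)) (at x)" "Ck n (\<lambda>x. frechet_derivative f (at x) v)"
  using assms by (auto simp: frechet_derivative_works)

lemma Ck_continuous: "Ck n f \<Longrightarrow> continuous_on UNIV f"
  by (cases n) (auto simp: continuous_at_imp_continuous_on differentiable_imp_continuous_within)

lemma Ck_Suc_imp: "Ck (Suc n) f \<Longrightarrow> Ck n f"
proof (induction n arbitrary: f)
  case 0 then show ?case using Ck_continuous[of "Suc 0" f] by simp
next
  case (Suc n)
  show ?case
    by (rule Ck_SucI[OF Ck_SucD(1)[OF Suc.prems]]) (rule Suc.IH[OF Ck_SucD(2)[OF Suc.prems]])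
qed

lemma Ck_const: "Ck n (\<lambda>x. c)"
proof (induction n arbitrary: c)
  case (Suc n) show ?case by (rule Ck_SucI[where f'="\<lambda>_ _. 0"]) (auto intro: Suc)
qed simp

lemma Ck_add: "Ck n f \<Longrightarrow> Ck n g \<Longrightarrow> Ck n (\<lambda>x. f x + g x)"
proof (induction n arbitrary: f g)
  case 0 then show ?case by (simp add: continuous_on_add)
next
  case (Suc n)
  show ?case
  proof (rule Ck_SucI[where f'="\<lambda>x v. frechet_derivative f (at x) v + frechet_derivative g (at x) v"])
    show "((\<lambda>x. f x + g x) has_derivative
        (\<lambda>v. frechet_derivative f (at x) v + frechet_derivative g (at x) v)) (at x)" for x
      by (intro has_derivative_add Ck_SucD(1)[OF Suc.prems(1)] Ck_SucD(1)[OF Suc.prems(2)])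
    show "Ck n (\<lambda>x. frechet_derivative f (at x) v + frechet_derivative g (at x) v)" for v
      by (rule Suc.IH[OF Ck_SucD(2)[OF Suc.prems(1)] Ck_SucD(2)[OF Suc.prems(2)]])
  qed
qed

lemma Ck_mult: "Ck n f \<Longrightarrow> Ck n g \<Longrightarrow> Ck n (\<lambda>x. f x * g x)"
proof (induction n arbitrary: f g)
  case 0 then show ?case by (simp add: continuous_on_mult)
next
  case (Suc n)
  show ?case
  proof (rule Ck_SucI[where f'="\<lambda>x v. f x * frechet_derivative g (at x) v + frechet_derivative f (at x) v * g x"])
    show "((\<lambda>x. f x * g x) has_derivative
        (\<lambda>v. f x * frechet_derivative g (at x) v + frechet_derivative f (at x) v * g x)) (at x)" for x
      by (intro has_derivative_mult Ck_SucD(1)[OF Suc.prems(1)] Ck_SucD(1)[OF Suc.prems(2)])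
    \<comment> \<open>The product rule keeps one factor undifferentiated, so it is only needed at
      level \<open>n\<close>; this is the purpose of \<open>Ck_Suc_imp\<close>.\<close>
    show "Ck n (\<lambda>x. f x * frechet_derivative g (at x) v + frechet_derivative f (at x) v * g x)" for v
      by (rule Ck_add[OF Suc.IH[OF Ck_Suc_imp[OF Suc.prems(1)] Ck_SucD(2)[OF Suc.prems(2), of v]]
          Suc.IH[OF Ck_SucD(2)[OF Suc.prems(1), of v] Ck_Suc_imp[OF Suc.prems(2)]]])
  qed
qed

lemma Ck_sum: "(\<And>i. i \<in> I \<Longrightarrow> Ck n (f i)) \<Longrightarrow> Ck n (\<lambda>x. \<Sum>i\<in>I. f i x)"
  by (induction I rule: infinite_finite_induct) (auto intro: Ck_const Ck_add)

lemma Ck_linear: "bounded_linear f \<Longrightarrow> Ck n f"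
proof (cases n)
  case 0
  assume "bounded_linear f"
  then show ?thesis using 0 by (simp add: linear_continuous_on)
next
  case (Suc m)
  assume "bounded_linear f"
  then show ?thesis unfolding Suc
    by (intro Ck_SucI[where f'="\<lambda>_. f"] Ck_const bounded_linear_imp_has_derivative)
qed

text \<open>The derivative along \<open>v\<close> is the derivative of \<open>f\<close> along the
  fixed vector \<open>A v\<close>, composed with the same affine map, so the induction closes
  without a product rule. Different domain types are allowed because restrictions to lines are
  treated with it too.\<close>

lemma Ck_compose_affine:
  fixes f :: "'b::euclidean_space \<Rightarrow> real" and A :: "'a::euclidean_space \<Rightarrow> 'b"
  assumes A: "bounded_linear A"
  shows "Ck n f \<Longrightarrow> Ck n (\<lambda>x. f (c + A x))"
proof (induction n arbitrary: f)
  case 0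
  have "continuous_on UNIV (\<lambda>x. c + A x)"
    using A by (intro continuous_intros linear_continuous_on)
  with 0 show ?case using continuous_on_compose2[of UNIV f UNIV "\<lambda>x. c + A x"] by simp
next
  case (Suc n)
  have d: "((\<lambda>x. c + A x) has_derivative A) (at x)" for x
    using A by (auto intro!: derivative_eq_intros bounded_linear_imp_has_derivative)
  show ?case
    by (rule Ck_SucI[OF has_derivative_compose[OF d Ck_SucD(1)[OF Suc.prems]]])
       (rule Suc.IH[OF Ck_SucD(2)[OF Suc.prems]])
qed

lemma Ck_compose_real:
  fixes g :: "real \<Rightarrow> real"
  shows "Ck n g \<Longrightarrow> Ck n f \<Longrightarrow> Ck n (\<lambda>x. g (f x))"
proof (induction n arbitrary: g f)
  case 0
  then show ?case using continuous_on_compose2[of UNIV g UNIV f] by simp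
next
  case (Suc n)
  \<comment> \<open>Linearity in one variable turns the chain rule into a product of
    \<open>g'\<close> at \<open>f x\<close> with a directional derivative of \<open>f\<close>, to
    which \<open>Ck_mult\<close> applies.\<close>
  have lin: "frechet_derivative g (at y) t = frechet_derivative g (at y) 1 * t" for y t
  proof -
    have "linear (frechet_derivative g (at y))"
      using Ck_SucD(1)[OF Suc.prems(1)] has_derivative_linear by blast
    from linear_scale[OF this, of t 1] show ?thesis by simp
  qed
  show ?case
  proof (rule Ck_SucI[where f'="\<lambda>x v. frechet_derivative g (at (f x)) (frechet_derivative f (at x) v)"])
    show "((\<lambda>x. g (f x)) has_derivative
        (\<lambda>v. frechet_derivative g (at (f x)) (frechet_derivative f (at x) v))) (at x)" for x
      by (rule has_derivative_compose[OF Ck_SucD(1)[OF Suc.prems(2)] Ck_SucD(1)[OF Suc.prems(1)]])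
    show "Ck n (\<lambda>x. frechet_derivative g (at (f x)) (frechet_derivative f (at x) v))" for v
      by (subst lin, rule Ck_mult[OF Suc.IH[OF Ck_SucD(2)[OF Suc.prems(1)] Ck_Suc_imp[OF Suc.prems(2)]]
          Ck_SucD(2)[OF Suc.prems(2)]])
  qed
qed

subsection \<open>A smooth bump function\<close>

text \<open>The polynomial factor makes this family closed under differentiation.\<close>

definition flat :: "real poly \<Rightarrow> real \<Rightarrow> real" where
  "flat p t = (if t \<le> 0 then 0 else poly p (1/t) * exp (- (1/t)))"

lemma poly_exp_tendsto_0: "((\<lambda>s::real. poly p s * exp (-s)) \<longlongrightarrow> 0) at_top"
proof (induction p)
  case 0 then show ?case by simp
next
  case (pCons a p)
  have 1: "((\<lambda>s::real. a * exp (-s)) \<longlongrightarrow> 0) at_top" 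
    by (intro tendsto_mult_right_zero) 
       (use filterlim_compose[OF exp_at_bot filterlim_uminus_at_bot_at_top] in simp)
  have 2: "((\<lambda>s::real. s * poly p s * exp (-s)) \<longlongrightarrow> 0) at_top"
  proof -
    have "((\<lambda>s::real. (\<Sum>i\<le>degree p. coeff p i * (s ^ Suc i / exp s))) \<longlongrightarrow> (\<Sum>i\<le>degree p. coeff p i * 0)) at_top"
      by (intro tendsto_sum tendsto_mult tendsto_const tendsto_power_div_exp_0)
    moreover have "(\<Sum>i\<le>degree p. coeff p i * (s ^ Suc i / exp s)) = s * poly p s * exp (-s)" for s :: real
      by (simp add: poly_altdef sum_distrib_left sum_distrib_right exp_minus field_simps)
    ultimately show ?thesis by simp
  qed
  from tendsto_add[OF 1 2] show ?case by (simp add: algebra_simps)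
qed

lemma flat_tendsto_0: "(flat p \<longlongrightarrow> 0) (at 0)"
proof -
  have "((\<lambda>t. poly p (inverse t) * exp (- inverse t)) \<longlongrightarrow> 0) (at_right 0)"
    using filterlim_compose[OF poly_exp_tendsto_0 filterlim_inverse_at_top_right] .
  moreover have "\<forall>\<^sub>F t in at_right 0. poly p (inverse t) * exp (- inverse t) = flat p t"
    by (auto simp: flat_def eventually_at_right_field inverse_eq_divide intro!: exI[of _ 1])
  ultimately have R: "(flat p \<longlongrightarrow> 0) (at_right 0)" using tendsto_cong by force
  have "\<forall>\<^sub>F t in at_left 0. flat p t = 0"
    by (auto simp: flat_def eventually_at_left_field intro!: exI[of _ "-1"])
  then have "(flat p \<longlongrightarrow> 0) (at_left 0)" by (simp add: tendsto_eventually)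
  with R show ?thesis using filterlim_at_split by blast
qed

text \<open>With s = 1/t one has ds/dt = - s^2, and p(s) exp(-s) has s-derivative (p' - p)(s)
  exp(-s); hence the polynomial s^2 (p - p').\<close>

lemma flat_has_derivative:
  "(flat p has_derivative (\<lambda>v. flat ([:0,0,1:] * (p - pderiv p)) x * v)) (at x)"
proof -
  let ?D = "flat ([:0,0,1:] * (p - pderiv p)) x"
  have "(flat p has_field_derivative ?D) (at x)"
  proof (cases x "0::real" rule: linorder_cases)
    case less
    have "((\<lambda>_. 0) has_field_derivative ?D) (at x)" using less by (simp add: flat_def)
    moreover have "\<forall>\<^sub>F t in nhds x. flat p t = 0"
      using eventually_nhds_in_open[of "{..<0}" x] less by (auto simp: flat_def elim: eventually_mono)
    ultimately show ?thesis using DERIV_cong_ev[OF refl _ refl] by fastforce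
  next
    case equal
    have "(flat ([:0,1:] * p) \<longlongrightarrow> 0) (at 0)" by (rule flat_tendsto_0)
    \<comment> \<open>The difference quotient at 0 is again of the form \<open>flat\<close>:
      dividing by \<open>h\<close> multiplies the polynomial by 1/h.\<close>
    moreover have "flat ([:0,1:] * p) = (\<lambda>h. (flat p (0 + h) - flat p 0) / h)"
      by (auto simp: flat_def fun_eq_iff)
    ultimately have "(\<lambda>h. (flat p (0 + h) - flat p 0) / h) \<midarrow>0\<rightarrow> 0" by metis
    then show ?thesis using equal by (simp add: DERIV_def flat_def)
  next
    case greater
    have "((\<lambda>t. poly p (1/t) * exp (- (1/t))) has_field_derivative ?D) (at x)"
    proof -
      have i: "((\<lambda>t. 1/t) has_field_derivative - (1 / x\<^sup>2)) (at x)"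
        using greater by (auto intro!: derivative_eq_intros simp: power2_eq_square)
      have "((\<lambda>t. poly p (1/t) * exp (- (1/t))) has_field_derivative
          (poly (pderiv p) (1/x) * - (1 / x\<^sup>2)) * exp (- (1/x)) +
          (exp (- (1/x)) * - (- (1 / x\<^sup>2))) * poly p (1/x)) (at x)"
        by (intro DERIV_mult DERIV_chain2[OF poly_DERIV i] DERIV_chain2[OF DERIV_exp] DERIV_minus i)
      moreover have "(poly (pderiv p) (1/x) * - (1 / x\<^sup>2)) * exp (- (1/x)) +
          (exp (- (1/x)) * - (- (1 / x\<^sup>2))) * poly p (1/x) = ?D"
        using greater by (simp add: flat_def field_simps power2_eq_square)
      ultimately show ?thesis by metis
    qed
    moreover have "\<forall>\<^sub>F t in nhds x. flat p t = poly p (1/t) * exp (- (1/t))"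
      using eventually_nhds_in_open[of "{0<..}" x] greater by (auto simp: flat_def elim!: eventually_mono)
    ultimately show ?thesis using DERIV_cong_ev[OF refl _ refl] by fastforce
  qed
  then show ?thesis by (simp add: has_field_derivative_def)
qed

lemma Ck_flat: "Ck n (flat p)"
proof (induction n arbitrary: p)
  case 0
  show ?case using flat_has_derivative
    by (metis Ck.simps(1) continuous_at_imp_continuous_on has_derivative_continuous)
next
  case (Suc n)
  show ?case
    by (rule Ck_SucI[OF flat_has_derivative]) (intro Ck_mult Suc Ck_const)
qed

text \<open>The argument is a polynomial in the coordinates, whereas \<open>norm x\<close> would not
  be differentiable at the origin.\<close>

definition bump :: "real \<Rightarrow> 'a::euclidean_space \<Rightarrow> real" where
  "bump d x = flat 1 (d\<^sup>2 - x \<bullet> x)"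

lemma smooth_bump: "smooth (bump d)"
proof -
  have "Ck n (\<lambda>x::'a. (\<Sum>b\<in>Basis. (x \<bullet> b) * (x \<bullet> b)))" for n
    by (intro Ck_sum Ck_mult Ck_linear bounded_linear_inner_left)
  then have "Ck n (\<lambda>x::'a. x \<bullet> x)" for n by (simp add: euclidean_inner[of _ _, symmetric] )
  then have "Ck n (\<lambda>x::'a. d\<^sup>2 + (- 1) * (x \<bullet> x))" for n by (intro Ck_add Ck_mult Ck_const)
  then have "Ck n (\<lambda>x::'a. d\<^sup>2 - (x \<bullet> x))" for n by simp
  from Ck_compose_real[OF Ck_flat this] show ?thesis unfolding smooth_def bump_def by blast
qed

lemma bump_nonneg: "0 \<le> bump d x" by (simp add: bump_def flat_def)

lemma bump_pos_iff: "d > 0 \<Longrightarrow> bump d x > 0 \<longleftrightarrow> norm x < d"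
  using power2_less_imp_less[of "norm x" d] power_strict_mono[of "norm x" d 2]
  by (auto simp: bump_def flat_def dot_square_norm not_le)

lemma bump_support:
  assumes "d > 0"
  shows "{x. bump d x \<noteq> 0} = ball 0 d"
proof -
  have "bump d x \<noteq> 0 \<longleftrightarrow> norm x < d" for x :: 'a
    using bump_pos_iff[OF assms, of x] bump_nonneg[of d x] by linarith
  then show ?thesis unfolding ball_def by simp
qed

lemma exists_nonzero_test_function: 
  assumes "open \<Omega>" "x0 \<in> \<Omega>"
  shows "\<exists>\<phi>\<in>test_functions \<Omega>. \<phi> \<noteq> (\<lambda>x. 0)"
proof -
  obtain e where e: "e > 0" "cball x0 e \<subseteq> \<Omega>"
    using assms open_contains_cball by blast
  define f where "f = (\<lambda>x. bump e (- x0 + 1 *\<^sub>R x))"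
  have "smooth f" unfolding f_def smooth_def
    using Ck_compose_affine[OF bounded_linear_scaleR_right] smooth_bump unfolding smooth_def by blast
  moreover have "{x. f x \<noteq> 0} = ball x0 e"
  proof -
    have "f x \<noteq> 0 \<longleftrightarrow> norm (- x0 + x) < e" for x
      unfolding f_def using bump_pos_iff[OF e(1), of "- x0 + x"] bump_nonneg[of e "- x0 + x"]
      by (simp add: order.strict_iff_order)
    moreover have "norm (- x0 + x) = dist x0 x" for x by (simp add: dist_norm norm_minus_commute)
    ultimately show ?thesis unfolding ball_def by simp
  qed
  moreover have "closure (ball x0 e) = cball x0 e" using e(1) by simp
  ultimately have "f \<in> test_functions \<Omega>" unfolding test_functions_def mem_Collect_eq using e by (metis compact_cball)
  moreover have "f x0 \<noteq> 0" using \<open>{x. f x \<noteq> 0} = ball x0 e\<close> e(1) centre_in_ball by blast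
  ultimately show ?thesis by (intro bexI[of _ f]) auto
qed

subsection \<open>Mollification\<close>

text \<open>The convolution, with the shift on the smooth factor: differentiation under the integral
  then falls on \<open>\<eta>\<close>, and \<open>k\<close> need only be continuous. The gauge
  integral is the one for which \<open>leibniz_rule\<close> is stated.\<close>

definition mollify :: "('a::euclidean_space \<Rightarrow> real) \<Rightarrow> ('a \<Rightarrow> real) \<Rightarrow> 'a \<Rightarrow> real" where
  "mollify k \<eta> x = integral UNIV (\<lambda>y. k y * \<eta> (x - y))"

text \<open>For \<open>x\<close> near \<open>x0\<close> all contributing \<open>y\<close> lie in one
  fixed box, so that theorems on parameter integrals over a compact box apply.\<close>

lemma mollify_local:
  fixes \<eta> :: "'a::euclidean_space \<Rightarrow> real"
  assumes \<eta>: "\<And>y. norm y > \<rho> \<Longrightarrow> \<eta> y = 0" and ab: "cball x0 (\<rho> + 1) \<subseteq> cbox a b" and x: "x \<in> ball x0 1"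
  shows "mollify k \<eta> x = integral (cbox a b) (\<lambda>y. k y * \<eta> (x - y))"
proof -
  have "(\<lambda>y. k y * \<eta> (x - y)) = (\<lambda>y. if y \<in> cbox a b then k y * \<eta> (x - y) else 0)"
  proof
    fix y
    have "\<eta> (x - y) = 0" if "y \<notin> cbox a b"
    proof (rule \<eta>)
      have "dist x0 y > \<rho> + 1" using that ab by (meson linorder_not_le mem_cball subsetD)
      then show "norm (x - y) > \<rho>" using x dist_triangle[of x0 y x] by (simp add: dist_norm)
    qed
    then show "k y * \<eta> (x - y) = (if y \<in> cbox a b then k y * \<eta> (x - y) else 0)" by simp
  qed
  then show ?thesis unfolding mollify_def using integral_restrict_UNIV by metis
qed

lemma Ck_mollify:
  fixes k :: "'a::euclidean_space \<Rightarrow> real"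
  assumes k: "continuous_on UNIV k"
  shows "Ck n \<eta> \<Longrightarrow> (\<And>y. norm y > \<rho> \<Longrightarrow> \<eta> y = 0) \<Longrightarrow> Ck n (mollify k \<eta>)"
proof (induction n arbitrary: \<eta>)
  case 0
  have "continuous (at x0) (mollify k \<eta>)" for x0
  proof -
    obtain a b where ab: "cball x0 (\<rho> + 1) \<subseteq> cbox a b"
      using bounded_subset_cbox_symmetric[OF bounded_cball] by metis
    have "continuous_on (ball x0 1 \<times> cbox a b) (\<lambda>z. k (snd z) * \<eta> (fst z - snd z))"
    proof (rule continuous_on_mult)
      show "continuous_on (ball x0 1 \<times> cbox a b) (\<lambda>z. k (snd z))"
        by (rule continuous_on_compose2[OF k]) (auto intro!: continuous_intros)
      have "continuous_on UNIV \<eta>" using 0(1) by simp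
      then show "continuous_on (ball x0 1 \<times> cbox a b) (\<lambda>z. \<eta> (fst z - snd z))"
        by (rule continuous_on_compose2) (auto intro!: continuous_intros)
    qed
    then have "continuous_on (ball x0 1) (\<lambda>x. integral (cbox a b) (\<lambda>y. k y * \<eta> (x - y)))"
      by (intro integral_continuous_on_param) (simp add: split_beta)
    then have "continuous_on (ball x0 1) (mollify k \<eta>)"
      by (rule continuous_on_eq) (rule mollify_local[OF 0(2) ab, symmetric])
    then show ?thesis using continuous_on_eq_continuous_at[of "ball x0 1" "mollify k \<eta>"]
      by (metis centre_in_ball open_ball zero_less_one)
  qed
  then show ?case by (simp add: continuous_at_imp_continuous_on)
next
  case (Suc n)
  let ?D = "\<lambda>x. frechet_derivative \<eta> (at x)"
  note d = Ck_SucD(1)[OF Suc.prems(1)]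
  have Dc: "continuous_on UNIV (\<lambda>x. ?D x v)" for v
    using Ck_continuous Ck_SucD(2)[OF Suc.prems(1)] by blast
  \<comment> \<open>The support condition passes to all directional derivatives, with the same
    \<open>\<rho>\<close>; this lets the induction hypothesis be applied to them.\<close>
  have D0: "?D y v = 0" if "norm y > \<rho>" for y v
  proof -
    have "open {y::'a. norm y > \<rho>}" by (intro open_Collect_less continuous_intros)
    then have "(\<eta> has_derivative (\<lambda>v. 0)) (at y)"
      using that Suc.prems(2)
      by (intro has_derivative_transform_within_open[OF has_derivative_const, of "{y. norm y > \<rho>}" _ 0]) auto
    then show ?thesis using frechet_derivative_at by metis
  qed
  have der: "(mollify k \<eta> has_derivative (\<lambda>v. mollify k (\<lambda>y. ?D y v) x0)) (at x0)" for x0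
  proof -
    obtain a b where ab: "cball x0 (\<rho> + 1) \<subseteq> cbox a b"
      using bounded_subset_cbox_symmetric[OF bounded_cball] by metis
    \<comment> \<open>\<open>leibniz_rule\<close> takes the derivative as a bounded linear function,
      so the directional derivatives are packed into one \<open>Blinfun\<close> and continuity is
      checked componentwise.\<close>
    define fx where "fx = (\<lambda>x t. k t *\<^sub>R Blinfun (?D (x - t)))"
    have fx: "blinfun_apply (fx x t) v = k t * ?D (x - t) v" for x t v
      unfolding fx_def using has_derivative_bounded_linear[OF d]
      by (simp add: blinfun.scaleR_left bounded_linear_Blinfun_apply)
    have cont: "continuous_on (ball x0 1 \<times> cbox a b) (\<lambda>(x, t). fx x t)"
    proof (rule continuous_on_blinfun_componentwise)
      fix i :: 'a
      have "continuous_on (ball x0 1 \<times> cbox a b) (\<lambda>z. k (snd z) * ?D (fst z - snd z) i)"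
      proof (rule continuous_on_mult)
        show "continuous_on (ball x0 1 \<times> cbox a b) (\<lambda>z. k (snd z))"
          by (rule continuous_on_compose2[OF k]) (auto intro!: continuous_intros)
        show "continuous_on (ball x0 1 \<times> cbox a b) (\<lambda>z. ?D (fst z - snd z) i)"
          by (rule continuous_on_compose2[OF Dc[of i]]) (auto intro!: continuous_intros)
      qed
      then show "continuous_on (ball x0 1 \<times> cbox a b) (\<lambda>z. (case z of (x, t) \<Rightarrow> fx x t) i)"
        by (simp add: split_beta fx)
    qed
    have "((\<lambda>x. integral (cbox a b) (\<lambda>t. k t * \<eta> (x - t))) has_derivative integral (cbox a b) (fx x0))
        (at x0 within ball x0 1)"
    proof (rule leibniz_rule[OF _ _ cont])
      fix x t assume "x \<in> ball x0 1" "t \<in> cbox a b"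
      have "((\<lambda>x. \<eta> (x - t)) has_derivative ?D (x - t)) (at x within ball x0 1)"
      proof -
        have "((\<lambda>x. x - t) has_derivative (\<lambda>v. v)) (at x within ball x0 1)"
          by (auto intro!: derivative_eq_intros)
        from has_derivative_compose[OF this d] show ?thesis .
      qed
      then have "((\<lambda>x. k t * \<eta> (x - t)) has_derivative (\<lambda>v. k t * ?D (x - t) v)) (at x within ball x0 1)"
        by (rule has_derivative_mult_right)
      moreover have "blinfun_apply (fx x t) = (\<lambda>v. k t * ?D (x - t) v)" using fx by auto
      ultimately show "((\<lambda>x. k t * \<eta> (x - t)) has_derivative blinfun_apply (fx x t)) (at x within ball x0 1)"
        by simp
    next
      fix x assume "x \<in> ball x0 1"
      show "(\<lambda>t. k t * \<eta> (x - t)) integrable_on cbox a b"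
      proof (intro integrable_continuous continuous_on_mult)
        show "continuous_on (cbox a b) k" using continuous_on_subset[OF k] by blast
        show "continuous_on (cbox a b) (\<lambda>t. \<eta> (x - t))"
          using Ck_continuous[OF Suc.prems(1)] by (rule continuous_on_compose2) (auto intro!: continuous_intros)
      qed
    qed auto
    then have 1: "((\<lambda>x. integral (cbox a b) (\<lambda>t. k t * \<eta> (x - t))) has_derivative integral (cbox a b) (fx x0)) (at x0)"
      using at_within_open[of x0 "ball x0 1"] by simp
    have 2: "(mollify k \<eta> has_derivative integral (cbox a b) (fx x0)) (at x0)"
      by (rule has_derivative_transform_within_open[OF 1, of "ball x0 1"])
         (auto simp: mollify_local[OF Suc.prems(2) ab])
    have "blinfun_apply (integral (cbox a b) (fx x0)) v = mollify k (\<lambda>y. ?D y v) x0" for v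
    proof -
      have "continuous_on (cbox a b) (Pair x0)" "Pair x0 ` cbox a b \<subseteq> ball x0 1 \<times> cbox a b"
        by (auto intro!: continuous_intros)
      from continuous_on_compose2[OF cont this] have "continuous_on (cbox a b) (fx x0)" by simp
      then have "blinfun_apply (integral (cbox a b) (fx x0)) v = integral (cbox a b) (\<lambda>t. fx x0 t v)"
        by (intro blinfun_apply_integral integrable_continuous)
      also have "\<dots> = mollify k (\<lambda>y. ?D y v) x0"
        using mollify_local[of \<rho> "\<lambda>y. ?D y v", OF D0 ab] by (simp add: fx)
      finally show ?thesis .
    qed
    then have "blinfun_apply (integral (cbox a b) (fx x0)) = (\<lambda>v. mollify k (\<lambda>y. ?D y v) x0)" by auto
    with 2 show ?thesis by simp
  qed
  have "Ck n (mollify k (\<lambda>y. ?D y v))" for v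
    by (rule Suc.IH[OF Ck_SucD(2)[OF Suc.prems(1)] D0])
  then show ?case
    by (intro Ck_SucI[where f'="\<lambda>x v. mollify k (\<lambda>y. ?D y v) x"] der)
qed

lemma integrable_lborel_continuous_support:
  fixes f :: "'a::euclidean_space \<Rightarrow> real"
  assumes "continuous_on UNIV f" "\<And>y. norm y > \<rho> \<Longrightarrow> f y = 0"
  shows "integrable lborel f"
proof -
  have "integrable lborel (\<lambda>x. indicator (cball 0 \<rho>) x *\<^sub>R f x)"
    by (rule borel_integrable_compact) (use assms in \<open>auto intro: continuous_on_subset\<close>)
  moreover have "(\<lambda>x. indicator (cball 0 \<rho>) x *\<^sub>R f x) = f"
    using assms(2) by (auto simp: fun_eq_iff indicator_def not_le)
  ultimately show ?thesis by simp
qed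

text \<open>The reflection \<open>y\<close> to \<open>x - y\<close> moves the shift onto
  \<open>k\<close>, so that bounds on increments of \<open>k\<close> carry over to its
  mollification.\<close>

lemma mollify_eq:
  fixes k :: "'a::euclidean_space \<Rightarrow> real"
  assumes k: "continuous_on UNIV k" and \<eta>: "continuous_on UNIV \<eta>" "\<And>y. norm y > \<rho> \<Longrightarrow> \<eta> y = 0"
  shows "mollify k \<eta> x = (\<integral>y. k (x - y) * \<eta> y \<partial>lborel)"
proof -
  have 1: "integrable lborel (\<lambda>y. k y * \<eta> (x - y))"
  proof (rule integrable_lborel_continuous_support[of _ "norm x + \<rho>"])
    show "continuous_on UNIV (\<lambda>y. k y * \<eta> (x - y))"
    proof (rule continuous_on_mult[OF k])
      show "continuous_on UNIV (\<lambda>y. \<eta> (x - y))"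
        by (rule continuous_on_compose2[OF \<eta>(1)]) (auto intro!: continuous_intros)
    qed
    show "k y * \<eta> (x - y) = 0" if "norm y > norm x + \<rho>" for y
      using \<eta>(2)[of "x - y"] norm_triangle_sub[of y x] that by (simp add: norm_minus_commute)
  qed
  have "mollify k \<eta> x = (\<integral>y. k y * \<eta> (x - y) \<partial>lborel)"
    unfolding mollify_def using integral_lborel[OF 1] by simp
  also have "\<dots> = (\<integral>y. k y * \<eta> (x - y) \<partial>distr lborel borel (\<lambda>y. x - y))"
    using lborel_affine[of "-1" x] by (simp add: density_1 one_ennreal_def[symmetric])
  also have "\<dots> = (\<integral>y. k (x - y) * \<eta> (x - (x - y)) \<partial>lborel)"
    using borel_measurable_continuous_onI[OF k] borel_measurable_continuous_onI[OF \<eta>(1)]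
    by (subst integral_distr) simp_all
  finally show ?thesis by simp
qed

section \<open>Gradients and local Lipschitz bounds\<close>

lemma grad_inner:
  assumes "f differentiable (at x)"
  shows "grad f x \<bullet> v = frechet_derivative f (at x) v"
proof -
  let ?d = "frechet_derivative f (at x)"
  have l: "linear ?d" using assms linear_frechet_derivative by blast
  have "?d v = ?d (\<Sum>b\<in>Basis. (v \<bullet> b) *\<^sub>R b)" by (simp add: euclidean_representation)
  also have "\<dots> = (\<Sum>b\<in>Basis. (v \<bullet> b) * ?d b)" by (simp add: linear_sum[OF l] linear_scale[OF l])
  finally show ?thesis unfolding grad_def by (simp add: inner_sum_left inner_commute[of v] mult.commute)
qed

text \<open>Difference quotients bound every directional derivative by \<open>L * norm v\<close>;
  taking \<open>v = grad f x\<close> bounds the squared norm of the gradient by \<open>L\<close>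
  times its norm.\<close>

lemma norm_grad_le_lipschitz:
  assumes f: "f differentiable (at x)" and L: "L \<ge> 0" "e > 0"
    and lip: "\<And>y. y \<in> ball x e \<Longrightarrow> \<bar>f y - f x\<bar> \<le> L * norm (y - x)"
  shows "norm (grad f x) \<le> L"
proof -
  let ?d = "frechet_derivative f (at x)"
  have bnd: "?d v \<le> L * norm v" for v
  proof -
    have "((\<lambda>t. f (x + t *\<^sub>R v)) has_derivative (\<lambda>t. ?d (t *\<^sub>R v))) (at 0)"
    proof (rule has_derivative_compose[where f="\<lambda>t::real. x + t *\<^sub>R v" and f'="\<lambda>t. t *\<^sub>R v"])
      show "((\<lambda>t::real. x + t *\<^sub>R v) has_derivative (\<lambda>t. t *\<^sub>R v)) (at 0)"
        by (auto intro!: derivative_eq_intros)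
      show "(f has_derivative ?d) (at (x + 0 *\<^sub>R v))" using f by (simp add: frechet_derivative_works)
    qed
    moreover have "?d (t *\<^sub>R v) = ?d v * t" for t
      using linear_frechet_derivative[OF f] by (simp add: linear_scale)
    ultimately have "((\<lambda>t. f (x + t *\<^sub>R v)) has_real_derivative ?d v) (at 0)"
      by (simp add: has_field_derivative_def mult_commute_abs)
    then have "((\<lambda>h. (f (x + h *\<^sub>R v) - f x) / h) \<longlongrightarrow> ?d v) (at_right 0)"
      by (simp add: DERIV_def filterlim_at_split)
    moreover have "\<forall>\<^sub>F h in at_right 0. (f (x + h *\<^sub>R v) - f x) / h \<le> L * norm v"
    proof -
      \<comment> \<open>Any smaller \<open>h\<close> keeps \<open>x + h v\<close> in the ball; the
        summand 1 covers \<open>v = 0\<close>.\<close>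
      have "e / (norm v + 1) > 0" using L by (simp add: add_nonneg_pos)
      moreover have "(f (x + h *\<^sub>R v) - f x) / h \<le> L * norm v" if h: "h > 0" "h < e / (norm v + 1)" for h
      proof -
        have "h * norm v \<le> h * (norm v + 1)" using h by simp
        also have "\<dots> < e" using h by (simp add: pos_less_divide_eq add_nonneg_pos)
        finally have "x + h *\<^sub>R v \<in> ball x e" using h by (simp add: dist_norm)
        from lip[OF this] h show ?thesis by (simp add: field_simps abs_le_iff)
      qed
      ultimately show ?thesis unfolding eventually_at_right_field by blast
    qed
    ultimately show ?thesis by (intro tendsto_upperbound) auto
  qed
  have "norm (grad f x) * norm (grad f x) = ?d (grad f x)"
    using grad_inner[OF f, of "grad f x"] by (simp add: dot_square_norm power2_eq_square)
  also have "\<dots> \<le> L * norm (grad f x)" by (rule bnd)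
  finally show ?thesis by (metis L(1) mult_right_le_imp_le norm_ge_zero order.order_iff_strict)
qed

subsection \<open>Polar coordinates\<close>

lemma nn_integral_lborel_scaleR:
  fixes f :: "'a::euclidean_space \<Rightarrow> ennreal"
  assumes [measurable]: "f \<in> borel_measurable borel" and s: "s > 0"
  shows "(\<integral>\<^sup>+x. f x \<partial>lborel) = ennreal (s ^ DIM('a)) * (\<integral>\<^sup>+x. f (s *\<^sub>R x) \<partial>lborel)"
proof -
  have "(\<integral>\<^sup>+x. f x \<partial>lborel)
      = (\<integral>\<^sup>+x. f x \<partial>density (distr lborel borel (\<lambda>x. 0 + s *\<^sub>R x)) (\<lambda>_. ennreal (\<bar>s\<bar> ^ DIM('a))))"
    using lborel_affine[of s "0::'a"] s by simp
  also have "\<dots> = (\<integral>\<^sup>+x. ennreal (s ^ DIM('a)) * f (s *\<^sub>R x) \<partial>lborel)"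
    using s by (subst nn_integral_density) (simp_all add: nn_integral_distr)
  finally show ?thesis by (simp add: nn_integral_cmult)
qed

text \<open>The value is independent of \<open>c\<close>. In \<open>nn_integral_polar\<close> it is
  used with \<open>c = k w\<close>, and this is how the gauge disappears from the left-hand
  side.\<close>

lemma nn_integral_power_tail:
  assumes "n > 0" "c > 0"
  shows "(\<integral>\<^sup>+s. indicator {c<..} s * ennreal (c ^ n / s ^ Suc n) \<partial>lborel) = ennreal (1 / n)"
proof -
  have "(\<integral>\<^sup>+s. indicator {c<..} s * ennreal (c ^ n / s ^ Suc n) \<partial>lborel)
      = (\<integral>\<^sup>+s. ennreal (c ^ n / s ^ Suc n) * indicator {c..} s \<partial>lborel)"
    using AE_lborel_singleton[of c]
    by (intro nn_integral_cong_AE) (auto elim!: eventually_mono split: split_indicator)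
  also have "\<dots> = ennreal (0 - (- (c ^ n) / (n * c ^ n)))"
  proof (rule nn_integral_FTC_atLeast[where F="\<lambda>s. - (c ^ n) / (real n * s ^ n)"])
    show "(\<lambda>s. c ^ n / s ^ Suc n) \<in> borel_measurable borel" by measurable
    fix s assume s: "c \<le> s"
    have "n * s ^ (n - Suc 0) * s = n * s ^ n" using assms(1) by (cases n) auto
    then show "((\<lambda>s. - (c ^ n) / (n * s ^ n)) has_real_derivative c ^ n / s ^ Suc n) (at s)"
      using s assms by (auto intro!: derivative_eq_intros simp: field_simps power2_eq_square)
    show "0 \<le> c ^ n / s ^ Suc n" using s assms by simp
  next
    have "((\<lambda>s::real. - (c ^ n) / real n * inverse (s ^ n)) \<longlongrightarrow> - (c ^ n) / real n * 0) at_top"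
      using assms(1)
      by (intro tendsto_intros tendsto_inverse_0_at_top filterlim_pow_at_top filterlim_ident) auto
    then show "((\<lambda>s::real. - (c ^ n) / (real n * s ^ n)) \<longlongrightarrow> 0) at_top"
      by (simp add: field_simps)
  qed
  also have "0 - (- (c ^ n) / (n * c ^ n)) = 1 / n" using assms by simp
  finally show ?thesis .
qed

lemma nn_integral_lborel_swap:
  fixes f :: "'a::euclidean_space \<Rightarrow> 'b::euclidean_space \<Rightarrow> ennreal"
  assumes "case_prod f \<in> borel_measurable (borel \<Otimes>\<^sub>M borel)"
  shows "(\<integral>\<^sup>+x. (\<integral>\<^sup>+y. f x y \<partial>lborel) \<partial>lborel) = (\<integral>\<^sup>+y. (\<integral>\<^sup>+x. f x y \<partial>lborel) \<partial>lborel)"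
proof -
  have "case_prod f \<in> borel_measurable (lborel \<Otimes>\<^sub>M lborel)"
    using assms measurable_cong_sets[OF sets_pair_measure_cong[OF sets_lborel sets_lborel] refl] by blast
  from lborel_pair.Fubini'[OF this] show ?thesis by simp
qed

text \<open>
  Polar coordinates adapted to the gauge \<open>k\<close>. Averaging over directions is expressed by
  integrating a function of the direction over \<open>{k < 1}\<close>, which avoids surface measures.
\<close>

theorem nn_integral_polar:
  fixes k :: "'a::euclidean_space \<Rightarrow> real" and f :: "'a \<Rightarrow> ennreal"
  assumes k[measurable]: "k \<in> borel_measurable borel"
    and hom: "\<And>t x. t > 0 \<Longrightarrow> k (t *\<^sub>R x) = t * k x" and pos: "\<And>x. x \<noteq> 0 \<Longrightarrow> k x > 0"
    and f[measurable]: "f \<in> borel_measurable borel"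
  shows "(\<integral>\<^sup>+x. f x \<partial>lborel) = ennreal DIM('a) *
    (\<integral>\<^sup>+z. indicator {z. k z < 1} z *
      (\<integral>\<^sup>+t. indicator {0<..} t * ennreal (t ^ (DIM('a) - 1)) * f ((t / k z) *\<^sub>R z) \<partial>lborel) \<partial>lborel)"
proof -
  define n where "n = DIM('a)"
  have n: "n > 0" by (simp add: n_def)
  have nz: "AE z::'a in lborel. z \<noteq> 0" by (rule AE_lborel_singleton)
  \<comment> \<open>The substitution \<open>t = s * k z\<close> turns the ray integral into the
    integral of \<open>g z\<close>. For fixed \<open>s\<close>, the dilation \<open>w = s z\<close>
    then turns \<open>g\<close> into \<open>h\<close>: the condition \<open>k z < 1\<close> becomes
    \<open>s > k w\<close>, and the powers combine to \<open>k w ^ n / s ^ Suc n\<close>.\<close>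
  define g where "g = (\<lambda>z s. indicator {z. k z < 1} z * (indicator {0<..} s * ennreal (s ^ (n - 1) * k z ^ n) * f (s *\<^sub>R z)))"
  have [measurable]: "case_prod g \<in> borel_measurable (borel \<Otimes>\<^sub>M borel)" unfolding g_def by measurable
  define h where "h = (\<lambda>w s. indicator {0<..} s * (indicator {k w <..} s * ennreal (k w ^ n / s ^ Suc n) * f w))"
  have [measurable]: "case_prod h \<in> borel_measurable (borel \<Otimes>\<^sub>M borel)"
    unfolding h_def indicator_def greaterThan_iff by measurable
  have inner: "(\<integral>\<^sup>+t. indicator {0<..} t * ennreal (t ^ (n - 1)) * f ((t / k z) *\<^sub>R z) \<partial>lborel)
      = (\<integral>\<^sup>+s. indicator {0<..} s * ennreal (s ^ (n - 1) * k z ^ n) * f (s *\<^sub>R z) \<partial>lborel)"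
    if z: "z \<noteq> 0" for z
  proof -
    have kz: "k z > 0" using pos z by auto
    have p: "k z * k z ^ (n - Suc 0) = k z ^ n" using n by (cases n) auto
    have "(\<integral>\<^sup>+t. indicator {0<..} t * ennreal (t ^ (n - 1)) * f ((t / k z) *\<^sub>R z) \<partial>lborel)
      = ennreal \<bar>k z\<bar> * (\<integral>\<^sup>+s. indicator {0<..} (0 + k z * s) * ennreal ((0 + k z * s) ^ (n - 1)) * f (((0 + k z * s) / k z) *\<^sub>R z) \<partial>lborel)"
      by (rule nn_integral_real_affine) (use kz in auto)
    also have "\<dots> = (\<integral>\<^sup>+s. ennreal (k z) * (indicator {0<..} (0 + k z * s) * ennreal ((0 + k z * s) ^ (n - 1)) * f (((0 + k z * s) / k z) *\<^sub>R z)) \<partial>lborel)"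
      using kz by (subst nn_integral_cmult) auto
    also have "\<dots> = (\<integral>\<^sup>+s. indicator {0<..} s * ennreal (s ^ (n - 1) * k z ^ n) * f (s *\<^sub>R z) \<partial>lborel)"
    proof (rule nn_integral_cong)
      fix s
      show "ennreal (k z) * (indicator {0<..} (0 + k z * s) * ennreal ((0 + k z * s) ^ (n - 1)) * f (((0 + k z * s) / k z) *\<^sub>R z))
        = indicator {0<..} s * ennreal (s ^ (n - 1) * k z ^ n) * f (s *\<^sub>R z)"
      proof (cases "s > 0")
        case True
        have "ennreal (k z) * ennreal ((k z * s) ^ (n - 1)) = ennreal (s ^ (n - 1) * k z ^ n)"
          using kz True by (simp add: ennreal_mult[symmetric] power_mult_distrib p[symmetric] mult_ac)
        then show ?thesis using kz True by (simp add: mult.assoc[symmetric])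
      next
        case False
        then show ?thesis using kz by (simp add: zero_less_mult_iff)
      qed
    qed
    finally show ?thesis .
  qed
  have gh: "(\<integral>\<^sup>+z. g z s \<partial>lborel) = (\<integral>\<^sup>+w. h w s \<partial>lborel)" for s
  proof (cases "s > 0")
    case False then show ?thesis by (simp add: g_def h_def)
  next
    case True
    have "(\<integral>\<^sup>+w. h w s \<partial>lborel) = ennreal (s ^ n) * (\<integral>\<^sup>+z. h (s *\<^sub>R z) s \<partial>lborel)"
      unfolding n_def by (rule nn_integral_lborel_scaleR[OF _ True]) measurable
    also have "\<dots> = (\<integral>\<^sup>+z. ennreal (s ^ n) * h (s *\<^sub>R z) s \<partial>lborel)"
      by (subst nn_integral_cmult) auto
    also have "\<dots> = (\<integral>\<^sup>+z. g z s \<partial>lborel)"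
    proof (rule nn_integral_cong_AE)
      show "AE z in lborel. ennreal (s ^ n) * h (s *\<^sub>R z) s = g z s"
        using nz
      proof eventually_elim
        case (elim z)
        have kz: "k z > 0" using pos elim by auto
        have p: "s * s ^ (n - Suc 0) = s ^ n" using n by (cases n) auto
        have "ennreal (s ^ n) * ennreal ((s * k z) ^ n / s ^ Suc n) = ennreal (s ^ (n - 1) * k z ^ n)"
          using kz True by (simp add: ennreal_mult[symmetric] power_mult_distrib p[symmetric] field_simps)
        then show ?case using True by (simp add: g_def h_def hom mult.assoc[symmetric] split: split_indicator)
      qed
    qed
    finally show ?thesis by simp
  qed
  have hw: "(\<integral>\<^sup>+s. h w s \<partial>lborel) = ennreal (1 / n) * f w" if "w \<noteq> 0" for w
  proof -
    have kw: "k w > 0" using pos that by auto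
    have "(\<integral>\<^sup>+s. h w s \<partial>lborel) = (\<integral>\<^sup>+s. indicator {k w<..} s * ennreal (k w ^ n / s ^ Suc n) * f w \<partial>lborel)"
      using kw by (intro nn_integral_cong) (auto simp: h_def split: split_indicator)
    also have "\<dots> = (\<integral>\<^sup>+s. indicator {k w<..} s * ennreal (k w ^ n / s ^ Suc n) \<partial>lborel) * f w"
      by (rule nn_integral_multc) measurable
    finally show ?thesis using nn_integral_power_tail[OF n kw] by simp
  qed
  have "(\<integral>\<^sup>+z. indicator {z. k z < 1} z * (\<integral>\<^sup>+t. indicator {0<..} t * ennreal (t ^ (n - 1)) * f ((t / k z) *\<^sub>R z) \<partial>lborel) \<partial>lborel)
      = (\<integral>\<^sup>+z. (\<integral>\<^sup>+s. g z s \<partial>lborel) \<partial>lborel)"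
    using nz inner by (intro nn_integral_cong_AE) (auto elim!: eventually_mono simp: g_def nn_integral_cmult)
  also have "\<dots> = (\<integral>\<^sup>+s. (\<integral>\<^sup>+z. g z s \<partial>lborel) \<partial>lborel)" by (rule nn_integral_lborel_swap) measurable
  also have "\<dots> = (\<integral>\<^sup>+s. (\<integral>\<^sup>+w. h w s \<partial>lborel) \<partial>lborel)" by (simp add: gh)
  also have "\<dots> = (\<integral>\<^sup>+w. (\<integral>\<^sup>+s. h w s \<partial>lborel) \<partial>lborel)" by (rule nn_integral_lborel_swap[symmetric]) measurable
  also have "\<dots> = (\<integral>\<^sup>+w. ennreal (1 / n) * f w \<partial>lborel)"
    using nz by (intro nn_integral_cong_AE) (auto elim!: eventually_mono simp: hw)
  also have "\<dots> = ennreal (1 / n) * (\<integral>\<^sup>+w. f w \<partial>lborel)" by (rule nn_integral_cmult) measurable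
  finally have *: "(\<integral>\<^sup>+z. indicator {z. k z < 1} z *
      (\<integral>\<^sup>+t. indicator {0<..} t * ennreal (t ^ (n - 1)) * f ((t / k z) *\<^sub>R z) \<partial>lborel) \<partial>lborel)
    = ennreal (1 / n) * (\<integral>\<^sup>+w. f w \<partial>lborel)" .
  have "ennreal n * (ennreal (1 / n) * F) = F" for F
  proof -
    have "ennreal n * ennreal (1 / n) = 1" using n by (subst ennreal_mult[symmetric]) auto
    then show ?thesis by (metis mult.assoc mult_1)
  qed
  with * show ?thesis unfolding n_def by simp
qed

subsection \<open>Energy, mass and scaling\<close>

text \<open>Integrating over the whole space, here and in \<open>mass\<close>, removes \<Omega> from
  the functionals; \<Omega> then enters \<open>lambda2\<close> only through the class of test
  functions.\<close>

definition energy :: "('a::euclidean_space \<Rightarrow> real) \<Rightarrow> real" where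
  "energy \<phi> = (\<integral>x. (norm (grad \<phi> x))\<^sup>2 \<partial>lborel)"

definition mass :: "real \<Rightarrow> ('a::euclidean_space \<Rightarrow> real) \<Rightarrow> real" where
  "mass q \<phi> = (\<integral>x. \<bar>\<phi> x\<bar> powr q \<partial>lborel)"

lemma energy_nonneg: "0 \<le> energy \<phi>" and mass_nonneg: "0 \<le> mass q \<phi>"
  by (simp_all add: energy_def mass_def)

lemma smooth_differentiable: "smooth \<phi> \<Longrightarrow> \<phi> differentiable (at x)"
  unfolding smooth_def by (metis Ck.simps(2))

lemma smooth_continuous: "smooth \<phi> \<Longrightarrow> continuous_on UNIV \<phi>"
  unfolding smooth_def using Ck_continuous by blast

lemma smooth_continuous_grad: "smooth \<phi> \<Longrightarrow> continuous_on UNIV (grad \<phi>)"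
  unfolding grad_def[abs_def] smooth_def
  by (intro continuous_intros) (metis Ck.simps)

lemma smooth_borel_measurable:
  assumes "smooth \<phi>"
  shows "\<phi> \<in> borel_measurable borel" "grad \<phi> \<in> borel_measurable borel"
  by (rule borel_measurable_continuous_onI[OF smooth_continuous[OF assms]]
           borel_measurable_continuous_onI[OF smooth_continuous_grad[OF assms]])+

lemma grad_eq_0_outside_support:
  assumes "x \<notin> closure {x. \<phi> x \<noteq> 0}"
  shows "\<phi> x = 0" "grad \<phi> x = 0"
proof -
  show "\<phi> x = 0" using assms closure_subset[of "{x. \<phi> x \<noteq> 0}"] by blast
  have "(\<phi> has_derivative (\<lambda>v. 0)) (at x)"
  proof (rule has_derivative_transform_within_open[OF has_derivative_const])
    show "open (- closure {x. \<phi> x \<noteq> 0})" by blast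
    show "0 = \<phi> y" if "y \<in> - closure {x. \<phi> x \<noteq> 0}" for y
      using that closure_subset[of "{x. \<phi> x \<noteq> 0}"] by auto
  qed (use assms in auto)
  then have "frechet_derivative \<phi> (at x) = (\<lambda>v. 0)" using frechet_derivative_at by metis
  then show "grad \<phi> x = 0" by (simp add: grad_def)
qed

lemma test_functionsD:
  assumes "\<phi> \<in> test_functions \<Omega>"
  shows "smooth \<phi>" "x \<notin> \<Omega> \<Longrightarrow> \<phi> x = 0" "x \<notin> \<Omega> \<Longrightarrow> grad \<phi> x = 0"
  using assms grad_eq_0_outside_support[of x \<phi>] by (auto simp: test_functions_def)

lemma test_functions_bounded_support:
  assumes "\<phi> \<in> test_functions \<Omega>"
  obtains \<rho> where "\<And>x. norm x > \<rho> \<Longrightarrow> \<phi> x = 0" "\<And>x. norm x > \<rho> \<Longrightarrow> grad \<phi> x = 0"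
proof -
  have "bounded (closure {x. \<phi> x \<noteq> 0})"
    using assms compact_imp_bounded by (auto simp: test_functions_def)
  then obtain \<rho> where "\<And>x. x \<in> closure {x. \<phi> x \<noteq> 0} \<Longrightarrow> norm x \<le> \<rho>"
    unfolding bounded_iff by blast
  then show thesis using grad_eq_0_outside_support[of _ \<phi>] that by (meson not_le)
qed

lemma test_functions_integrable:
  assumes "\<phi> \<in> test_functions \<Omega>"
  shows "integrable lborel (\<lambda>x. (norm (grad \<phi> x))\<^sup>2)" "q > 0 \<Longrightarrow> integrable lborel (\<lambda>x. \<bar>\<phi> x\<bar> powr q)"
proof -
  obtain \<rho> where \<rho>: "\<And>x. norm x > \<rho> \<Longrightarrow> \<phi> x = 0" "\<And>x. norm x > \<rho> \<Longrightarrow> grad \<phi> x = 0"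
    by (rule test_functions_bounded_support[OF assms]) blast
  note s = test_functionsD(1)[OF assms]
  show "integrable lborel (\<lambda>x. (norm (grad \<phi> x))\<^sup>2)"
    by (rule integrable_lborel_continuous_support[of _ \<rho>])
       (auto intro!: continuous_intros smooth_continuous_grad[OF s] simp: \<rho>)
  show "q > 0 \<Longrightarrow> integrable lborel (\<lambda>x. \<bar>\<phi> x\<bar> powr q)"
  proof (rule integrable_lborel_continuous_support[of _ \<rho>])
    assume "q > 0"
    then show "continuous_on UNIV (\<lambda>x. \<bar>\<phi> x\<bar> powr q)"
      by (intro continuous_on_powr' continuous_on_rabs smooth_continuous[OF s] continuous_on_const) auto
  qed (simp add: \<rho>)
qed

section \<open>The Rayleigh quotient and its infimum\<close>

lemma lambda2_eq_INF:
  assumes "q > 0"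
  shows "lambda2 q \<Omega> = (INF \<phi>\<in>test_functions \<Omega> - {\<lambda>x. 0}. energy \<phi> / mass q \<phi> powr (2 / q))"
  unfolding lambda2_def
proof (intro INF_cong refl)
  fix \<phi> assume \<phi>: "\<phi> \<in> test_functions \<Omega> - {\<lambda>x. 0}"
  then have t: "\<phi> \<in> test_functions \<Omega>" by simp
  note m [measurable] = smooth_borel_measurable[OF test_functionsD(1)[OF t]]
  have "(LINT x:\<Omega>|lebesgue. (norm (grad \<phi> x))\<^sup>2) = (LINT x|lebesgue. (norm (grad \<phi> x))\<^sup>2)"
    unfolding set_lebesgue_integral_def
    using test_functionsD(3)[OF t] by (intro Bochner_Integration.integral_cong) (auto simp: indicator_def)
  also have "\<dots> = energy \<phi>" unfolding energy_def by (intro integral_completion) measurable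
  finally have 1: "(LINT x:\<Omega>|lebesgue. (norm (grad \<phi> x))\<^sup>2) = energy \<phi>" .
  have "(LINT x:\<Omega>|lebesgue. \<bar>\<phi> x\<bar> powr q) = (LINT x|lebesgue. \<bar>\<phi> x\<bar> powr q)"
    unfolding set_lebesgue_integral_def
    using test_functionsD(2)[OF t] by (intro Bochner_Integration.integral_cong) (auto simp: indicator_def)
  also have "\<dots> = mass q \<phi>" unfolding mass_def by (intro integral_completion) measurable
  finally show "(LINT x:\<Omega>|lebesgue. (norm (grad \<phi> x))\<^sup>2) / (LINT x:\<Omega>|lebesgue. \<bar>\<phi> x\<bar> powr q) powr (2 / q)
      = energy \<phi> / mass q \<phi> powr (2 / q)" using 1 by simp
qed

text \<open>If the integral were 0, the set where \<phi> does not vanish would be both open and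
  negligible, hence empty.\<close>

lemma mass_pos:
  assumes t: "\<phi> \<in> test_functions \<Omega>" and ne: "\<phi> \<noteq> (\<lambda>x. 0)" and q: "q > 0"
  shows "mass q \<phi> > 0"
proof (rule ccontr)
  assume "\<not> mass q \<phi> > 0"
  then have "mass q \<phi> = 0" using mass_nonneg[of q \<phi>] by simp
  then have "AE x in lborel. \<bar>\<phi> x\<bar> powr q = 0"
    unfolding mass_def using test_functions_integrable(2)[OF t q]
    by (subst (asm) integral_nonneg_eq_0_iff_AE) auto
  then have "AE x in lborel. x \<notin> {x. \<phi> x \<noteq> 0}" by simp
  moreover have "open {x. \<phi> x \<noteq> 0}"
    using smooth_continuous[OF test_functionsD(1)[OF t]] open_Collect_neq[of \<phi> "\<lambda>x. 0"] by simp
  ultimately have "{x. \<phi> x \<noteq> 0} \<in> null_sets lborel" by (subst AE_iff_null_sets) auto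
  then have "negligible {x. \<phi> x \<noteq> 0}" 
    using negligible_iff_null_sets null_sets_completionI by blast
  then have "{x. \<phi> x \<noteq> 0} = {}" using \<open>open {x. \<phi> x \<noteq> 0}\<close> open_not_negligible by blast
  with ne show False by auto
qed

text \<open>Cleared of its denominator, the bound also covers the zero function, whose
  \<open>mass\<close> is 0 and for which \<open>0 powr (2 / q)\<close> is 0.\<close>

lemma lambda2_mult_le_energy:
  assumes t: "\<phi> \<in> test_functions \<Omega>" and q: "q > 0"
  shows "lambda2 q \<Omega> * mass q \<phi> powr (2 / q) \<le> energy \<phi>"
proof (cases "\<phi> = (\<lambda>x. 0)")
  case True
  then show ?thesis using energy_nonneg[of \<phi>] q by (simp add: mass_def)
next
  case False
  have "bdd_below ((\<lambda>\<phi>. energy \<phi> / mass q \<phi> powr (2 / q)) ` (test_functions \<Omega> - {\<lambda>x. 0}))"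
    by (rule bdd_belowI2[of _ 0]) (simp add: energy_nonneg)
  then have "lambda2 q \<Omega> \<le> energy \<phi> / mass q \<phi> powr (2 / q)"
    unfolding lambda2_eq_INF[OF q] using t False by (intro cINF_lower) auto
  then show ?thesis using mass_pos[OF t False q] by (simp add: field_simps)
qed

lemma le_lambda2I:
  assumes "open \<Omega>" "\<Omega> \<noteq> {}" and q: "q > 0"
    and le: "\<And>\<phi>. \<phi> \<in> test_functions \<Omega> \<Longrightarrow> c * mass q \<phi> powr (2 / q) \<le> energy \<phi>"
  shows "c \<le> lambda2 q \<Omega>"
  unfolding lambda2_eq_INF[OF q]
proof (rule cINF_greatest)
  show "test_functions \<Omega> - {\<lambda>x. 0} \<noteq> {}" using exists_nonzero_test_function assms(1,2) by blast
  fix \<phi> assume \<phi>: "\<phi> \<in> test_functions \<Omega> - {\<lambda>x. 0}"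
  then show "c \<le> energy \<phi> / mass q \<phi> powr (2 / q)"
    using le[of \<phi>] mass_pos[of \<phi> \<Omega> q] q by (simp add: field_simps)
qed

lemma lambda2_nonneg: "open \<Omega> \<Longrightarrow> \<Omega> \<noteq> {} \<Longrightarrow> q > 0 \<Longrightarrow> 0 \<le> lambda2 q \<Omega>"
  by (rule le_lambda2I) (auto simp: energy_nonneg)

lemma lambda2_antimono:
  assumes "open \<Omega>" "\<Omega> \<noteq> {}" "q > 0" "\<Omega> \<subseteq> \<Omega>'"
  shows "lambda2 q \<Omega>' \<le> lambda2 q \<Omega>"
  by (rule le_lambda2I[OF assms(1-3)], rule lambda2_mult_le_energy)
     (use assms in \<open>auto simp: test_functions_def\<close>)

section \<open>Similarities and balls\<close>

lemma lborel_integral_affine: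
  fixes f :: "'a::euclidean_space \<Rightarrow> real"
  assumes [measurable]: "f \<in> borel_measurable borel" and r: "r > 0"
  shows "(\<integral>x. f x \<partial>lborel) = r ^ DIM('a) * (\<integral>x. f (c + r *\<^sub>R x) \<partial>lborel)"
proof -
  have "(\<integral>x. f x \<partial>lborel)
      = (\<integral>x. f x \<partial>density (distr lborel borel (\<lambda>x. c + r *\<^sub>R x)) (\<lambda>_. ennreal (\<bar>r\<bar> ^ DIM('a))))"
    using lborel_affine[of r c] r by simp
  also have "\<dots> = (\<integral>x. r ^ DIM('a) * f (c + r *\<^sub>R x) \<partial>lborel)"
    using r by (subst integral_density) (simp_all add: integral_distr)
  finally show ?thesis by simp
qed

lemma grad_affine:
  assumes "\<phi> differentiable (at (c + r *\<^sub>R x))"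
  shows "grad (\<lambda>x. \<phi> (c + r *\<^sub>R x)) x = r *\<^sub>R grad \<phi> (c + r *\<^sub>R x)"
proof -
  let ?d = "frechet_derivative \<phi> (at (c + r *\<^sub>R x))"
  have a: "((\<lambda>x. c + r *\<^sub>R x) has_derivative (\<lambda>v. r *\<^sub>R v)) (at x)"
    by (auto intro!: derivative_eq_intros)
  have "(\<phi> has_derivative ?d) (at (c + r *\<^sub>R x))" using assms by (simp add: frechet_derivative_works)
  from has_derivative_compose[OF a this]
  have "frechet_derivative (\<lambda>x. \<phi> (c + r *\<^sub>R x)) (at x) = (\<lambda>v. ?d (r *\<^sub>R v))"
    using frechet_derivative_at by metis
  also have "\<dots> = (\<lambda>v. r * ?d v)"
    using linear_scale[OF linear_frechet_derivative[OF assms]] by auto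
  finally show ?thesis by (simp add: grad_def scaleR_sum_right)
qed

lemma test_functions_affine:
  assumes t: "\<phi> \<in> test_functions ((\<lambda>x. c + r *\<^sub>R x) ` \<Omega>)" and r: "r > 0"
  shows "(\<lambda>x. \<phi> (c + r *\<^sub>R x)) \<in> test_functions \<Omega>"
proof -
  let ?T = "\<lambda>x. c + r *\<^sub>R x" and ?S = "\<lambda>y. (1 / r) *\<^sub>R (y - c)"
  let ?K = "closure {x. \<phi> x \<noteq> 0}"
  have sm: "smooth (\<lambda>x. \<phi> (c + r *\<^sub>R x))"
    unfolding smooth_def using Ck_compose_affine[OF bounded_linear_scaleR_right] test_functionsD(1)[OF t]
    unfolding smooth_def by blast
  have cK: "compact (?S ` ?K)"
    using t by (intro compact_continuous_image continuous_intros) (auto simp: test_functions_def)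
  have ST: "?S (?T x) = x" for x using r by simp
  have "{x. \<phi> (?T x) \<noteq> 0} \<subseteq> ?S ` ?K"
  proof
    fix x assume "x \<in> {x. \<phi> (?T x) \<noteq> 0}"
    then have "?T x \<in> ?K" using closure_subset[of "{x. \<phi> x \<noteq> 0}"] by auto
    then show "x \<in> ?S ` ?K" using ST by (metis imageI)
  qed
  then have sub: "closure {x. \<phi> (?T x) \<noteq> 0} \<subseteq> ?S ` ?K"
    using cK closure_minimal compact_imp_closed by blast
  moreover have "?S ` ?K \<subseteq> \<Omega>"
  proof -
    have "?K \<subseteq> ?T ` \<Omega>" using t by (simp add: test_functions_def)
    then have "?S ` ?K \<subseteq> ?S ` ?T ` \<Omega>" by blast
    also have "\<dots> = \<Omega>" unfolding image_image ST by simp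
    finally show ?thesis .
  qed
  moreover have "compact (closure {x. \<phi> (?T x) \<noteq> 0})"
    using sub cK by (meson closed_closure compact_Int_closed inf.absorb_iff2 bounded_subset compact_eq_bounded_closed)
  ultimately show ?thesis using sm by (auto simp: test_functions_def)
qed

text \<open>The energy scales like r^(N - 2) and the mass like r^N, the latter raised to 2/q. The
  reverse inequality comes from the inverse similarity.\<close>

lemma lambda2_affine_le:
  fixes \<Omega> :: "'a::euclidean_space set"
  assumes "open \<Omega>" "\<Omega> \<noteq> {}" and q: "q > 0" and r: "r > 0"
  shows "lambda2 q \<Omega> * r powr (real DIM('a) - 2 - real DIM('a) * (2 / q)) \<le> lambda2 q ((\<lambda>x. c + r *\<^sub>R x) ` \<Omega>)"
proof (rule le_lambda2I[OF _ _ q])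
  have "(\<lambda>x. c + r *\<^sub>R x) ` \<Omega> = (+) c ` (\<lambda>x. r *\<^sub>R x) ` \<Omega>" by (auto simp: image_image)
  then show "open ((\<lambda>x. c + r *\<^sub>R x) ` \<Omega>)"
    using open_translation[OF open_scaling[of r \<Omega>]] assms by simp
  show "(\<lambda>x. c + r *\<^sub>R x) ` \<Omega> \<noteq> {}" using assms by simp
  fix \<phi> assume t: "\<phi> \<in> test_functions ((\<lambda>x. c + r *\<^sub>R x) ` \<Omega>)"
  let ?\<psi> = "\<lambda>x. \<phi> (c + r *\<^sub>R x)" and ?N = "real DIM('a)"
  note sm = test_functionsD(1)[OF t]
  note m [measurable] = smooth_borel_measurable[OF sm]
  have M: "mass q \<phi> = r powr ?N * mass q ?\<psi>"
    unfolding mass_def using r by (subst lborel_integral_affine[OF _ r, of _ c]) (auto simp: powr_realpow)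
  have E: "r\<^sup>2 * energy \<phi> = r powr ?N * energy ?\<psi>"
  proof -
    have "(norm (grad ?\<psi> x))\<^sup>2 = r\<^sup>2 * (norm (grad \<phi> (c + r *\<^sub>R x)))\<^sup>2" for x
      by (simp add: grad_affine smooth_differentiable[OF sm] power_mult_distrib)
    then show ?thesis
      unfolding energy_def using r
      by (subst lborel_integral_affine[OF _ r, of _ c]) (auto simp: powr_realpow)
  qed
  have "lambda2 q \<Omega> * r powr (?N - 2 - ?N * (2 / q)) * mass q \<phi> powr (2 / q)
      = r powr (?N - 2) * (lambda2 q \<Omega> * mass q ?\<psi> powr (2 / q))"
    unfolding M using r mass_nonneg[of q ?\<psi>] by (simp add: powr_mult powr_powr powr_diff powr_add powr_numeral field_simps)
  also have "\<dots> \<le> r powr (?N - 2) * energy ?\<psi>"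
    by (intro mult_left_mono lambda2_mult_le_energy[OF test_functions_affine[OF t r] q]) simp
  also have "\<dots> = energy \<phi>" using E r by (simp add: powr_diff field_simps)
  finally show "lambda2 q \<Omega> * r powr (?N - 2 - ?N * (2 / q)) * mass q \<phi> powr (2 / q) \<le> energy \<phi>" .
qed

lemma lambda2_affine:
  fixes \<Omega> :: "'a::euclidean_space set"
  assumes "open \<Omega>" "\<Omega> \<noteq> {}" and q: "q > 0" and r: "r > 0"
  shows "lambda2 q ((\<lambda>x. c + r *\<^sub>R x) ` \<Omega>) = lambda2 q \<Omega> * r powr (real DIM('a) - 2 - real DIM('a) * (2 / q))"
proof (rule antisym)
  let ?\<Omega> = "(\<lambda>x. c + r *\<^sub>R x) ` \<Omega>" and ?p = "real DIM('a) - 2 - real DIM('a) * (2 / q)"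
  have "?\<Omega> = (+) c ` (\<lambda>x. r *\<^sub>R x) ` \<Omega>" by (auto simp: image_image)
  then have o: "open ?\<Omega>" using open_translation[OF open_scaling[of r \<Omega>]] assms by simp
  have "(\<lambda>x. - ((1 / r) *\<^sub>R c) + (1 / r) *\<^sub>R x) ` ?\<Omega> = \<Omega>"
    using r by (simp add: image_image scaleR_add_right)
  then have "lambda2 q ?\<Omega> * (1 / r) powr ?p \<le> lambda2 q \<Omega>"
    using lambda2_affine_le[OF o _ q, of "1 / r" "- ((1 / r) *\<^sub>R c)"] assms by simp
  then show "lambda2 q ?\<Omega> \<le> lambda2 q \<Omega> * r powr ?p"
    using r by (simp add: powr_divide field_simps)
qed (rule lambda2_affine_le[OF assms])

lemma measure_lebesgue_ball:
  "r \<ge> 0 \<Longrightarrow> measure lebesgue (ball (c::'a::euclidean_space) r) = measure lebesgue (ball (0::'a) 1) * r ^ DIM('a)"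
  by (simp add: content_ball)

lemma ball_affine: "r > 0 \<Longrightarrow> ball (c::'a::euclidean_space) r = (\<lambda>x. c + r *\<^sub>R x) ` ball 0 1"
proof -
  assume r: "r > 0"
  have "(\<lambda>x. c + r *\<^sub>R x) ` ball 0 1 = (+) c ` (*\<^sub>R) r ` ball 0 1" by (simp add: image_image)
  also have "(*\<^sub>R) r ` ball (0::'a) 1 = ball 0 r" using ball_scale[of r "0::'a" 1] r by simp
  also have "(+) c ` ball 0 r = ball c r" using ball_translation[of c 0 r] by simp
  finally show ?thesis by simp
qed

lemma lambda2_ball:
  fixes c :: "'a::euclidean_space"
  assumes q: "q > 0" and r: "r > 0"
  shows "lambda2 q (ball c r) * measure lebesgue (ball c r) powr ((2 - q) / q)
    = measure lebesgue (ball (0::'a) 1) powr ((2 - q) / q) * lambda2 q (ball (0::'a) 1) / r\<^sup>2"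
proof -
  let ?N = "real DIM('a)" and ?w = "measure lebesgue (ball (0::'a) 1)"
  have l: "lambda2 q (ball c r) = lambda2 q (ball (0::'a) 1) * r powr (?N - 2 - ?N * (2 / q))"
    unfolding ball_affine[OF r] by (rule lambda2_affine[OF _ _ q r]) auto
  have m: "measure lebesgue (ball c r) powr ((2 - q) / q) = ?w powr ((2 - q) / q) * r powr (?N * ((2 - q) / q))"
    using measure_lebesgue_ball[of r c] r by (simp add: powr_mult powr_realpow[symmetric] powr_powr)
  \<comment> \<open>The power of the volume contributes 2 N / q - N, so that all terms with N cancel
    and only r^(-2) is left.\<close>
  have "r powr (?N - 2 - ?N * (2 / q)) * r powr (?N * ((2 - q) / q)) = r powr (-2)"
    using q by (simp add: powr_add[symmetric] field_simps)
  also have "\<dots> = 1 / r\<^sup>2" using r by (simp add: powr_minus field_simps powr_numeral)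
  finally have e: "r powr (?N - 2 - ?N * (2 / q)) * r powr (?N * ((2 - q) / q)) = 1 / r\<^sup>2" .
  have "lambda2 q (ball c r) * measure lebesgue (ball c r) powr ((2 - q) / q)
    = ?w powr ((2 - q) / q) * lambda2 q (ball (0::'a) 1) * (r powr (?N - 2 - ?N * (2 / q)) * r powr (?N * ((2 - q) / q)))"
    unfolding l m by (simp add: mult_ac)
  then show ?thesis unfolding e by simp
qed

lemma inradius_ball:
  fixes c :: "'a::euclidean_space"
  assumes "r > 0"
  shows "inradius (ball c r) = r"
proof (rule antisym)
  note b = ball_inradius[of "ball c r", OF open_ball bounded_ball]
  show "r \<le> inradius (ball c r)" using b(3)[of r c] assms by simp
  obtain x where "ball x (inradius (ball c r)) \<subseteq> ball c r" using b(2) assms by auto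
  then show "inradius (ball c r) \<le> r" using b(1) assms
    by (simp add: ball_subset_ball_iff) (use zero_le_dist[of x c] in linarith)
qed

lemma measure_lebesgue_open_pos:
  assumes "open S" "S \<noteq> {}" "bounded S"
  shows "measure lebesgue S > 0"
  by (metis assms bounded_set_imp_lmeasurable lmeasurable_open negligible_iff_measure open_not_negligible zero_less_measure_iff)

text \<open>Removing the closed ball leaves an open set. If it is nonempty it adds positive measure;
  if it is empty, the open set \<Omega> lies in the interior of the closed ball.\<close>

lemma open_eq_ball_if_measure_eq:
  fixes \<Omega> :: "'a::euclidean_space set"
  assumes "open \<Omega>" "bounded \<Omega>" and sub: "ball c r \<subseteq> \<Omega>" and le: "measure lebesgue \<Omega> \<le> measure lebesgue (ball c r)"
  shows "r \<le> 0 \<or> \<Omega> = ball c r"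
proof (rule ccontr)
  assume "\<not> ?thesis"
  then have r: "r > 0" and ne: "\<Omega> \<noteq> ball c r" by auto
  let ?D = "\<Omega> - cball c r"
  have "?D \<noteq> {}"
  proof
    assume "?D = {}"
    then have "\<Omega> \<subseteq> interior (cball c r)" using assms(1) by (intro interior_maximal) auto
    then show False using sub ne by auto
  qed
  then have "measure lebesgue ?D > 0"
    using assms by (intro measure_lebesgue_open_pos) (auto intro: bounded_subset)
  moreover have "measure lebesgue (ball c r \<union> ?D) = measure lebesgue (ball c r) + measure lebesgue ?D"
  proof -
    have "ball c r \<inter> ?D = {}" by auto
    moreover have "?D \<in> lmeasurable" using assms by (intro lmeasurable_open) (auto intro: bounded_subset)
    ultimately show ?thesis using measure_Un3[of "ball c r" lebesgue ?D] by simp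
  qed
  moreover have "measure lebesgue (ball c r \<union> ?D) \<le> measure lebesgue \<Omega>"
    using assms by (intro measure_mono_fmeasurable) (auto intro: lmeasurable_open)
  ultimately show False using le by linarith
qed

subsection \<open>Positivity of \<open>\<lambda>\<close> for the ball\<close>

lemma weighted_am_gm3:
  fixes a b c :: real
  assumes abc: "a \<ge> 0" "b \<ge> 0" "c \<ge> 0" and w: "\<alpha> \<ge> 0" "\<beta> \<ge> 0" "\<gamma> \<ge> 0" "\<alpha> + \<beta> + \<gamma> = 1"
  shows "a powr \<alpha> * b powr \<beta> * c powr \<gamma> \<le> \<alpha> * a + \<beta> * b + \<gamma> * c"
proof (cases "a > 0 \<and> b > 0 \<and> c > 0")
  case False
  then have "a = 0 \<or> b = 0 \<or> c = 0" using abc by auto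
  \<comment> \<open>\<open>0 powr \<alpha>\<close> is 0 for every exponent, including \<alpha> = 0,
    so one vanishing base suffices.\<close>
  then have "a powr \<alpha> * b powr \<beta> * c powr \<gamma> = 0" by auto
  also have "0 \<le> \<alpha> * a + \<beta> * b + \<gamma> * c" using abc w by (intro add_nonneg_nonneg mult_nonneg_nonneg)
  finally show ?thesis .
next
  case True
  define S where "S = \<alpha> * a + \<beta> * b + \<gamma> * c"
  have "S > 0"
  proof -
    have "\<alpha> > 0 \<or> \<beta> > 0 \<or> \<gamma> > 0" using w by linarith
    then have "\<alpha> * a > 0 \<or> \<beta> * b > 0 \<or> \<gamma> * c > 0" using True by auto
    moreover have "\<alpha> * a \<ge> 0" "\<beta> * b \<ge> 0" "\<gamma> * c \<ge> 0" using True w by auto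
    ultimately show ?thesis unfolding S_def by linarith
  qed
  \<comment> \<open>Tangent line of \<open>ln\<close> at the weighted mean \<open>S\<close>; summed
    with the weights, the linear terms cancel.\<close>
  have l: "ln x \<le> x / S - 1 + ln S" if "x > 0" for x
    using ln_le_minus_one[of "x / S"] that \<open>S > 0\<close> by (simp add: ln_div)
  have "\<alpha> * ln a + \<beta> * ln b + \<gamma> * ln c
      \<le> \<alpha> * (a / S - 1 + ln S) + \<beta> * (b / S - 1 + ln S) + \<gamma> * (c / S - 1 + ln S)"
    using True w by (intro add_mono mult_left_mono l) auto
  also have "\<dots> = (\<alpha> * a + \<beta> * b + \<gamma> * c) / S + (\<alpha> + \<beta> + \<gamma>) * (ln S - 1)"
    by (simp add: field_simps add_divide_distrib)
  also have "\<dots> = ln S" using w \<open>S > 0\<close> by (simp add: S_def[symmetric])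
  finally have "exp (\<alpha> * ln a + \<beta> * ln b + \<gamma> * ln c) \<le> S"
    using \<open>S > 0\<close> by (metis exp_le_cancel_iff exp_ln)
  then show ?thesis using True by (simp add: powr_def exp_add S_def)
qed

lemma ennreal_lincomb3:
  assumes "0 \<le> a" "0 \<le> b" "0 \<le> c" "0 \<le> x" "0 \<le> y" "0 \<le> z"
  shows "ennreal a * ennreal x + ennreal b * ennreal y + ennreal c * ennreal z = ennreal (a * x + b * y + c * z)"
  using assms by (simp add: ennreal_mult)

text \<open>Normalise the three integrals to 1, apply \<open>weighted_am_gm3\<close> pointwise and
  integrate. If one of the integrals is 0, the corresponding factor vanishes almost
  everywhere.\<close>

lemma nn_integral_Holder3:
  fixes f g h :: "'b \<Rightarrow> real"
  assumes [measurable]: "f \<in> borel_measurable M" "g \<in> borel_measurable M" "h \<in> borel_measurable M"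
    and nn: "\<And>x. f x \<ge> 0" "\<And>x. g x \<ge> 0" "\<And>x. h x \<ge> 0"
    and w: "\<alpha> \<ge> 0" "\<beta> \<ge> 0" "\<gamma> \<ge> 0" "\<alpha> + \<beta> + \<gamma> = 1"
    and I: "(\<integral>\<^sup>+x. ennreal (f x) \<partial>M) = ennreal A" "(\<integral>\<^sup>+x. ennreal (g x) \<partial>M) = ennreal B"
      "(\<integral>\<^sup>+x. ennreal (h x) \<partial>M) = ennreal C" and ABC: "A \<ge> 0" "B \<ge> 0" "C \<ge> 0"
  shows "(\<integral>\<^sup>+x. ennreal (f x powr \<alpha> * g x powr \<beta> * h x powr \<gamma>) \<partial>M)
    \<le> ennreal (A powr \<alpha> * B powr \<beta> * C powr \<gamma>)"
proof (cases "A > 0 \<and> B > 0 \<and> C > 0")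
  case False
  then have "A = 0 \<or> B = 0 \<or> C = 0" using ABC by auto
  moreover have "AE x in M. k x = 0"
    if "k \<in> borel_measurable M" "\<And>x. 0 \<le> k x" "(\<integral>\<^sup>+x. ennreal (k x) \<partial>M) = ennreal 0" for k
  proof -
    have "AE x in M. ennreal (k x) = 0" using that by (simp add: nn_integral_0_iff_AE)
    then show ?thesis using that(2) by (auto elim!: eventually_mono simp: ennreal_eq_0_iff order_antisym)
  qed
  ultimately have "(AE x in M. f x = 0) \<or> (AE x in M. g x = 0) \<or> (AE x in M. h x = 0)"
    using I nn assms(1-3) by metis
  then have "AE x in M. ennreal (f x powr \<alpha> * g x powr \<beta> * h x powr \<gamma>) = 0"
    by (auto elim!: eventually_mono)
  then have "(\<integral>\<^sup>+x. ennreal (f x powr \<alpha> * g x powr \<beta> * h x powr \<gamma>) \<partial>M) = 0"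
    by (subst nn_integral_0_iff_AE) auto
  then show ?thesis by simp
next
  case True
  define P where "P = A powr \<alpha> * B powr \<beta> * C powr \<gamma>"
  have P: "P \<ge> 0" by (simp add: P_def)
  have le: "f x powr \<alpha> * g x powr \<beta> * h x powr \<gamma> \<le> (P * \<alpha> / A) * f x + (P * \<beta> / B) * g x + (P * \<gamma> / C) * h x" for x
  proof -
    have "f x powr \<alpha> * g x powr \<beta> * h x powr \<gamma>
        = P * ((f x / A) powr \<alpha> * (g x / B) powr \<beta> * (h x / C) powr \<gamma>)"
      using True nn by (simp add: P_def powr_divide)
    also have "\<dots> \<le> P * (\<alpha> * (f x / A) + \<beta> * (g x / B) + \<gamma> * (h x / C))"
      using True nn w P by (intro mult_left_mono weighted_am_gm3) auto
    finally show ?thesis by (simp add: field_simps)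
  qed
  have "(\<integral>\<^sup>+x. ennreal (f x powr \<alpha> * g x powr \<beta> * h x powr \<gamma>) \<partial>M)
     \<le> (\<integral>\<^sup>+x. ennreal (P * \<alpha> / A) * ennreal (f x) + ennreal (P * \<beta> / B) * ennreal (g x) + ennreal (P * \<gamma> / C) * ennreal (h x) \<partial>M)"
  proof (rule nn_integral_mono)
    fix x
    have "0 \<le> P * \<alpha> / A" "0 \<le> P * \<beta> / B" "0 \<le> P * \<gamma> / C" using True P w by auto
    then have "ennreal (P * \<alpha> / A) * ennreal (f x) + ennreal (P * \<beta> / B) * ennreal (g x) + ennreal (P * \<gamma> / C) * ennreal (h x)
      = ennreal ((P * \<alpha> / A) * f x + (P * \<beta> / B) * g x + (P * \<gamma> / C) * h x)"
      by (intro ennreal_lincomb3 nn)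
    then show "ennreal (f x powr \<alpha> * g x powr \<beta> * h x powr \<gamma>)
      \<le> ennreal (P * \<alpha> / A) * ennreal (f x) + ennreal (P * \<beta> / B) * ennreal (g x) + ennreal (P * \<gamma> / C) * ennreal (h x)"
      using le[of x] by (simp add: ennreal_leI del: ennreal_plus)
  qed
  also have "\<dots> = ennreal (P * \<alpha> / A) * ennreal A + ennreal (P * \<beta> / B) * ennreal B + ennreal (P * \<gamma> / C) * ennreal C"
    by (simp add: nn_integral_add nn_integral_cmult I)
  also have "\<dots> = ennreal ((P * \<alpha> / A) * A + (P * \<beta> / B) * B + (P * \<gamma> / C) * C)"
    using True P w by (simp add: ennreal_mult[symmetric] ennreal_plus[symmetric] del: ennreal_plus)
  also have "(P * \<alpha> / A) * A + (P * \<beta> / B) * B + (P * \<gamma> / C) * C = P * (\<alpha> + \<beta> + \<gamma>)"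
    using True by (simp add: field_simps)
  finally show ?thesis using w by (simp add: P_def)
qed

section \<open>Riesz potential estimate and the subcritical Sobolev inequality\<close>

lemma abs_le_nn_integral_grad_ray:
  fixes u :: "'a::euclidean_space \<Rightarrow> real"
  assumes t: "u \<in> test_functions \<Omega>" and e: "norm e = 1"
  shows "ennreal \<bar>u x\<bar> \<le> (\<integral>\<^sup>+t. indicator {0<..} t * ennreal (norm (grad u (x + t *\<^sub>R e))) \<partial>lborel)"
proof -
  note s = test_functionsD(1)[OF t]
  obtain \<rho> where \<rho>: "\<And>x. norm x > \<rho> \<Longrightarrow> u x = 0" "\<And>x. norm x > \<rho> \<Longrightarrow> grad u x = 0"
    by (rule test_functions_bounded_support[OF t]) blast
  \<comment> \<open>Chosen so that \<open>x + T e\<close> has norm at least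
    \<open>\<bar>\<rho>\<bar> + 1\<close>, hence lies outside the support.\<close>
  define T where "T = \<bar>\<rho>\<bar> + norm x + 1"
  have T: "T > 0" by (simp add: T_def add_nonneg_pos)
  have "T \<le> norm (x + T *\<^sub>R e) + norm x"
    using norm_triangle_sub[of "T *\<^sub>R e" "- x"] e T by (simp add: add.commute)
  then have uT: "u (x + T *\<^sub>R e) = 0" by (intro \<rho>) (simp add: T_def)
  define f where "f = (\<lambda>t. grad u (x + t *\<^sub>R e) \<bullet> e)"
  have c: "continuous_on UNIV f"
    unfolding f_def
    by (intro continuous_on_inner continuous_on_const continuous_on_compose2[OF smooth_continuous_grad[OF s]]) (auto intro!: continuous_intros)
  have d: "((\<lambda>t. u (x + t *\<^sub>R e)) has_vector_derivative f t) (at t within S)" for t S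
  proof -
    have 1: "((\<lambda>t. x + t *\<^sub>R e) has_derivative (\<lambda>h. h *\<^sub>R e)) (at t within S)"
      by (auto intro!: derivative_eq_intros)
    have df: "u differentiable (at (x + t *\<^sub>R e))" by (rule smooth_differentiable[OF s])
    then have "(u has_derivative frechet_derivative u (at (x + t *\<^sub>R e))) (at (x + t *\<^sub>R e))"
      by (simp add: frechet_derivative_works)
    from has_derivative_compose[OF 1 this]
    have "((\<lambda>t. u (x + t *\<^sub>R e)) has_derivative (\<lambda>h. frechet_derivative u (at (x + t *\<^sub>R e)) (h *\<^sub>R e))) (at t within S)" .
    moreover have "frechet_derivative u (at (x + t *\<^sub>R e)) (h *\<^sub>R e) = h *\<^sub>R f t" for h
      using linear_scale[OF linear_frechet_derivative[OF df], of h e] grad_inner[OF df, of e] by (simp add: f_def)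
    ultimately show ?thesis by (simp add: has_vector_derivative_def)
  qed
  have "(\<integral>t. indicator {0..T} t *\<^sub>R f t \<partial>lborel) = u (x + T *\<^sub>R e) - u (x + 0 *\<^sub>R e)"
    by (rule integral_FTC_atLeastAtMost[OF _ d]) (use T c continuous_on_subset in auto)
  then have "\<bar>u x\<bar> = norm (\<integral>t. indicator {0..T} t *\<^sub>R f t \<partial>lborel)" using uT by simp
  also have "ennreal \<dots> \<le> (\<integral>\<^sup>+t. norm (indicator {0..T} t *\<^sub>R f t) \<partial>lborel)"
    by (intro integral_norm_bound_ennreal borel_integrable_compact) (use c continuous_on_subset in auto)
  also have "\<dots> \<le> (\<integral>\<^sup>+t. indicator {0<..} t * ennreal (norm (grad u (x + t *\<^sub>R e))) \<partial>lborel)"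
  proof (rule nn_integral_mono_AE)
    show "AE t in lborel. ennreal (norm (indicator {0..T} t *\<^sub>R f t)) \<le> indicator {0<..} t * ennreal (norm (grad u (x + t *\<^sub>R e)))"
      using AE_lborel_singleton[of "0::real"]
    proof eventually_elim
      case (elim t)
      have "norm (f t) \<le> norm (grad u (x + t *\<^sub>R e))"
        using Cauchy_Schwarz_ineq2[of "grad u (x + t *\<^sub>R e)" e] e by (simp add: f_def)
      then show ?case using elim by (auto split: split_indicator intro!: ennreal_leI)
    qed
  qed
  finally show ?thesis .
qed

lemma emeasure_lborel_open_bounded:
  "open S \<Longrightarrow> bounded (S :: 'a::euclidean_space set) \<Longrightarrow> emeasure lborel S = ennreal (measure lebesgue S)"
  using emeasure_bounded_finite[of S] emeasure_eq_ennreal_measure[of lborel S]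
  by (simp add: measure_completion less_top)

lemma emeasure_lborel_ball:
  "emeasure lborel (ball (0::'a::euclidean_space) 1) = ennreal (measure lebesgue (ball (0::'a) 1))"
  by (simp add: emeasure_lborel_open_bounded)

lemma nn_integral_translate:
  fixes f :: "'a::euclidean_space \<Rightarrow> ennreal"
  assumes [measurable]: "f \<in> borel_measurable borel"
  shows "(\<integral>\<^sup>+y. f (x + y) \<partial>lborel) = (\<integral>\<^sup>+y. f y \<partial>lborel)"
proof -
  have "(\<integral>\<^sup>+y. f y \<partial>lborel) = (\<integral>\<^sup>+y. f y \<partial>distr lborel borel ((+) x))"
    by (simp add: lborel_distr_plus)
  then show ?thesis by (simp add: nn_integral_distr)
qed

text \<open>Average the ray estimate over all directions. In polar coordinates around
  \<open>x\<close> the kernel exactly cancels the Jacobian factor t^(N - 1). The constant on the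
  left is the area of the unit sphere.\<close>

lemma abs_le_riesz_potential:
  fixes u :: "'a::euclidean_space \<Rightarrow> real"
  assumes t: "u \<in> test_functions \<Omega>"
  shows "ennreal (DIM('a) * measure lebesgue (ball (0::'a) 1) * \<bar>u x\<bar>)
    \<le> (\<integral>\<^sup>+y. ennreal (norm (grad u y) * norm (y - x) powr (1 - real DIM('a))) \<partial>lborel)"
proof -
  note s = test_functionsD(1)[OF t]
  note [measurable] = smooth_borel_measurable[OF s]
  let ?w = "measure lebesgue (ball (0::'a) 1)" and ?N = "real DIM('a)"
  define f where "f = (\<lambda>y. ennreal (norm (grad u (x + y)) * norm y powr (1 - ?N)))"
  have [measurable]: "f \<in> borel_measurable borel" unfolding f_def by measurable
  have B: "{z::'a. norm z < 1} = ball 0 1" by (auto simp: ball_def)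
  have "ennreal (?w * \<bar>u x\<bar>) = (\<integral>\<^sup>+z. indicator {z::'a. norm z < 1} z * ennreal \<bar>u x\<bar> \<partial>lborel)"
    unfolding B by (subst nn_integral_multc) (auto simp add: emeasure_lborel_ball ennreal_mult intro!: borel_measurable_indicator)
  also have "\<dots> \<le> (\<integral>\<^sup>+z. indicator {z. norm z < 1} z *
      (\<integral>\<^sup>+t. indicator {0<..} t * ennreal (t ^ (DIM('a) - 1)) * f ((t / norm z) *\<^sub>R z) \<partial>lborel) \<partial>lborel)"
  proof (rule nn_integral_mono_AE)
    show "AE z in lborel. indicator {z::'a. norm z < 1} z * ennreal \<bar>u x\<bar> \<le> indicator {z. norm z < 1} z *
      (\<integral>\<^sup>+t. indicator {0<..} t * ennreal (t ^ (DIM('a) - 1)) * f ((t / norm z) *\<^sub>R z) \<partial>lborel)"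
      using AE_lborel_singleton[of "0::'a"]
    proof eventually_elim
      case (elim z)
      let ?e = "(1 / norm z) *\<^sub>R z"
      have "norm ?e = 1" using elim by simp
      from abs_le_nn_integral_grad_ray[OF t this, of x]
      have "ennreal \<bar>u x\<bar> \<le> (\<integral>\<^sup>+t. indicator {0<..} t * ennreal (norm (grad u (x + t *\<^sub>R ?e))) \<partial>lborel)" .
      also have "\<dots> = (\<integral>\<^sup>+t. indicator {0<..} t * ennreal (t ^ (DIM('a) - 1)) * f ((t / norm z) *\<^sub>R z) \<partial>lborel)"
      proof (rule nn_integral_cong)
        fix t :: real
        show "indicator {0<..} t * ennreal (norm (grad u (x + t *\<^sub>R ?e)))
          = indicator {0<..} t * ennreal (t ^ (DIM('a) - 1)) * f ((t / norm z) *\<^sub>R z)"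
        proof (cases "t > 0")
          case True
          have "t ^ (DIM('a) - 1) * t powr (1 - ?N) = 1"
            using True by (simp add: powr_realpow[symmetric] powr_add[symmetric] of_nat_diff)
          then have "ennreal (t ^ (DIM('a) - 1)) * f ((t / norm z) *\<^sub>R z) = ennreal (norm (grad u (x + (t / norm z) *\<^sub>R z)))"
            using True elim by (simp add: f_def ennreal_mult[symmetric] mult.left_commute)
          then show ?thesis using True by (simp add: mult.assoc)
        qed simp
      qed
      finally show ?case by (simp add: mult_left_mono)
    qed
  qed
  finally have "ennreal ?N * ennreal (?w * \<bar>u x\<bar>) \<le> (\<integral>\<^sup>+y. f y \<partial>lborel)"
    unfolding nn_integral_polar[where k=norm and f=f, simplified] by (simp add: mult_left_mono)
  also have "(\<integral>\<^sup>+y. f y \<partial>lborel) = (\<integral>\<^sup>+y. ennreal (norm (grad u (x + y)) * norm ((x + y) - x) powr (1 - ?N)) \<partial>lborel)"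
    by (simp add: f_def)
  also have "\<dots> = (\<integral>\<^sup>+y. ennreal (norm (grad u y) * norm (y - x) powr (1 - ?N)) \<partial>lborel)"
    by (rule nn_integral_translate) measurable
  finally show ?thesis by (simp add: ennreal_mult mult.assoc)
qed

text \<open>Two points of the unit ball have distance less than 2, so the truncation is invisible
  for functions supported there, while it makes suitable powers of the kernel integrable at
  infinity.\<close>

definition trunc_kernel :: "real \<Rightarrow> 'a::euclidean_space \<Rightarrow> real" where
  "trunc_kernel p y = (if norm y < 2 then norm y powr p else 0)"

lemma trunc_kernel_measurable [measurable]: "trunc_kernel p \<in> borel_measurable borel"
  unfolding trunc_kernel_def[abs_def] by measurable

text \<open>In polar coordinates what remains is the integral of t^(p + N - 1) over (0, 2), and the
  hypothesis makes this exponent exceed -1.\<close>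

lemma nn_integral_trunc_kernel_finite:
  assumes "p > - real DIM('a::euclidean_space)"
  shows "(\<integral>\<^sup>+y. ennreal (trunc_kernel p (y::'a)) \<partial>lborel) < \<infinity>"
proof -
  let ?N = "real DIM('a)"
  have "(\<integral>\<^sup>+t. indicator {0<..} t * ennreal (t ^ (DIM('a) - 1)) * ennreal (trunc_kernel p ((t / norm z) *\<^sub>R z)) \<partial>lborel)
      \<le> ennreal (2 powr (p + ?N) / (p + ?N))" (is "?I z \<le> _") if "z \<noteq> 0" for z :: 'a
  proof -
    have a: "p + ?N - 1 > - 1" using assms by simp
    have "?I z \<le> (\<integral>\<^sup>+t. indicator {0..2} t * ennreal (t powr (p + ?N - 1)) \<partial>lborel)"
    proof (rule nn_integral_mono)
      fix t :: real
      show "indicator {0<..} t * ennreal (t ^ (DIM('a) - 1)) * ennreal (trunc_kernel p ((t / norm z) *\<^sub>R z))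
        \<le> indicator {0..2} t * ennreal (t powr (p + ?N - 1))"
      proof (cases "t > 0 \<and> t < 2")
        case True
        have "t ^ (DIM('a) - 1) * t powr p = t powr (p + ?N - 1)"
          using True by (simp add: powr_realpow[symmetric] powr_add[symmetric] of_nat_diff algebra_simps)
        then show ?thesis using True that by (simp add: trunc_kernel_def ennreal_mult[symmetric])
      next
        case False
        then show ?thesis using that by (auto simp: trunc_kernel_def split: split_indicator)
      qed
    qed
    also have "\<dots> = ennreal (2 powr (p + ?N) / (p + ?N))"
    proof -
      have "((\<lambda>t. if t \<in> {0..2} then t powr (p + ?N - 1) else 0) has_integral 2 powr (p + ?N) / (p + ?N)) UNIV"
        using has_integral_powr_from_0[OF a, of 2] by (subst has_integral_restrict_UNIV) simp
      then have "(\<integral>\<^sup>+t. ennreal (if t \<in> {0..2} then t powr (p + ?N - 1) else 0) \<partial>lborel) = ennreal (2 powr (p + ?N) / (p + ?N))"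
        by (intro nn_integral_has_integral_lborel) auto
      moreover have "ennreal (if t \<in> {0..2} then t powr (p + ?N - 1) else 0) = indicator {0..2} t * ennreal (t powr (p + ?N - 1))" for t
        by (simp split: split_indicator)
      ultimately show ?thesis by simp
    qed
    finally show ?thesis .
  qed
  then have "(\<integral>\<^sup>+z. indicator {z::'a. norm z < 1} z * ?I z \<partial>lborel)
      \<le> (\<integral>\<^sup>+z. indicator (ball (0::'a) 1) z * ennreal (2 powr (p + ?N) / (p + ?N)) \<partial>lborel)"
    using AE_lborel_singleton[of "0::'a"]
    by (intro nn_integral_mono_AE) (auto elim!: eventually_mono split: split_indicator)
  also have "\<dots> < \<infinity>"
    by (subst nn_integral_multc) (auto simp: emeasure_lborel_ball ennreal_mult_less_top intro!: borel_measurable_indicator)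
  finally show ?thesis
    by (subst nn_integral_polar[where k=norm]) (auto simp: ennreal_mult_less_top)
qed


text \<open>The factorisation behind Young's convolution inequality from L^2 and L^r to L^q. The
  three outer exponents sum to 1 and serve as Hoelder weights.\<close>

lemma powr_split_Holder:
  fixes g K :: real
  assumes "g \<ge> 0" "K \<ge> 0" and q: "q \<ge> 2" and r: "r > 0" "1 / r = 1 / 2 + 1 / q"
  shows "(g\<^sup>2 * K powr r) powr (1 / q) * (g\<^sup>2) powr (1 / 2 - 1 / q) * (K powr r) powr (1 / 2) = g * K"
proof (cases "g > 0 \<and> K > 0")
  case True
  have e1: "2 * (1 / q) + 2 * (1 / 2 - 1 / q) = (1::real)" by simp
  have "r * (1 / q) + r * (1 / 2) = r * (1 / r)" unfolding r(2) by (simp add: algebra_simps)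
  then have e2: "r * (1 / q) + r * (1 / 2) = 1" using r(1) by simp
  have g2: "g\<^sup>2 = g powr 2" using True by (simp add: powr_numeral)
  have "(g\<^sup>2 * K powr r) powr (1 / q) * (g\<^sup>2) powr (1 / 2 - 1 / q) * (K powr r) powr (1 / 2)
    = (g powr (2 * (1 / q)) * g powr (2 * (1 / 2 - 1 / q))) * (K powr (r * (1 / q)) * K powr (r * (1 / 2)))"
    unfolding g2 by (simp only: powr_mult powr_powr mult_ac)
  also have "\<dots> = g powr 1 * K powr 1" unfolding powr_add[symmetric] e1 e2 ..
  finally show ?thesis using True by simp
next
  case False
  then have "g = 0 \<or> K = 0" using assms by auto
  then show ?thesis by auto
qed

lemma sobolev_ball:
  assumes q: "q \<ge> 2" "1 / q > 1 / 2 - 1 / real DIM('a::euclidean_space)"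
  shows "\<exists>C>0. \<forall>u\<in>test_functions (ball (0::'a) 1). mass q u \<le> C * energy u powr (q / 2)"
proof -
  let ?N = "real DIM('a)" and ?w = "measure lebesgue (ball (0::'a) 1)"
  define r where "r = 1 / (1 / 2 + 1 / q)"
  have q0: "q > 0" using q by simp
  have r: "r > 0" "1 / r = 1 / 2 + 1 / q" using q by (auto simp: r_def add_pos_pos)
  \<comment> \<open>This says (N - 1) / N < 1 / r = 1/2 + 1/q, which is exactly subcriticality: the
    kernel to the power \<open>r\<close> is integrable.\<close>
  have p: "(1 - ?N) * r > - ?N"
  proof -
    have "(?N - 1) * r < ?N"
    proof -
      have "(?N - 1) / ?N < 1 / r" using q(2) r(2) by (simp add: diff_divide_distrib)
      then show ?thesis using r(1) by (simp add: field_simps)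
    qed
    then show ?thesis by (simp add: algebra_simps)
  qed
  define K where "K = (trunc_kernel (1 - ?N) :: 'a \<Rightarrow> real)"
  have [measurable]: "K \<in> borel_measurable borel" by (simp add: K_def)
  have K0: "K y \<ge> 0" for y by (simp add: K_def trunc_kernel_def)
  have Kr: "K y powr r = trunc_kernel ((1 - ?N) * r) y" for y
    by (simp add: K_def trunc_kernel_def powr_powr)
  obtain \<kappa> where \<kappa>: "\<kappa> \<ge> 0" "(\<integral>\<^sup>+y. ennreal (K y powr r) \<partial>lborel) = ennreal \<kappa>"
    using nn_integral_trunc_kernel_finite[OF p] unfolding Kr
    by (metis ennreal_cases infinity_ennreal_def less_irrefl)
  have Kx: "(\<integral>\<^sup>+y. ennreal (K (y - x) powr r) \<partial>lborel) = ennreal \<kappa>" for x :: 'a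
    using nn_integral_translate[of "\<lambda>y. ennreal (K y powr r)" "- x"] \<kappa>(2) by simp
  have K_sym: "K (y - x) = K (x - y)" for x y :: 'a by (simp add: K_def trunc_kernel_def norm_minus_commute)
  have Kx': "(\<integral>\<^sup>+x. ennreal (K (y - x) powr r) \<partial>lborel) = ennreal \<kappa>" for y :: 'a
    using Kx[of y] by (simp only: K_sym[of y])
  have w: "?w > 0" by (rule measure_lebesgue_open_pos) auto
  define C0 where "C0 = ?N * ?w"
  have C0: "C0 > 0" using w by (simp add: C0_def)
  have main: "mass q u \<le> (\<kappa> powr (q / 2 + 1) / C0 powr q) * energy u powr (q / 2)"
    if t: "u \<in> test_functions (ball 0 1)" for u :: "'a \<Rightarrow> real"
  proof -
    note s = test_functionsD(1)[OF t]
    note [measurable] = smooth_borel_measurable[OF s]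
    define g where "g = (\<lambda>y. norm (grad u y))"
    have [measurable]: "g \<in> borel_measurable borel" unfolding g_def by measurable
    have g0: "g y \<ge> 0" for y by (simp add: g_def)
    define E where "E = energy u"
    have E0: "E \<ge> 0" by (simp add: E_def energy_nonneg)
    have gE: "(\<integral>\<^sup>+y. ennreal ((g y)\<^sup>2) \<partial>lborel) = ennreal E"
      unfolding g_def E_def energy_def
      by (rule nn_integral_eq_integral[OF test_functions_integrable(1)[OF t]]) simp
    obtain G where G: "\<And>y. g y \<le> G"
    proof -
      have "compact (grad u ` cball 0 1)"
        by (intro compact_continuous_image continuous_on_subset[OF smooth_continuous_grad[OF s]]) auto
      then obtain b where b: "\<And>y. y \<in> cball 0 1 \<Longrightarrow> norm (grad u y) \<le> b"
        using compact_imp_bounded bounded_iff by (metis imageI)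
      have "g y \<le> \<bar>b\<bar>" for y
        using b[of y] test_functionsD(3)[OF t, of y] by (cases "y \<in> ball 0 1") (auto simp: g_def)
      then show thesis using that by blast
    qed
    \<comment> \<open>After Hoelder this is the only factor depending on \<open>x\<close>, and by
      Tonelli its integral is \<open>E * \<kappa>\<close>. Pointwise finiteness, from the bound
      \<open>G\<close> on the gradient, allows it to be used as a real number.\<close>
    define A where "A = (\<lambda>x. \<integral>\<^sup>+y. ennreal ((g y)\<^sup>2 * K (y - x) powr r) \<partial>lborel)"
    have A_fin: "A x < \<infinity>" for x
    proof -
      have "A x \<le> (\<integral>\<^sup>+y. ennreal (G\<^sup>2) * ennreal (K (y - x) powr r) \<partial>lborel)"
        unfolding A_def using G g0
        by (intro nn_integral_mono) (auto simp: ennreal_mult[symmetric] intro!: ennreal_leI mult_right_mono power_mono)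
      also have "\<dots> = ennreal (G\<^sup>2) * ennreal \<kappa>" by (simp add: nn_integral_cmult Kx)
      finally show ?thesis by (auto simp: ennreal_mult_less_top intro: le_less_trans)
    qed
    have [measurable]: "A \<in> borel_measurable borel" unfolding A_def by measurable
    have int_A: "(\<integral>\<^sup>+x. A x \<partial>lborel) = ennreal (E * \<kappa>)"
    proof -
      have "(\<integral>\<^sup>+x. A x \<partial>lborel) = (\<integral>\<^sup>+y. (\<integral>\<^sup>+x. ennreal ((g y)\<^sup>2 * K (y - x) powr r) \<partial>lborel) \<partial>lborel)"
        unfolding A_def by (rule nn_integral_lborel_swap) measurable
      also have "\<dots> = (\<integral>\<^sup>+y. ennreal ((g y)\<^sup>2) * ennreal \<kappa> \<partial>lborel)"
        by (intro nn_integral_cong) (simp add: ennreal_mult nn_integral_cmult Kx')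
      also have "\<dots> = ennreal (E * \<kappa>)" using E0 \<kappa>(1) by (simp add: nn_integral_multc gE ennreal_mult)
      finally show ?thesis .
    qed
    have pointwise: "(C0 * \<bar>u x\<bar>) powr q \<le> enn2real (A x) * (E powr (q / 2 - 1) * \<kappa> powr (q / 2))" for x
    proof (cases "x \<in> ball 0 1")
      case False
      then show ?thesis using test_functionsD(2)[OF t] q0 by simp
    next
      case True
      have "ennreal (C0 * \<bar>u x\<bar>) \<le> (\<integral>\<^sup>+y. ennreal (g y * norm (y - x) powr (1 - ?N)) \<partial>lborel)"
        unfolding C0_def g_def by (rule abs_le_riesz_potential[OF t])
      also have "\<dots> = (\<integral>\<^sup>+y. ennreal (((g y)\<^sup>2 * K (y - x) powr r) powr (1 / q) * ((g y)\<^sup>2) powr (1 / 2 - 1 / q)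
          * (K (y - x) powr r) powr (1 / 2)) \<partial>lborel)"
      proof (rule nn_integral_cong)
        fix y
        have "g y * norm (y - x) powr (1 - ?N) = g y * K (y - x)"
        proof (cases "y \<in> ball 0 1")
          case y: True
          have "norm (y - x) < 2" using True y norm_triangle_ineq4[of y x] by simp
          then show ?thesis by (simp add: K_def trunc_kernel_def)
        next
          case False
          then show ?thesis using test_functionsD(3)[OF t] by (simp add: g_def)
        qed
        then show "ennreal (g y * norm (y - x) powr (1 - ?N)) = ennreal (((g y)\<^sup>2 * K (y - x) powr r) powr (1 / q) * ((g y)\<^sup>2) powr (1 / 2 - 1 / q)
          * (K (y - x) powr r) powr (1 / 2))"
          by (simp only: powr_split_Holder[OF g0 K0 q(1) r])
      qed
      also have "\<dots> \<le> ennreal (enn2real (A x) powr (1 / q) * E powr (1 / 2 - 1 / q) * \<kappa> powr (1 / 2))"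
      proof (rule nn_integral_Holder3)
        show "0 \<le> 1 / 2 - 1 / q" using q by (simp add: field_simps)
        show "(\<integral>\<^sup>+y. ennreal ((g y)\<^sup>2 * K (y - x) powr r) \<partial>lborel) = ennreal (enn2real (A x))"
          using A_fin[of x] by (simp add: A_def)
      qed (use q E0 \<kappa>(1) gE Kx in auto)
      finally have "C0 * \<bar>u x\<bar> \<le> enn2real (A x) powr (1 / q) * E powr (1 / 2 - 1 / q) * \<kappa> powr (1 / 2)"
        by (subst (asm) ennreal_le_iff) auto
      then have "(C0 * \<bar>u x\<bar>) powr q \<le> (enn2real (A x) powr (1 / q) * E powr (1 / 2 - 1 / q) * \<kappa> powr (1 / 2)) powr q"
        using C0 q by (intro powr_mono2) auto
      also have "\<dots> = enn2real (A x) * (E powr (q / 2 - 1) * \<kappa> powr (q / 2))"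
      proof -
        have "(1 / 2 - 1 / q) * q = q / 2 - 1" "1 / 2 * q = q / 2" "1 / q * q = 1"
          using q0 by (simp_all add: field_simps)
        then show ?thesis by (simp only: powr_mult powr_powr) simp
      qed
      finally show ?thesis .
    qed
    have "ennreal (C0 powr q * mass q u) = (\<integral>\<^sup>+x. ennreal ((C0 * \<bar>u x\<bar>) powr q) \<partial>lborel)"
    proof -
      have "(\<integral>\<^sup>+x. ennreal ((C0 * \<bar>u x\<bar>) powr q) \<partial>lborel) = ennreal (\<integral>x. C0 powr q * \<bar>u x\<bar> powr q \<partial>lborel)"
        using test_functions_integrable(2)[OF t q0] C0
        by (subst nn_integral_eq_integral[symmetric]) (auto simp: powr_mult)
      then show ?thesis by (simp add: mass_def)
    qed
    also have "\<dots> \<le> (\<integral>\<^sup>+x. A x * ennreal (E powr (q / 2 - 1) * \<kappa> powr (q / 2)) \<partial>lborel)"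
    proof (rule nn_integral_mono)
      fix x
      have "ennreal ((C0 * \<bar>u x\<bar>) powr q) \<le> ennreal (enn2real (A x) * (E powr (q / 2 - 1) * \<kappa> powr (q / 2)))"
        by (rule ennreal_leI[OF pointwise])
      also have "\<dots> = A x * ennreal (E powr (q / 2 - 1) * \<kappa> powr (q / 2))"
        using A_fin[of x] by (simp add: ennreal_mult)
      finally show "ennreal ((C0 * \<bar>u x\<bar>) powr q) \<le> A x * ennreal (E powr (q / 2 - 1) * \<kappa> powr (q / 2))" .
    qed
    also have "\<dots> = ennreal (E * \<kappa> * (E powr (q / 2 - 1) * \<kappa> powr (q / 2)))"
      using E0 \<kappa>(1) by (simp add: nn_integral_multc int_A ennreal_mult)
    finally have "C0 powr q * mass q u \<le> E * \<kappa> * (E powr (q / 2 - 1) * \<kappa> powr (q / 2))"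
      using E0 \<kappa>(1) by (subst (asm) ennreal_le_iff) auto
    also have "\<dots> = E powr (q / 2) * \<kappa> powr (q / 2 + 1)"
    proof -
      have "E * E powr (q / 2 - 1) = E powr (q / 2)" using E0 by (cases "E = 0") (auto simp: powr_mult_base)
      moreover have "\<kappa> * \<kappa> powr (q / 2) = \<kappa> powr (q / 2 + 1)" using \<kappa>(1) by (cases "\<kappa> = 0") (auto simp: powr_mult_base add.commute)
      ultimately show ?thesis by (metis mult.assoc mult.commute)
    qed
    finally show ?thesis using C0 by (simp add: E_def field_simps)
  qed
  show ?thesis
  proof (intro exI[of _ "\<kappa> powr (q / 2 + 1) / C0 powr q + 1"] conjI ballI)
    show "\<kappa> powr (q / 2 + 1) / C0 powr q + 1 > 0" by (simp add: add_nonneg_pos)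
    fix u assume "u \<in> test_functions (ball (0::'a) 1)"
    from main[OF this] show "mass q u \<le> (\<kappa> powr (q / 2 + 1) / C0 powr q + 1) * energy u powr (q / 2)"
      by (simp add: distrib_right add_increasing2)
  qed
qed


lemma mass_le_mass_2:
  fixes u :: "'a::euclidean_space \<Rightarrow> real"
  assumes t: "u \<in> test_functions (ball (0::'a) 1)" and q: "q > 0" "q \<le> 2"
  shows "mass q u \<le> mass 2 u powr (q / 2) * measure lebesgue (ball (0::'a) 1) powr (1 - q / 2)"
proof -
  let ?w = "measure lebesgue (ball (0::'a) 1)" and ?I = "indicator (ball (0::'a) 1) :: 'a \<Rightarrow> real"
  note [measurable] = smooth_borel_measurable[OF test_functionsD(1)[OF t]]
  have [measurable]: "?I \<in> borel_measurable borel" by (auto intro!: borel_measurable_indicator)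
  have I: "(\<integral>\<^sup>+x. ennreal (?I x) \<partial>lborel) = ennreal ?w"
    by (simp add: ennreal_indicator emeasure_lborel_ball)
  have nn: "(\<integral>\<^sup>+x. ennreal (\<bar>u x\<bar> powr p) \<partial>lborel) = ennreal (mass p u)" if "p > 0" for p
    unfolding mass_def using test_functions_integrable(2)[OF t that] by (intro nn_integral_eq_integral) auto
  \<comment> \<open>Two-factor Hoelder against the indicator of the ball; a second copy with weight
    0 fills the third slot. Outside the ball \<open>0 powr 0\<close> is 0, which agrees with
    \<open>u = 0\<close> there.\<close>
  have "ennreal (mass q u) = (\<integral>\<^sup>+x. ennreal ((\<bar>u x\<bar> powr 2) powr (q / 2) * ?I x powr (1 - q / 2) * ?I x powr 0) \<partial>lborel)"
  proof -
    have "(\<bar>y\<bar> powr 2) powr (q / 2) = \<bar>y\<bar> powr q" for y :: real by (subst powr_powr) simp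
    then show ?thesis unfolding nn[OF q(1), symmetric]
      using test_functionsD(2)[OF t] by (intro nn_integral_cong) (simp only:, auto split: split_indicator)
  qed
  also have "\<dots> \<le> ennreal (mass 2 u powr (q / 2) * ?w powr (1 - q / 2) * ?w powr 0)"
    by (rule nn_integral_Holder3) (use q nn[of 2] I mass_nonneg in auto)
  finally have "mass q u \<le> mass 2 u powr (q / 2) * ?w powr (1 - q / 2) * ?w powr 0"
    by (subst (asm) ennreal_le_iff) auto
  also have "\<dots> \<le> mass 2 u powr (q / 2) * ?w powr (1 - q / 2)" by simp
  finally show ?thesis .
qed

text \<open>A form of the condition that is uniform in the dimension: for N = 2 the right-hand side
  is 0.\<close>

lemma subcritical_iff:
  assumes "2 \<le> N" "1 \<le> q" "ereal q < critical_exponent N"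
  shows "1 / q > 1 / 2 - 1 / real N"
proof (cases "N = 2")
  case True
  then show ?thesis using assms by simp
next
  case False
  then have "N \<ge> 3" using assms(1) by simp
  moreover from this have "q < 2 * real N / (real N - 2)"
    using assms(3) False by (simp add: critical_exponent_def)
  ultimately have "q * (real N - 2) < 2 * real N" by (simp add: field_simps)
  then show ?thesis using assms(2) \<open>N \<ge> 3\<close> by (simp add: field_simps)
qed

theorem lambda2_ball_pos:
  assumes N: "DIM('a::euclidean_space) \<ge> 2" and q: "1 \<le> q" "ereal q < critical_exponent DIM('a)"
  shows "lambda2 q (ball (0::'a) 1) > 0"
proof -
  let ?w = "measure lebesgue (ball (0::'a) 1)"
  have w: "?w > 0" by (rule measure_lebesgue_open_pos) auto
  have q0: "q > 0" using q by simp
  have posI: "lambda2 q (ball (0::'a) 1) > 0"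
    if "c > 0" "\<And>u. u \<in> test_functions (ball (0::'a) 1) \<Longrightarrow> mass q u powr (2 / q) \<le> c * energy u" for c
  proof -
    have "1 / c \<le> lambda2 q (ball (0::'a) 1)"
      by (rule le_lambda2I[OF _ _ q0]) (use that in \<open>auto simp: field_simps\<close>)
    moreover have "1 / c > 0" using that by simp
    ultimately show ?thesis by linarith
  qed
  show ?thesis
  proof (cases "q \<ge> 2")
    case True
    obtain C where C: "C > 0" "\<And>u. u \<in> test_functions (ball (0::'a) 1) \<Longrightarrow> mass q u \<le> C * energy u powr (q / 2)"
      using sobolev_ball[OF True subcritical_iff[OF N q]] by blast
    show ?thesis
    proof (rule posI)
      show "C powr (2 / q) > 0" using C by simp
      fix u assume "u \<in> test_functions (ball (0::'a) 1)"
      then have "mass q u powr (2 / q) \<le> (C * energy u powr (q / 2)) powr (2 / q)"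
        using C q0 mass_nonneg by (intro powr_mono2) auto
      also have "\<dots> = C powr (2 / q) * energy u"
        using C q0 energy_nonneg[of u] by (simp add: powr_mult powr_powr)
      finally show "mass q u powr (2 / q) \<le> C powr (2 / q) * energy u" .
    qed
  next
    case False
    \<comment> \<open>The exponent 2 is subcritical in every dimension, and on the ball smaller
      exponents reduce to it by \<open>mass_le_mass_2\<close>.\<close>
    have "1 / 2 > 1 / 2 - 1 / real DIM('a)" by simp
    from sobolev_ball[OF order_refl this]
    obtain C where C: "C > 0" "\<And>u. u \<in> test_functions (ball (0::'a) 1) \<Longrightarrow> mass 2 u \<le> C * energy u powr (2 / 2)"
      by blast
    show ?thesis
    proof (rule posI)
      show "C * ?w powr ((1 - q / 2) * (2 / q)) > 0" using C w by simp
      fix u assume t: "u \<in> test_functions (ball (0::'a) 1)"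
      have "mass q u powr (2 / q) \<le> (mass 2 u powr (q / 2) * ?w powr (1 - q / 2)) powr (2 / q)"
        using q0 mass_nonneg False t by (intro powr_mono2 mass_le_mass_2) auto
      also have "\<dots> = mass 2 u * ?w powr ((1 - q / 2) * (2 / q))"
        using q0 mass_nonneg[of 2 u] by (simp add: powr_mult powr_powr)
      also have "\<dots> \<le> (C * energy u) * ?w powr ((1 - q / 2) * (2 / q))"
        using C(2)[OF t] energy_nonneg[of u] by (intro mult_right_mono) auto
      finally show "mass q u powr (2 / q) \<le> C * ?w powr ((1 - q / 2) * (2 / q)) * energy u"
        by (simp add: mult_ac)
    qed
  qed
qed

subsection \<open>Test functions depending on a gauge\<close>

definition mollifier :: "real \<Rightarrow> 'a::euclidean_space \<Rightarrow> real" where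
  "mollifier d y = bump d y / (\<integral>z. bump d (z::'a) \<partial>lborel)"

lemma
  fixes y :: "'a::euclidean_space"
  assumes d: "d > 0"
  shows smooth_mollifier: "smooth (mollifier d :: 'a \<Rightarrow> real)"
    and mollifier_nonneg: "mollifier d y \<ge> 0"
    and mollifier_eq_0: "norm y > d \<Longrightarrow> mollifier d y = 0"
    and integrable_mollifier: "integrable lborel (mollifier d :: 'a \<Rightarrow> real)"
    and integral_mollifier: "(\<integral>y. mollifier d (y::'a) \<partial>lborel) = 1"
proof -
  let ?I = "\<integral>z. bump d (z::'a) \<partial>lborel"
  have c: "continuous_on UNIV (bump d :: 'a \<Rightarrow> real)" using smooth_continuous[OF smooth_bump] .
  have z: "bump d y = 0" if "norm y > d" for y :: 'a
    using bump_pos_iff[OF d, of y] bump_nonneg[of d y] that by simp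
  have i: "integrable lborel (bump d :: 'a \<Rightarrow> real)"
    by (rule integrable_lborel_continuous_support[OF c z])
  have "?I > 0"
  proof -
    have "bump d \<in> test_functions (UNIV :: 'a set)"
      unfolding test_functions_def mem_Collect_eq bump_support[OF d] using smooth_bump d by simp
    moreover have "bump d (0::'a) > 0" using bump_pos_iff[OF d, of 0] d by simp
    then have "bump d \<noteq> (\<lambda>x::'a. 0)" by fastforce
    ultimately have "mass 1 (bump d :: 'a \<Rightarrow> real) > 0" by (intro mass_pos) auto
    then show ?thesis by (simp add: mass_def bump_nonneg)
  qed
  show "smooth (mollifier d :: 'a \<Rightarrow> real)"
  proof -
    have "Ck n (\<lambda>y::'a. bump d y * (1 / ?I))" for n
      using smooth_bump unfolding smooth_def by (intro Ck_mult Ck_const) blast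
    then show ?thesis unfolding smooth_def mollifier_def[abs_def] by simp
  qed
  show "mollifier d y \<ge> 0" using \<open>?I > 0\<close> by (simp add: mollifier_def bump_nonneg)
  show "norm y > d \<Longrightarrow> mollifier d y = 0" by (simp add: mollifier_def z)
  show "integrable lborel (mollifier d :: 'a \<Rightarrow> real)" unfolding mollifier_def[abs_def] using i by simp
  show "(\<integral>y. mollifier d (y::'a) \<partial>lborel) = 1" unfolding mollifier_def using \<open>?I > 0\<close> by simp
qed

text \<open>Averaging against a probability density preserves a bound on the increments of
  \<open>k\<close>, and only shifts of length at most \<open>d\<close> are averaged.\<close>

lemma mollify_mollifier_diff:
  fixes k :: "'a::euclidean_space \<Rightarrow> real"
  assumes k: "continuous_on UNIV k" and d: "d > 0" and B: "B \<ge> 0"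
    and le: "\<And>z. norm z \<le> d \<Longrightarrow> \<bar>k (x - z) - k (y - z)\<bar> \<le> B"
  shows "\<bar>mollify k (mollifier d) x - mollify k (mollifier d) y\<bar> \<le> B"
proof -
  note m = smooth_continuous[OF smooth_mollifier[OF d]] mollifier_eq_0[OF d] mollifier_nonneg[OF d]
  have i: "integrable lborel (\<lambda>z. k (x - z) * mollifier d z)" for x
  proof (rule integrable_lborel_continuous_support[of _ d])
    show "continuous_on UNIV (\<lambda>z. k (x - z) * mollifier d z)"
      by (intro continuous_on_mult m(1) continuous_on_compose2[OF k]) (auto intro!: continuous_intros)
  qed (simp add: m(2))
  have "mollify k (mollifier d) x - mollify k (mollifier d) y
      = (\<integral>z. k (x - z) * mollifier d z - k (y - z) * mollifier d z \<partial>lborel)"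
    using mollify_eq[OF k m(1,2)] i by simp
  also have "\<bar>\<dots>\<bar> \<le> (\<integral>z. B * mollifier d (z::'a) \<partial>lborel)"
  proof (rule Bochner_Integration.integral_abs_bound_integral)
    show "integrable lborel (\<lambda>z. k (x - z) * mollifier d z - k (y - z) * mollifier d z)" using i by simp
    show "integrable lborel (\<lambda>z. B * mollifier d (z::'a))" using integrable_mollifier[OF d, where 'a='a] by simp
    show "\<bar>k (x - z) * mollifier d z - k (y - z) * mollifier d z\<bar> \<le> B * mollifier d z" for z
    proof (cases "norm z \<le> d")
      case True
      have "\<bar>k (x - z) * mollifier d z - k (y - z) * mollifier d z\<bar> = \<bar>k (x - z) - k (y - z)\<bar> * mollifier d z"
        using m(3)[of z] by (simp add: left_diff_distrib[symmetric] abs_mult)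
      then show ?thesis using le[OF True] m(3)[of z] by (simp add: mult_right_mono)
    qed (simp add: m(2))
  qed
  also have "\<dots> = B" using integral_mollifier[OF d, where 'a='a] by simp
  finally show ?thesis .
qed

lemma mollify_mollifier_approx:
  fixes k :: "'a::euclidean_space \<Rightarrow> real"
  assumes k: "continuous_on UNIV k" and d: "d > 0" and B: "B \<ge> 0"
    and le: "\<And>z. norm z \<le> d \<Longrightarrow> \<bar>k (x - z) - k x\<bar> \<le> B"
  shows "\<bar>mollify k (mollifier d) x - k x\<bar> \<le> B"
proof -
  note m = smooth_continuous[OF smooth_mollifier[OF d]] mollifier_eq_0[OF d] mollifier_nonneg[OF d]
  have i: "integrable lborel (\<lambda>z. k (x - z) * mollifier d z)"
  proof (rule integrable_lborel_continuous_support[of _ d])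
    show "continuous_on UNIV (\<lambda>z. k (x - z) * mollifier d z)"
      by (intro continuous_on_mult m(1) continuous_on_compose2[OF k]) (auto intro!: continuous_intros)
  qed (simp add: m(2))
  have j: "integrable lborel (\<lambda>z. k x * mollifier d (z::'a))" using integrable_mollifier[OF d, where 'a='a] by simp
  have "k x = (\<integral>z. k x * mollifier d (z::'a) \<partial>lborel)" using integral_mollifier[OF d, where 'a='a] by simp
  then have "mollify k (mollifier d) x - k x
      = (\<integral>z. k (x - z) * mollifier d z - k x * mollifier d z \<partial>lborel)"
    unfolding Bochner_Integration.integral_diff[OF i j] using mollify_eq[OF k m(1,2)] by metis
  also have "\<bar>\<dots>\<bar> \<le> (\<integral>z. B * mollifier d (z::'a) \<partial>lborel)"
  proof (rule Bochner_Integration.integral_abs_bound_integral)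
    show "integrable lborel (\<lambda>z. k (x - z) * mollifier d z - k x * mollifier d z)" using i j by simp
    show "integrable lborel (\<lambda>z. B * mollifier d (z::'a))" using integrable_mollifier[OF d, where 'a='a] by simp
    show "\<bar>k (x - z) * mollifier d z - k x * mollifier d z\<bar> \<le> B * mollifier d z" for z
    proof (cases "norm z \<le> d")
      case True
      have "\<bar>k (x - z) * mollifier d z - k x * mollifier d z\<bar> = \<bar>k (x - z) - k x\<bar> * mollifier d z"
        using m(3)[of z] by (simp add: left_diff_distrib[symmetric] abs_mult)
      then show ?thesis using le[OF True] m(3)[of z] by (simp add: mult_right_mono)
    qed (simp add: m(2))
  qed
  also have "\<dots> = B" using integral_mollifier[OF d, where 'a='a] by simp
  finally show ?thesis .
qed

lemma grad_compose_real:
  assumes W: "\<And>t. (W has_real_derivative W' t) (at t)" and f: "f differentiable (at x)"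
  shows "grad (\<lambda>x. W (f x)) x = W' (f x) *\<^sub>R grad f x"
proof -
  have "((\<lambda>x. W (f x)) has_derivative (\<lambda>v. W' (f x) * frechet_derivative f (at x) v)) (at x)"
    using has_derivative_compose[OF f[unfolded frechet_derivative_works] W[unfolded has_field_derivative_def]] .
  then have "frechet_derivative (\<lambda>x. W (f x)) (at x) = (\<lambda>v. W' (f x) * frechet_derivative f (at x) v)"
    using frechet_derivative_at by metis
  then show ?thesis by (simp add: grad_def scaleR_sum_right)
qed

text \<open>
  \<open>G\<close> bounds the local Lipschitz constant of \<open>k\<close>, so that \<open>\<bar>\<nabla>k\<bar> \<le> G\<close> wherever the gradient exists.
\<close>

locale lipschitz_gauge =
  fixes k G :: "'a::euclidean_space \<Rightarrow> real" and L \<mu> :: real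
  assumes hom: "\<And>t x. t > 0 \<Longrightarrow> k (t *\<^sub>R x) = t * k x"
    and lip: "\<And>x y. \<bar>k x - k y\<bar> \<le> L * norm (x - y)"
    and \<mu>_pos: "\<mu> > 0" and lower: "\<And>x. \<mu> * norm x \<le> k x"
    and G_meas [measurable]: "G \<in> borel_measurable borel"
    and G_nonneg: "\<And>x. 0 \<le> G x" and G_le: "\<And>x. G x \<le> L"
    and G_hom: "\<And>t x. t > 0 \<Longrightarrow> G (t *\<^sub>R x) = G x"
    and G_lip: "\<And>x. \<exists>e>0. \<forall>y\<in>ball x e. \<forall>z\<in>ball x e. \<bar>k y - k z\<bar> \<le> G x * norm (y - z)"
begin

lemma L_nonneg: "L \<ge> 0" using G_nonneg[of 0] G_le[of 0] by simp

lemma k_nonneg: "k x \<ge> 0" using lower[of x] \<mu>_pos by (meson mult_nonneg_nonneg norm_ge_zero order.trans less_imp_le)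

lemma k_pos: "x \<noteq> 0 \<Longrightarrow> k x > 0"
  using lower[of x] \<mu>_pos by (meson less_le_trans mult_pos_pos zero_less_norm_iff)

lemma continuous_k: "continuous_on S k"
proof -
  have "L-lipschitz_on S k"
    using lip L_nonneg by (intro lipschitz_onI) (auto simp: dist_norm)
  then show ?thesis by (rule lipschitz_on_continuous_on)
qed

lemma measurable_k [measurable]: "k \<in> borel_measurable borel"
  by (rule borel_measurable_continuous_onI[OF continuous_k])

definition kd :: "real \<Rightarrow> 'a \<Rightarrow> real" where "kd d = mollify k (mollifier d)"

lemma smooth_kd: "d > 0 \<Longrightarrow> smooth (kd d)"
  unfolding kd_def smooth_def
  using Ck_mollify[OF continuous_k] smooth_mollifier mollifier_eq_0 unfolding smooth_def by metis

lemma kd_approx: "d > 0 \<Longrightarrow> \<bar>kd d x - k x\<bar> \<le> L * d"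
  unfolding kd_def
proof (rule mollify_mollifier_approx[OF continuous_k])
  show "\<bar>k (x - z) - k x\<bar> \<le> L * d" if "norm z \<le> d" for z
    using lip[of "x - z" x] mult_left_mono[OF that L_nonneg] by simp
qed (use L_nonneg in auto)

text \<open>A Lipschitz bound for \<open>k\<close> on the ball of radius \<open>e\<close> is
  inherited by \<open>kd d\<close> on the ball of radius \<open>e / 2\<close>, because the averaged
  shifts are shorter than \<open>e / 2\<close>.\<close>

lemma norm_grad_kd_le:
  assumes d: "d > 0" and e: "2 * d < e" and g: "g \<ge> 0"
    and l: "\<And>y z. y \<in> ball x e \<Longrightarrow> z \<in> ball x e \<Longrightarrow> \<bar>k y - k z\<bar> \<le> g * norm (y - z)"
  shows "norm (grad (kd d) x) \<le> g"
proof (rule norm_grad_le_lipschitz[OF smooth_differentiable[OF smooth_kd[OF d]] g])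
  show "e / 2 > 0" using d e by simp
  fix y assume y: "y \<in> ball x (e / 2)"
  show "\<bar>kd d y - kd d x\<bar> \<le> g * norm (y - x)"
    unfolding kd_def
  proof (rule mollify_mollifier_diff[OF continuous_k d])
    show "0 \<le> g * norm (y - x)" using g by simp
    fix z :: 'a assume z: "norm z \<le> d"
    have "dist x (y - z) \<le> dist x y + norm z" using norm_triangle_ineq[of "x - y" z] by (simp add: dist_norm algebra_simps)
    then have "y - z \<in> ball x e" using y z e by simp
    moreover have "x - z \<in> ball x e" using z e d by (simp add: dist_norm)
    ultimately show "\<bar>k (y - z) - k (x - z)\<bar> \<le> g * norm (y - x)" using l[of "y - z" "x - z"] by simp
  qed
qed

lemma norm_grad_kd_le_L: "d > 0 \<Longrightarrow> norm (grad (kd d) x) \<le> L"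
  by (rule norm_grad_kd_le[of d "2 * d + 1"]) (use lip L_nonneg in auto)

text \<open>The radius on which \<open>G x\<close> is a Lipschitz bound depends on \<open>x\<close>,
  so the estimate holds only eventually and not uniformly; pointwise limits need no more.\<close>

lemma norm_grad_kd_le_G:
  assumes "d \<longlonglongrightarrow> 0" "\<And>n::nat. d n > 0"
  shows "\<forall>\<^sub>F n in sequentially. norm (grad (kd (d n)) x) \<le> G x"
proof -
  obtain e where e: "e > 0" "\<And>y z. y \<in> ball x e \<Longrightarrow> z \<in> ball x e \<Longrightarrow> \<bar>k y - k z\<bar> \<le> G x * norm (y - z)"
    using G_lip[of x] by blast
  have "\<forall>\<^sub>F n in sequentially. d n < e / 2" using order_tendstoD(2)[OF assms(1), of "e / 2"] e(1) by simp
  then show ?thesis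
    by (rule eventually_mono) (rule norm_grad_kd_le[OF assms(2) _ G_nonneg e(2)], auto)
qed

text \<open>Keeps the argument of \<open>W\<close> in the half-line on which \<open>W\<close> and
  its derivative are bounded.\<close>

lemma kd_nonneg: 
  assumes "d > 0" shows "kd d x \<ge> 0"
proof -
  have "kd d x = (\<integral>y. k (x - y) * mollifier d y \<partial>lborel)"
    unfolding kd_def
    by (rule mollify_eq[OF continuous_k smooth_continuous[OF smooth_mollifier[OF assms]] mollifier_eq_0[OF assms]])
  then show ?thesis
    by (auto intro!: Bochner_Integration.integral_nonneg mult_nonneg_nonneg k_nonneg mollifier_nonneg[OF assms])
qed

text \<open>
  The gauge replaces the distance to the origin in a radial function. Since the gauge is merely
  Lipschitz, its mollifications are used as test functions, and the mollification is then removed.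
\<close>

lemma lambda2_radial_le:
  fixes W W' :: "real \<Rightarrow> real"
  assumes q: "q > 0" and W: "smooth W" and W': "\<And>t. (W has_real_derivative W' t) (at t)"
    and cW': "continuous_on UNIV W'" and \<tau>: "\<tau> < 1"
    and zero: "\<And>t. t \<ge> \<tau> \<Longrightarrow> W t = 0" "\<And>t. t \<ge> \<tau> \<Longrightarrow> W' t = 0"
  shows "lambda2 q {x. k x < 1} * (\<integral>x. \<bar>W (k x)\<bar> powr q \<partial>lborel) powr (2 / q) \<le> (\<integral>x. (W' (k x))\<^sup>2 * (G x)\<^sup>2 \<partial>lborel)"
    and "integrable lborel (\<lambda>x. \<bar>W (k x)\<bar> powr q)" and "integrable lborel (\<lambda>x. (W' (k x))\<^sup>2 * (G x)\<^sup>2)"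
proof -
  let ?D = "{x. k x < 1}"
  \<comment> \<open>A level strictly between \<open>\<tau>\<close> and 1: all approximating
    functions vanish off the compact set \<open>{x. k x \<le> \<sigma>}\<close>, which lies inside
    \<open>{x. k x < 1}\<close>.\<close>
  define \<sigma> where "\<sigma> = max ((1 + \<tau>) / 2) 0"
  have \<sigma>: "\<sigma> < 1" "\<tau> < \<sigma>" "\<sigma> \<ge> 0" using \<tau> by (auto simp: \<sigma>_def max_def)
  \<comment> \<open>Small enough that mollifying moves \<open>k\<close> by at most
    \<open>\<sigma> - \<tau>\<close>; dividing by \<open>L + 1\<close> allows for
    \<open>L = 0\<close>.\<close>
  define d where "d = (\<lambda>n::nat. (\<sigma> - \<tau>) / (L + 1) * inverse (real (Suc n)))"
  have d0: "d n > 0" for n using \<sigma> L_nonneg by (simp add: d_def)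
  have d_lim: "d \<longlonglongrightarrow> 0" unfolding d_def using LIMSEQ_inverse_real_of_nat by (intro tendsto_mult_right_zero)
  have Ld: "L * d n \<le> \<sigma> - \<tau>" for n
  proof -
    have "L / (L + 1) * inverse (real (Suc n)) \<le> 1 * 1"
      using L_nonneg by (intro mult_mono) (auto simp: field_simps)
    then have "(\<sigma> - \<tau>) * (L / (L + 1) * inverse (real (Suc n))) \<le> (\<sigma> - \<tau>) * 1"
      using \<sigma> by (intro mult_left_mono) auto
    then show ?thesis by (simp add: d_def mult_ac)
  qed
  have supp: "kd (d n) x \<ge> \<tau>" if "k x \<ge> \<sigma>" for n x
    using kd_approx[OF d0, of n x] Ld[of n] that by linarith
  have cont_W: "continuous_on UNIV W" by (rule smooth_continuous[OF W])
  obtain B where B: "\<And>t. t \<ge> 0 \<Longrightarrow> \<bar>W t\<bar> \<le> B"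
  proof -
    have "compact (W ` {0..\<tau>})" by (intro compact_continuous_image continuous_on_subset[OF cont_W]) auto
    then obtain b where b: "\<And>t. t \<in> {0..\<tau>} \<Longrightarrow> norm (W t) \<le> b"
      using compact_imp_bounded bounded_iff by (metis imageI)
    have "\<bar>W t\<bar> \<le> \<bar>b\<bar>" if "t \<ge> 0" for t
      using b[of t] zero(1)[of t] that by (cases "t \<le> \<tau>") auto
    then show thesis using that by blast
  qed
  obtain B' where B': "\<And>t. t \<ge> 0 \<Longrightarrow> \<bar>W' t\<bar> \<le> B'"
  proof -
    have "compact (W' ` {0..\<tau>})" by (intro compact_continuous_image continuous_on_subset[OF cW']) auto
    then obtain b where b: "\<And>t. t \<in> {0..\<tau>} \<Longrightarrow> norm (W' t) \<le> b"
      using compact_imp_bounded bounded_iff by (metis imageI)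
    have "\<bar>W' t\<bar> \<le> \<bar>b\<bar>" if "t \<ge> 0" for t
      using b[of t] zero(2)[of t] that by (cases "t \<le> \<tau>") auto
    then show thesis using that by blast
  qed
  define \<psi> where "\<psi> = (\<lambda>n x. W (kd (d n) x))"
  have lim_k: "(\<lambda>n. kd (d n) x) \<longlonglongrightarrow> k x" for x
  proof (rule Lim_transform_bound[where g="\<lambda>n. L * d n" and f="\<lambda>n. kd (d n) x - k x", THEN Lim_null[THEN iffD2]])
    show "\<forall>\<^sub>F n in sequentially. norm (kd (d n) x - k x) \<le> norm (L * d n)"
      using kd_approx[OF d0] L_nonneg d0 by (auto intro!: always_eventually simp: abs_mult less_imp_le)
    show "(\<lambda>n. L * d n) \<longlonglongrightarrow> 0" using d_lim by (rule tendsto_mult_right_zero)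
  qed
  have K: "compact {x. k x \<le> \<sigma>}"
  proof (rule compact_eq_bounded_closed[THEN iffD2, OF conjI])
    have "norm x \<le> \<sigma> / \<mu>" if "k x \<le> \<sigma>" for x using lower[of x] that \<mu>_pos by (simp add: field_simps)
    then show "bounded {x. k x \<le> \<sigma>}" by (auto simp: bounded_iff)
    show "closed {x. k x \<le> \<sigma>}" by (intro closed_Collect_le continuous_k continuous_on_const)
  qed
  have int_K: "integrable lborel (\<lambda>x. c * indicator {x. k x \<le> \<sigma>} x :: real)" for c
    using borel_integrable_compact[OF K, of "\<lambda>_. c"] by (simp add: mult.commute)
  have \<psi>_T: "\<psi> n \<in> test_functions ?D" for n
  proof -
    have "smooth (\<psi> n)"
      using W smooth_kd[OF d0[of n]] Ck_compose_real unfolding smooth_def \<psi>_def by blast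
    moreover have "{x. \<psi> n x \<noteq> 0} \<subseteq> {x. k x \<le> \<sigma>}"
      using supp zero(1) unfolding \<psi>_def by (force simp: not_le)
    then have c: "closure {x. \<psi> n x \<noteq> 0} \<subseteq> {x. k x \<le> \<sigma>}"
      using K by (simp add: closure_minimal compact_imp_closed)
    moreover have "compact (closure {x. \<psi> n x \<noteq> 0})"
      using c K by (metis bounded_subset closed_closure compact_eq_bounded_closed)
    ultimately show ?thesis using \<sigma>(1) by (auto simp: test_functions_def)
  qed
  have [measurable]: "kd (d n) \<in> borel_measurable borel" "grad (kd (d n)) \<in> borel_measurable borel" for n
    using smooth_borel_measurable[OF smooth_kd[OF d0]] by auto
  have [measurable]: "W \<in> borel_measurable borel" "W' \<in> borel_measurable borel"
    using cont_W cW' borel_measurable_continuous_onI by auto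
  have mass_lim: "(\<lambda>n. mass q (\<psi> n)) \<longlonglongrightarrow> (\<integral>x. \<bar>W (k x)\<bar> powr q \<partial>lborel)"
    and intW: "integrable lborel (\<lambda>x. \<bar>W (k x)\<bar> powr q)"
  proof -
    have lim: "AE x in lborel. (\<lambda>n. \<bar>\<psi> n x\<bar> powr q) \<longlonglongrightarrow> \<bar>W (k x)\<bar> powr q"
    proof (rule AE_I2)
      fix x
      have "(\<lambda>n. W (kd (d n) x)) \<longlonglongrightarrow> W (k x)"
        using cont_W lim_k by (rule continuous_on_tendsto_compose) auto
      then have "(\<lambda>n. \<bar>\<psi> n x\<bar>) \<longlonglongrightarrow> \<bar>W (k x)\<bar>" unfolding \<psi>_def by (rule tendsto_rabs)
      then show "(\<lambda>n. \<bar>\<psi> n x\<bar> powr q) \<longlonglongrightarrow> \<bar>W (k x)\<bar> powr q"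
        using q by (intro tendsto_powr' tendsto_const) auto
    qed
    have bnd: "AE x in lborel. norm (\<bar>\<psi> n x\<bar> powr q) \<le> B powr q * indicator {x. k x \<le> \<sigma>} x" for n
    proof (rule AE_I2)
      fix x
      show "norm (\<bar>\<psi> n x\<bar> powr q) \<le> B powr q * indicator {x. k x \<le> \<sigma>} x"
        using B[OF kd_nonneg[OF d0], of n x] supp[of x n] zero(1) q
        by (auto simp: \<psi>_def split: split_indicator intro!: powr_mono2)
    qed
    show "(\<lambda>n. mass q (\<psi> n)) \<longlonglongrightarrow> (\<integral>x. \<bar>W (k x)\<bar> powr q \<partial>lborel)"
      unfolding mass_def
      by (rule integral_dominated_convergence[OF _ _ int_K lim bnd]) (simp_all add: \<psi>_def)
    show "integrable lborel (\<lambda>x. \<bar>W (k x)\<bar> powr q)"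
      by (rule integrable_dominated_convergence[OF _ _ int_K lim bnd]) (simp_all add: \<psi>_def)
  qed
  define F where "F = (\<lambda>n x. (W' (kd (d n) x))\<^sup>2 * (max (norm (grad (kd (d n)) x)) (G x))\<^sup>2)"
  have [measurable]: "F n \<in> borel_measurable borel" for n unfolding F_def by measurable
  have limF: "AE x in lborel. (\<lambda>n. F n x) \<longlonglongrightarrow> (W' (k x))\<^sup>2 * (G x)\<^sup>2"
  proof (rule AE_I2)
    fix x
    have "(\<lambda>n. W' (kd (d n) x)) \<longlonglongrightarrow> W' (k x)"
      using cW' lim_k by (rule continuous_on_tendsto_compose) auto
    then have "(\<lambda>n. (W' (kd (d n) x))\<^sup>2 * (G x)\<^sup>2) \<longlonglongrightarrow> (W' (k x))\<^sup>2 * (G x)\<^sup>2"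
      by (intro tendsto_intros)
    moreover have "\<forall>\<^sub>F n in sequentially. (W' (kd (d n) x))\<^sup>2 * (G x)\<^sup>2 = F n x"
      using norm_grad_kd_le_G[OF d_lim d0, of x] by (rule eventually_mono) (simp add: F_def max_def)
    ultimately show "(\<lambda>n. F n x) \<longlonglongrightarrow> (W' (k x))\<^sup>2 * (G x)\<^sup>2"
      using tendsto_cong by force
  qed
  have bndF: "AE x in lborel. norm (F n x) \<le> (B'\<^sup>2 * L\<^sup>2) * indicator {x. k x \<le> \<sigma>} x" for n
  proof (rule AE_I2)
    fix x
    have "(W' (kd (d n) x))\<^sup>2 \<le> B'\<^sup>2"
      using B'[OF kd_nonneg[OF d0], of n x] by (simp add: abs_le_square_iff[symmetric])
    moreover have "(max (norm (grad (kd (d n)) x)) (G x))\<^sup>2 \<le> L\<^sup>2"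
      using norm_grad_kd_le_L[OF d0] G_le by (intro power_mono) (auto simp: le_max_iff_disj)
    ultimately have "F n x \<le> B'\<^sup>2 * L\<^sup>2" unfolding F_def by (intro mult_mono) auto
    moreover have "F n x = 0" if "\<not> k x \<le> \<sigma>"
      using supp[of x n] zero(2) that by (simp add: F_def)
    ultimately show "norm (F n x) \<le> (B'\<^sup>2 * L\<^sup>2) * indicator {x. k x \<le> \<sigma>} x"
      by (auto simp: F_def split: split_indicator)
  qed
  have limF': "(\<lambda>n. \<integral>x. F n x \<partial>lborel) \<longlonglongrightarrow> (\<integral>x. (W' (k x))\<^sup>2 * (G x)\<^sup>2 \<partial>lborel)"
    by (rule integral_dominated_convergence[OF _ _ int_K limF bndF]) simp_all
  have intF: "integrable lborel (F n)" for n
    by (rule integrable_dominated_convergence2[OF _ _ int_K limF bndF]) simp_all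
  have le: "lambda2 q ?D * mass q (\<psi> n) powr (2 / q) \<le> (\<integral>x. F n x \<partial>lborel)" for n
  proof -
    have "lambda2 q ?D * mass q (\<psi> n) powr (2 / q) \<le> energy (\<psi> n)"
      by (rule lambda2_mult_le_energy[OF \<psi>_T q])
    also have "\<dots> \<le> (\<integral>x. F n x \<partial>lborel)"
      unfolding energy_def
    proof (rule integral_mono[OF test_functions_integrable(1)[OF \<psi>_T] intF])
      fix x
      have "grad (\<psi> n) x = W' (kd (d n) x) *\<^sub>R grad (kd (d n)) x"
        unfolding \<psi>_def by (rule grad_compose_real[OF W' smooth_differentiable[OF smooth_kd[OF d0]]])
      then show "(norm (grad (\<psi> n) x))\<^sup>2 \<le> F n x"
        by (simp add: F_def power_mult_distrib mult_left_mono power_mono)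
    qed
    finally show ?thesis .
  qed
  have "(\<lambda>n. lambda2 q ?D * mass q (\<psi> n) powr (2 / q)) \<longlonglongrightarrow> lambda2 q ?D * (\<integral>x. \<bar>W (k x)\<bar> powr q \<partial>lborel) powr (2 / q)"
    using q by (intro tendsto_mult tendsto_const tendsto_powr' mass_lim) (auto intro!: always_eventually mass_nonneg)
  from LIMSEQ_le[OF this limF'] le
  show "lambda2 q ?D * (\<integral>x. \<bar>W (k x)\<bar> powr q \<partial>lborel) powr (2 / q) \<le> (\<integral>x. (W' (k x))\<^sup>2 * (G x)\<^sup>2 \<partial>lborel)"
    by blast
  show "integrable lborel (\<lambda>x. \<bar>W (k x)\<bar> powr q)" by (rule intW)
  show "integrable lborel (\<lambda>x. (W' (k x))\<^sup>2 * (G x)\<^sup>2)"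
    by (rule integrable_dominated_convergence[OF _ _ int_K limF bndF]) simp_all
qed

end

text \<open>After division by \<beta> this is Bernoulli's inequality, which is
  \<open>weighted_am_gm3\<close> for \<open>x powr s\<close> and 1 with weights \<open>1 / s\<close>
  and \<open>1 - 1 / s\<close>.\<close>

lemma powr_ge_tangent:
  fixes b \<beta> s :: real
  assumes "b \<ge> 0" "\<beta> > 0" "s \<ge> 1"
  shows "b powr s \<ge> \<beta> powr s + s * \<beta> powr (s - 1) * (b - \<beta>)"
proof -
  define x where "x = b / \<beta>"
  have x: "x \<ge> 0" using assms by (simp add: x_def)
  have "(x powr s) powr (1 / s) * 1 powr (1 - 1 / s) * 1 powr 0 \<le> 1 / s * x powr s + (1 - 1 / s) * 1 + 0 * 1"
    using assms by (intro weighted_am_gm3) (auto simp: field_simps)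
  then have "x \<le> 1 / s * x powr s + (1 - 1 / s)" using assms x by (simp add: powr_powr)
  then have "s * x \<le> s * (1 / s * x powr s + (1 - 1 / s))" using assms by (intro mult_left_mono) auto
  also have "\<dots> = x powr s + (s - 1)" using assms by (simp add: field_simps)
  finally have "1 + s * (x - 1) \<le> x powr s" by (simp add: algebra_simps)
  then have "\<beta> powr s * (1 + s * (x - 1)) \<le> \<beta> powr s * x powr s" by (intro mult_left_mono) auto
  also have "\<beta> powr s * x powr s = b powr s" using assms by (simp add: x_def powr_divide)
  also have "\<beta> powr s * (1 + s * (x - 1)) = \<beta> powr s + s * \<beta> powr (s - 1) * (b - \<beta>)"
  proof -
    have "\<beta> powr s = \<beta> powr (s - 1) * \<beta>" using assms by (simp add: powr_diff)
    then show ?thesis using assms by (simp add: x_def field_simps)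
  qed
  finally show ?thesis .
qed

section \<open>Competitors from single rays and their average\<close>

lemma test_functions_ball_radius:
  assumes "\<phi> \<in> test_functions (ball (0::'a::euclidean_space) 1)"
  obtains \<tau> where "0 \<le> \<tau>" "\<tau> < 1" "\<And>x. norm x \<ge> \<tau> \<Longrightarrow> \<phi> x = 0" "\<And>x. norm x \<ge> \<tau> \<Longrightarrow> grad \<phi> x = 0"
proof -
  let ?K = "closure {x. \<phi> x \<noteq> 0}"
  have K: "compact ?K" "?K \<subseteq> ball 0 1" using assms by (auto simp: test_functions_def)
  obtain \<tau> where \<tau>: "0 \<le> \<tau>" "\<tau> < 1" "\<And>x. x \<in> ?K \<Longrightarrow> norm x < \<tau>"
  proof (cases "?K = {}")
    case True
    show thesis using that[of 0] unfolding True by simp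
  next
    case False
    obtain y where y: "y \<in> ?K" "\<And>x. x \<in> ?K \<Longrightarrow> norm x \<le> norm y"
      using continuous_attains_sup[OF K(1) False, of norm] by (auto intro: continuous_intros)
    have "norm y < 1" using y(1) K(2) by auto
    then show thesis using that[of "(norm y + 1) / 2"] y(2) by fastforce
  qed
  show thesis
  proof (rule that[OF \<tau>(1,2)])
    show "\<phi> x = 0" if "norm x \<ge> \<tau>" for x
      by (rule grad_eq_0_outside_support(1)) (use \<tau>(3)[of x] that in auto)
    show "grad \<phi> x = 0" if "norm x \<ge> \<tau>" for x
      by (rule grad_eq_0_outside_support(2)) (use \<tau>(3)[of x] that in auto)
  qed
qed

context lipschitz_gauge
begin

lemma k_zero: "k 0 = 0" using hom[of 2 0] by simp

lemma open_sublevel: "open {x. k x < 1}"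
  by (intro open_Collect_less continuous_k continuous_on_const)

lemma bounded_sublevel: "bounded {x. k x < 1}"
proof -
  have "norm x \<le> 1 / \<mu>" if "k x < 1" for x using lower[of x] that \<mu>_pos by (simp add: field_simps)
  then show ?thesis by (auto simp: bounded_iff)
qed

text \<open>On a ray \<open>k\<close> takes the value \<open>t\<close> and \<open>H\<close> is
  constant, so the polar formula splits into a radial and an angular factor.\<close>

lemma nn_integral_gauge:
  assumes [measurable]: "f \<in> borel_measurable borel" "H \<in> borel_measurable borel"
    and H: "\<And>t x. t > 0 \<Longrightarrow> H (t *\<^sub>R x) = H x"
  shows "(\<integral>\<^sup>+x. f (k x) * H x \<partial>lborel) = ennreal DIM('a) *
    ((\<integral>\<^sup>+x. indicator {x. k x < 1} x * H x \<partial>lborel) *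
     (\<integral>\<^sup>+t. indicator {0<..} t * ennreal (t ^ (DIM('a) - 1)) * f t \<partial>lborel))"
proof -
  let ?I = "\<integral>\<^sup>+t. indicator {0<..} t * ennreal (t ^ (DIM('a) - 1)) * f t \<partial>lborel"
  have "(\<integral>\<^sup>+z. indicator {z. k z < 1} z * (\<integral>\<^sup>+t. indicator {0<..} t * ennreal (t ^ (DIM('a) - 1)) *
      (f (k ((t / k z) *\<^sub>R z)) * H ((t / k z) *\<^sub>R z)) \<partial>lborel) \<partial>lborel)
    = (\<integral>\<^sup>+z. indicator {z. k z < 1} z * H z * ?I \<partial>lborel)"
  proof (rule nn_integral_cong_AE)
    show "AE z in lborel. indicator {z. k z < 1} z * (\<integral>\<^sup>+t. indicator {0<..} t * ennreal (t ^ (DIM('a) - 1)) *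
      (f (k ((t / k z) *\<^sub>R z)) * H ((t / k z) *\<^sub>R z)) \<partial>lborel) = indicator {z. k z < 1} z * H z * ?I"
      using AE_lborel_singleton[of "0::'a"]
    proof eventually_elim
      case (elim z)
      have kz: "k z > 0" using k_pos elim by simp
      have "(\<integral>\<^sup>+t. indicator {0<..} t * ennreal (t ^ (DIM('a) - 1)) *
        (f (k ((t / k z) *\<^sub>R z)) * H ((t / k z) *\<^sub>R z)) \<partial>lborel)
        = (\<integral>\<^sup>+t. H z * (indicator {0<..} t * ennreal (t ^ (DIM('a) - 1)) * f t) \<partial>lborel)"
        using kz by (intro nn_integral_cong) (auto simp: hom H mult_ac split: split_indicator)
      also have "\<dots> = H z * ?I" by (rule nn_integral_cmult) measurable
      finally show ?case by (simp add: mult.assoc)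
    qed
  qed
  also have "\<dots> = (\<integral>\<^sup>+z. indicator {z. k z < 1} z * H z \<partial>lborel) * ?I"
    by (rule nn_integral_multc) measurable
  finally show ?thesis
    by (subst nn_integral_polar[OF measurable_k hom k_pos]) simp_all
qed

text \<open>\<open>b\<close> and \<open>a\<close> are the radial mass and energy of \<phi> on the
  ray through \<open>z\<close>. The geometry of the sublevel set enters only through its volume and
  \<open>g\<close>, so the inequalities for different rays share their constants.\<close>

lemma lambda2_ray_le:
  fixes q g :: real and z :: 'a
  assumes q: "q > 0" and t: "\<phi> \<in> test_functions (ball (0::'a) 1)" and z: "z \<noteq> 0"
    and g: "(\<integral>\<^sup>+x. indicator {x. k x < 1} x * ennreal ((G x)\<^sup>2) \<partial>lborel) = ennreal g" "g > 0"
  defines "b \<equiv> \<integral>\<^sup>+t. indicator {0<..} t * ennreal (t ^ (DIM('a) - 1)) * ennreal (\<bar>\<phi> ((t / norm z) *\<^sub>R z)\<bar> powr q) \<partial>lborel"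
    and "a \<equiv> \<integral>\<^sup>+t. indicator {0<..} t * ennreal (t ^ (DIM('a) - 1)) * ennreal ((norm (grad \<phi> ((t / norm z) *\<^sub>R z)))\<^sup>2) \<partial>lborel"
  shows "b < \<infinity>"
    and "ennreal (lambda2 q {x. k x < 1} * (real DIM('a) * measure lebesgue {x. k x < 1} * enn2real b) powr (2 / q)) \<le> ennreal (real DIM('a) * g) * a"
proof -
  let ?N = "real DIM('a)" and ?D = "{x. k x < 1}"
  define V where "V = measure lebesgue ?D"
  have "0 \<in> ?D" using k_zero by simp
  then have "?D \<noteq> {}" by blast
  then have V: "V > 0" unfolding V_def by (intro measure_lebesgue_open_pos open_sublevel bounded_sublevel)
  have eV: "emeasure lborel ?D = ennreal V"
    unfolding V_def by (rule emeasure_lborel_open_bounded[OF open_sublevel bounded_sublevel])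
  note s = test_functionsD(1)[OF t]
  obtain \<tau> where \<tau>: "0 \<le> \<tau>" "\<tau> < 1" "\<And>x. norm x \<ge> \<tau> \<Longrightarrow> \<phi> x = 0" "\<And>x. norm x \<ge> \<tau> \<Longrightarrow> grad \<phi> x = 0"
    using test_functions_ball_radius[OF t] by blast
  define e where "e = (1 / norm z) *\<^sub>R z"
  have e: "norm e = 1" using z by (simp add: e_def)
  define W where "W = (\<lambda>t. \<phi> (t *\<^sub>R e))"
  define W' where "W' = (\<lambda>t. grad \<phi> (t *\<^sub>R e) \<bullet> e)"
  have sW: "smooth W"
    unfolding smooth_def W_def
    using Ck_compose_affine[OF bounded_linear_scaleR_left, of _ \<phi> 0 e] s unfolding smooth_def by simp
  have dW: "(W has_real_derivative W' t) (at t)" for t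
  proof -
    have 1: "((\<lambda>t. t *\<^sub>R e) has_derivative (\<lambda>h. h *\<^sub>R e)) (at t)"
      by (auto intro!: derivative_eq_intros)
    have df: "\<phi> differentiable (at (t *\<^sub>R e))" by (rule smooth_differentiable[OF s])
    then have "(\<phi> has_derivative frechet_derivative \<phi> (at (t *\<^sub>R e))) (at (t *\<^sub>R e))"
      by (simp add: frechet_derivative_works)
    from has_derivative_compose[OF 1 this]
    have "(W has_derivative (\<lambda>h. frechet_derivative \<phi> (at (t *\<^sub>R e)) (h *\<^sub>R e))) (at t)" unfolding W_def .
    moreover have "frechet_derivative \<phi> (at (t *\<^sub>R e)) (h *\<^sub>R e) = W' t * h" for h
      using linear_scale[OF linear_frechet_derivative[OF df], of h e] grad_inner[OF df, of e] by (simp add: W'_def)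
    ultimately show ?thesis by (simp add: has_field_derivative_def)
  qed
  have cW': "continuous_on UNIV W'"
    unfolding W'_def
    by (intro continuous_on_inner continuous_on_const continuous_on_compose2[OF smooth_continuous_grad[OF s]]) (auto intro!: continuous_intros)
  have zero: "W t = 0" "W' t = 0" if "t \<ge> \<tau>" for t
    using \<tau>(3,4)[of "t *\<^sub>R e"] \<tau>(1) that e by (auto simp: W_def W'_def)
  note R = lambda2_radial_le[OF q sW dW cW' \<tau>(2) zero]
  have [measurable]: "W \<in> borel_measurable borel" "W' \<in> borel_measurable borel"
    using smooth_continuous[OF sW] cW' borel_measurable_continuous_onI by auto
  have W_eq: "\<phi> ((t / norm z) *\<^sub>R z) = W t" for t by (simp add: W_def e_def)
  \<comment> \<open>The competitor sees only the radial derivative of \<phi>, which is at most the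
    full gradient.\<close>
  have W'_le: "(W' t)\<^sup>2 \<le> (norm (grad \<phi> ((t / norm z) *\<^sub>R z)))\<^sup>2" for t
  proof -
    have "\<bar>W' t\<bar> \<le> norm (grad \<phi> (t *\<^sub>R e))"
      using Cauchy_Schwarz_ineq2[of "grad \<phi> (t *\<^sub>R e)" e] e by (simp add: W'_def)
    then have "(W' t)\<^sup>2 \<le> (norm (grad \<phi> (t *\<^sub>R e)))\<^sup>2" by (simp add: abs_le_square_iff[symmetric])
    then show ?thesis by (simp add: e_def)
  qed
  define X where "X = (\<integral>x. \<bar>W (k x)\<bar> powr q \<partial>lborel)"
  have X0: "X \<ge> 0" by (simp add: X_def)
  have "ennreal X = (\<integral>\<^sup>+x. ennreal (\<bar>W (k x)\<bar> powr q) * 1 \<partial>lborel)"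
    unfolding X_def using R(2) by (simp add: nn_integral_eq_integral)
  also have "\<dots> = ennreal ?N * (ennreal V * b)"
    by (subst nn_integral_gauge[where H="\<lambda>_. 1" and f="\<lambda>t. ennreal (\<bar>W t\<bar> powr q)"])
       (simp_all add: b_def W_eq eV[symmetric])
  finally have Xb: "ennreal X = ennreal ?N * (ennreal V * b)" .
  have "b \<noteq> \<infinity>"
  proof
    assume "b = \<infinity>"
    then have "ennreal X = \<infinity>" using Xb V by (simp add: ennreal_mult_top)
    then show False by simp
  qed
  then show bfin: "b < \<infinity>" by (simp add: less_top)
  have X_eq: "X = ?N * V * enn2real b"
  proof -
    have "ennreal ?N * (ennreal V * ennreal (enn2real b)) = ennreal (?N * V * enn2real b)"
      using V by (simp add: ennreal_mult mult.assoc)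
    moreover have "ennreal (enn2real b) = b" using bfin by simp
    ultimately have "ennreal X = ennreal (?N * V * enn2real b)" using Xb by simp
    then show ?thesis using X0 V by (subst (asm) ennreal_inj) auto
  qed
  have "ennreal (lambda2 q ?D * X powr (2 / q)) \<le> ennreal (\<integral>x. (W' (k x))\<^sup>2 * (G x)\<^sup>2 \<partial>lborel)"
    using R(1) unfolding X_def by (rule ennreal_leI)
  also have "\<dots> = (\<integral>\<^sup>+x. ennreal ((W' (k x))\<^sup>2) * ennreal ((G x)\<^sup>2) \<partial>lborel)"
    using R(3) by (subst nn_integral_eq_integral[symmetric]) (auto simp: ennreal_mult)
  also have "\<dots> = ennreal ?N * (ennreal g * (\<integral>\<^sup>+t. indicator {0<..} t * ennreal (t ^ (DIM('a) - 1)) * ennreal ((W' t)\<^sup>2) \<partial>lborel))"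
    unfolding g(1)[symmetric] by (rule nn_integral_gauge) (simp_all add: G_hom)
  also have "\<dots> \<le> ennreal ?N * (ennreal g * a)"
    unfolding a_def by (intro mult_left_mono nn_integral_mono mult_left_mono ennreal_leI W'_le) auto
  also have "\<dots> = ennreal (?N * g) * a" using g by (simp add: ennreal_mult mult.assoc)
  finally show "ennreal (lambda2 q ?D * (?N * measure lebesgue ?D * enn2real b) powr (2 / q)) \<le> ennreal (?N * g) * a"
    unfolding X_eq V_def .
qed

text \<open>
  Transplanting \<open>\<phi>\<close> along a single ray gives a competitor for \<open>{k < 1}\<close>. Averaging the resulting
  inequalities over all rays replaces a symmetrisation of \<open>\<phi>\<close>: since \<open>2 / q \<ge> 1\<close>, Jensen's
  inequality (used through the tangent line at the mean value) goes in the right direction.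
\<close>

theorem lambda2_gauge_le:
  fixes q g :: real
  assumes q: "1 \<le> q" "q \<le> 2"
    and g: "(\<integral>\<^sup>+x. indicator {x. k x < 1} x * ennreal ((G x)\<^sup>2) \<partial>lborel) = ennreal g" "g > 0"
  shows "lambda2 q {x. k x < 1} * measure lebesgue {x. k x < 1} powr (2 / q) * measure lebesgue (ball (0::'a) 1) powr (1 - 2 / q)
    \<le> g * lambda2 q (ball (0::'a) 1)"
proof -
  let ?N = "real DIM('a)" and ?D = "{x. k x < 1}" and ?B = "ball (0::'a) 1"
  define w where "w = measure lebesgue ?B"
  define V where "V = measure lebesgue ?D"
  define s where "s = 2 / q"
  define lam where "lam = lambda2 q ?D"
  have q0: "q > 0" and s: "s \<ge> 1" using q by (auto simp: s_def)
  have "0 \<in> ?D" using k_zero by simp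
  then have ne: "?D \<noteq> {}" by blast
  have w: "w > 0" unfolding w_def by (rule measure_lebesgue_open_pos) auto
  have V: "V > 0" unfolding V_def by (intro measure_lebesgue_open_pos open_sublevel bounded_sublevel ne)
  have lam: "lam \<ge> 0" unfolding lam_def by (rule lambda2_nonneg[OF open_sublevel ne q0])
  have ew: "emeasure lborel ?B = ennreal w" unfolding w_def by (rule emeasure_lborel_ball)
  have B: "{z::'a. norm z < 1} = ?B" by (auto simp: ball_def)
  have main: "lam * V powr s * w powr (1 - s) / g * mass q \<phi> powr (2 / q) \<le> energy \<phi>" if t: "\<phi> \<in> test_functions ?B" for \<phi>
  proof (cases "\<phi> = (\<lambda>x. 0)")
    case True
    then show ?thesis using energy_nonneg[of \<phi>] by (simp add: mass_def)
  next
    case False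
    note [measurable] = smooth_borel_measurable[OF test_functionsD(1)[OF t]]
    have m: "mass q \<phi> > 0" by (rule mass_pos[OF t False q0])
    define b where "b = (\<lambda>z. \<integral>\<^sup>+t. indicator {0<..} t * ennreal (t ^ (DIM('a) - 1)) * ennreal (\<bar>\<phi> ((t / norm z) *\<^sub>R z)\<bar> powr q) \<partial>lborel)"
    define a where "a = (\<lambda>z. \<integral>\<^sup>+t. indicator {0<..} t * ennreal (t ^ (DIM('a) - 1)) * ennreal ((norm (grad \<phi> ((t / norm z) *\<^sub>R z)))\<^sup>2) \<partial>lborel)"
    have [measurable]: "a \<in> borel_measurable borel" "b \<in> borel_measurable borel" unfolding a_def b_def by measurable
    have IB [measurable]: "indicator ?B \<in> borel_measurable borel" by (auto intro!: borel_measurable_indicator)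
    have cancel: "X = ennreal (y / ?N)" if "ennreal y = ennreal ?N * X" "y \<ge> 0" for X y
    proof -
      have "ennreal (1 / ?N) * ennreal ?N = 1" by (subst ennreal_mult[symmetric]) auto
      then have "X = ennreal (1 / ?N) * ennreal y" unfolding that(1) by (metis mult.assoc mult_1)
      then show ?thesis using that(2) by (simp add: ennreal_mult[symmetric])
    qed
    have int_b: "(\<integral>\<^sup>+z. indicator ?B z * b z \<partial>lborel) = ennreal (mass q \<phi> / ?N)"
    proof (rule cancel)
      have "ennreal (mass q \<phi>) = (\<integral>\<^sup>+x. ennreal (\<bar>\<phi> x\<bar> powr q) \<partial>lborel)"
        unfolding mass_def using test_functions_integrable(2)[OF t q0] by (simp add: nn_integral_eq_integral)
      then show "ennreal (mass q \<phi>) = ennreal ?N * (\<integral>\<^sup>+z. indicator ?B z * b z \<partial>lborel)"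
        unfolding b_def B[symmetric] by (subst (asm) nn_integral_polar[where k=norm]) auto
    qed (rule mass_nonneg)
    have int_a: "(\<integral>\<^sup>+z. indicator ?B z * a z \<partial>lborel) = ennreal (energy \<phi> / ?N)"
    proof (rule cancel)
      have "ennreal (energy \<phi>) = (\<integral>\<^sup>+x. ennreal ((norm (grad \<phi> x))\<^sup>2) \<partial>lborel)"
        unfolding energy_def using test_functions_integrable(1)[OF t] by (simp add: nn_integral_eq_integral)
      then show "ennreal (energy \<phi>) = ennreal ?N * (\<integral>\<^sup>+z. indicator ?B z * a z \<partial>lborel)"
        unfolding a_def B[symmetric] by (subst (asm) nn_integral_polar[where k=norm]) auto
    qed (rule energy_nonneg)
    \<comment> \<open>The mean of \<open>b\<close> over the unit ball, since \<open>b\<close> has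
      integral \<open>mass q \<phi> / N\<close> there.\<close>
    define \<beta> where "\<beta> = mass q \<phi> / (?N * w)"
    have \<beta>: "\<beta> > 0" using m w by (simp add: \<beta>_def)
    define \<Lambda> where "\<Lambda> = lam * (?N * V) powr s"
    have \<Lambda>: "\<Lambda> \<ge> 0" using lam by (simp add: \<Lambda>_def)
    define c where "c = \<Lambda> * s * \<beta> powr (s - 1)"
    have c: "c \<ge> 0" using \<Lambda> s by (simp add: c_def)
    \<comment> \<open>The tangent inequality at the mean, with the negative term moved to the other
      side because \<open>ennreal\<close> has no negative values.\<close>
    have ptw: "ennreal (\<Lambda> * \<beta> powr s) + ennreal c * b z \<le> ennreal (?N * g) * a z + ennreal (c * \<beta>)" if z: "z \<noteq> 0" for z
    proof -
      note R = lambda2_ray_le[OF q0 t z g]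
      define bz where "bz = enn2real (b z)"
      have bz: "b z = ennreal bz" "bz \<ge> 0" using R(1) by (auto simp: bz_def b_def)
      have "\<Lambda> * \<beta> powr s + c * bz = \<Lambda> * (\<beta> powr s + s * \<beta> powr (s - 1) * (bz - \<beta>)) + c * \<beta>"
        by (simp add: c_def algebra_simps)
      also have "\<dots> \<le> \<Lambda> * bz powr s + c * \<beta>"
        using powr_ge_tangent[OF bz(2) \<beta> s] \<Lambda> by (intro add_right_mono mult_left_mono)
      also have "\<Lambda> * bz powr s = lam * (?N * V * bz) powr s"
        using V bz(2) by (simp add: \<Lambda>_def powr_mult)
      finally have "ennreal (\<Lambda> * \<beta> powr s + c * bz) \<le> ennreal (lam * (?N * V * bz) powr s + c * \<beta>)"
        by (rule ennreal_leI)
      also have "\<dots> = ennreal (lam * (?N * V * bz) powr s) + ennreal (c * \<beta>)"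
        using lam c \<beta> by (intro ennreal_plus) auto
      also have "\<dots> \<le> ennreal (?N * g) * a z + ennreal (c * \<beta>)"
        using R(2) unfolding lam_def V_def bz_def b_def a_def s_def by (rule add_right_mono)
      finally show ?thesis
        using \<Lambda> c bz by (simp add: ennreal_plus ennreal_mult)
    qed
    have "(\<integral>\<^sup>+z. indicator ?B z * (ennreal (\<Lambda> * \<beta> powr s) + ennreal c * b z) \<partial>lborel)
      \<le> (\<integral>\<^sup>+z. indicator ?B z * (ennreal (?N * g) * a z + ennreal (c * \<beta>)) \<partial>lborel)"
      using AE_lborel_singleton[of "0::'a"] ptw
      by (intro nn_integral_mono_AE) (auto elim!: eventually_mono intro!: mult_left_mono)
    moreover have "(\<integral>\<^sup>+z. indicator ?B z * (ennreal u + ennreal v * h z) \<partial>lborel)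
      = ennreal u * ennreal w + ennreal v * (\<integral>\<^sup>+z. indicator ?B z * h z \<partial>lborel)"
      if [measurable]: "h \<in> borel_measurable borel" for u v h
    proof -
      have "(\<integral>\<^sup>+z. indicator ?B z * (ennreal u + ennreal v * h z) \<partial>lborel)
        = (\<integral>\<^sup>+z. ennreal u * indicator ?B z + ennreal v * (indicator ?B z * h z) \<partial>lborel)"
        by (intro nn_integral_cong) (simp add: distrib_left mult_ac)
      also have "\<dots> = ennreal u * ennreal w + ennreal v * (\<integral>\<^sup>+z. indicator ?B z * h z \<partial>lborel)"
        using IB by (simp add: nn_integral_add nn_integral_cmult ew)
      finally show ?thesis .
    qed
    ultimately have *: "ennreal (\<Lambda> * \<beta> powr s) * ennreal w + ennreal c * ennreal (mass q \<phi> / ?N)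
      \<le> ennreal (c * \<beta>) * ennreal w + ennreal (?N * g) * ennreal (energy \<phi> / ?N)"
      by (simp add: add.commute[of "ennreal (?N * g) * _"] int_a int_b)
    have "ennreal (\<Lambda> * \<beta> powr s * w + c * (mass q \<phi> / ?N)) \<le> ennreal (c * \<beta> * w + ?N * g * (energy \<phi> / ?N))"
    proof -
      have lincomb: "ennreal u * ennreal x + ennreal v * ennreal y = ennreal (u * x + v * y)"
        if "0 \<le> u" "0 \<le> v" "0 \<le> x" "0 \<le> y" for u v x y
        using that by (simp add: ennreal_mult)
      have "ennreal (\<Lambda> * \<beta> powr s) * ennreal w + ennreal c * ennreal (mass q \<phi> / ?N)
        = ennreal (\<Lambda> * \<beta> powr s * w + c * (mass q \<phi> / ?N))"
        by (rule lincomb) (use \<Lambda> w c m in auto)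
      moreover have "ennreal (c * \<beta>) * ennreal w + ennreal (?N * g) * ennreal (energy \<phi> / ?N)
        = ennreal (c * \<beta> * w + ?N * g * (energy \<phi> / ?N))"
        by (rule lincomb) (use \<beta> w c g energy_nonneg[of \<phi>] in auto)
      ultimately show ?thesis using * by simp
    qed
    then have "\<Lambda> * \<beta> powr s * w + c * (mass q \<phi> / ?N) \<le> c * \<beta> * w + ?N * g * (energy \<phi> / ?N)"
      using c \<beta> w g energy_nonneg[of \<phi>] by (subst (asm) ennreal_le_iff) auto
    \<comment> \<open>The choice of \<beta> as the mean makes the linear terms cancel after
      integration.\<close>
    moreover have "c * (mass q \<phi> / ?N) = c * \<beta> * w" using w by (simp add: \<beta>_def)
    ultimately have le: "\<Lambda> * \<beta> powr s * w \<le> g * energy \<phi>" by simp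
    have "\<Lambda> * \<beta> powr s * w = lam * V powr s * w powr (1 - s) * mass q \<phi> powr s"
      using V w m by (simp add: \<Lambda>_def \<beta>_def powr_mult powr_divide powr_diff)
    then show ?thesis using le g(2) by (simp add: s_def field_simps)
  qed
  have "lam * V powr s * w powr (1 - s) / g \<le> lambda2 q ?B"
    by (rule le_lambda2I[OF _ _ q0 main]) auto
  then show ?thesis using g(2) by (simp add: lam_def V_def s_def w_def field_simps)
qed

end

subsection \<open>Convex sets other than balls\<close>

text \<open>\<open>S x\<close> is the set of dilation factors that capture \<open>x\<close>;
  convexity and 0 in \<Omega> make it closed upwards. The weights t / (t + u) and u / (t + u) give
  subadditivity, the two balls give the bounds.\<close>

lemma minkowski_gauge:
  fixes \<Omega> :: "'a::euclidean_space set"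
  assumes op: "open \<Omega>" and cv: "convex \<Omega>" and R: "R > 0" "ball 0 R \<subseteq> \<Omega>" and M: "M > 0" "\<Omega> \<subseteq> ball 0 M"
  obtains j :: "'a \<Rightarrow> real"
  where "\<And>t x. t > 0 \<Longrightarrow> j (t *\<^sub>R x) = t * j x" "\<And>x y. j (x + y) \<le> j x + j y"
    "\<And>x. j x \<le> norm x / R" "\<And>x. norm x / M \<le> j x" "{x. j x < 1} = \<Omega>"
proof -
  define S where "S = (\<lambda>x. {t. 0 < t \<and> (1 / t) *\<^sub>R x \<in> \<Omega>})"
  define j where "j = (\<lambda>x. Inf (S x))"
  have zero: "0 \<in> \<Omega>" using R by (metis centre_in_ball subsetD)
  have bdd: "bdd_below (S x)" for x by (rule bdd_belowI[of _ 0]) (auto simp: S_def)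
  have large: "t \<in> S x" if "t > norm x / R" for x t
  proof -
    have "t > 0" using that R(1) by (meson divide_nonneg_pos le_less_trans norm_ge_zero)
    moreover have "(1 / t) *\<^sub>R x \<in> ball 0 R" using \<open>t > 0\<close> that R(1) by (simp add: field_simps)
    ultimately show ?thesis using R(2) by (auto simp: S_def)
  qed
  have ne: "S x \<noteq> {}" for x using large[of x "norm x / R + 1"] by auto
  have up: "t' \<in> S x" if "t \<in> S x" "t \<le> t'" for t t' x
  proof -
    have t: "t > 0" "(1 / t) *\<^sub>R x \<in> \<Omega>" using that(1) by (auto simp: S_def)
    have "(t / t') *\<^sub>R ((1 / t) *\<^sub>R x) + (1 - t / t') *\<^sub>R 0 \<in> \<Omega>"
      using t that(2) zero by (intro convexD[OF cv]) (auto simp: field_simps)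
    then show ?thesis using t that(2) by (simp add: S_def)
  qed
  have le: "j x \<le> t" if "t \<in> S x" for x t unfolding j_def by (rule cInf_lower[OF that bdd])
  have mem: "t \<in> S x" if "j x < t" for x t
    using cInf_lessD[OF ne that[unfolded j_def]] up by (meson less_imp_le)
  have ge: "c \<le> j x" if "\<And>t. t \<in> S x \<Longrightarrow> c \<le> t" for c x
    unfolding j_def by (rule cInf_greatest[OF ne that])
  have hom_le: "j (c *\<^sub>R x) \<le> c * j x" if c: "c > 0" for c x
  proof -
    have "j (c *\<^sub>R x) / c \<le> j x"
    proof (rule ge)
      fix t assume "t \<in> S x"
      then have "c * t \<in> S (c *\<^sub>R x)" using c by (simp add: S_def)
      from le[OF this] show "j (c *\<^sub>R x) / c \<le> t" using c by (simp add: field_simps)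
    qed
    then show ?thesis using c by (simp add: field_simps)
  qed
  show thesis
  proof
    show "j (c *\<^sub>R x) = c * j x" if c: "c > 0" for c x
    proof (rule antisym[OF hom_le[OF c]])
      have "j ((1 / c) *\<^sub>R (c *\<^sub>R x)) \<le> (1 / c) * j (c *\<^sub>R x)" using c by (intro hom_le) simp
      then show "c * j x \<le> j (c *\<^sub>R x)" using c by (simp add: field_simps)
    qed
    show "j (x + y) \<le> j x + j y" for x y
    proof (rule field_le_epsilon)
      fix e :: real assume e: "e > 0"
      define t u where "t = j x + e / 2" and "u = j y + e / 2"
      have "t \<in> S x" "u \<in> S y" using e by (auto simp: t_def u_def intro: mem)
      then have tu: "t > 0" "u > 0" "(1 / t) *\<^sub>R x \<in> \<Omega>" "(1 / u) *\<^sub>R y \<in> \<Omega>" by (auto simp: S_def)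
      have "(t / (t + u)) *\<^sub>R ((1 / t) *\<^sub>R x) + (u / (t + u)) *\<^sub>R ((1 / u) *\<^sub>R y) \<in> \<Omega>"
        using tu by (intro convexD[OF cv]) (auto simp: add_divide_distrib[symmetric])
      then have "t + u \<in> S (x + y)" using tu by (simp add: S_def scaleR_add_right)
      from le[OF this] show "j (x + y) \<le> j x + j y + e" by (simp add: t_def u_def)
    qed
    show "j x \<le> norm x / R" for x by (rule dense_ge) (rule le[OF large])
    show "norm x / M \<le> j x" for x
    proof (rule ge)
      fix t assume "t \<in> S x"
      then have t: "t > 0" "(1 / t) *\<^sub>R x \<in> ball 0 M" using M by (auto simp: S_def)
      then show "norm x / M \<le> t" using M(1) by (simp add: field_simps)
    qed
    show "{x. j x < 1} = \<Omega>"
    proof (intro set_eqI iffI)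
      fix x assume "x \<in> {x. j x < 1}"
      then have "1 \<in> S x" by (intro mem) simp
      then show "x \<in> \<Omega>" by (simp add: S_def)
    next
      fix x assume "x \<in> \<Omega>"
      then obtain e where e: "e > 0" "ball x e \<subseteq> \<Omega>" using op openE by blast
      \<comment> \<open>Openness leaves room to stretch \<open>x\<close> by the factor
        \<open>1 + d\<close>, which makes the infimum strictly less than 1.\<close>
      define d where "d = e / (norm x + 1)"
      have nx: "norm x + 1 > 0" by (simp add: add_nonneg_pos)
      have d: "d > 0" using e nx by (simp add: d_def)
      have "d * norm x < d * (norm x + 1)" using d by simp
      also have "\<dots> = e" using nx by (simp add: d_def)
      finally have "(1 + d) *\<^sub>R x \<in> ball x e" using d by (simp add: dist_norm scaleR_add_left)
      then have "1 / (1 + d) \<in> S x" using e d by (auto simp: S_def)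
      moreover have "1 / (1 + d) < 1" using d by simp
      ultimately have "j x < 1" using le by (meson le_less_trans)
      then show "x \<in> {x. j x < 1}" by simp
    qed
  qed
qed

text \<open>\<open>e\<close> points to a point \<open>y\<close> of the closure with maximal norm
  \<open>M\<close>. Points of \<Omega> come arbitrarily close to \<open>y\<close>, so every level
  below \<open>M\<close> cuts off something. If \<open>M \<le> R\<close>, then \<Omega> would be the
  ball.\<close>

lemma farthest_point_direction:
  fixes \<Omega> :: "'a::euclidean_space set"
  assumes op: "open \<Omega>" and bd: "bounded \<Omega>" and R: "R > 0" "ball 0 R \<subseteq> \<Omega>" and ne: "\<Omega> \<noteq> ball 0 R"
  obtains M and e :: 'a where "M > R" "\<Omega> \<subseteq> ball 0 M" "norm e = 1" "\<And>m. m < M \<Longrightarrow> \<exists>x\<in>\<Omega>. x \<bullet> e > m"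
proof -
  have 0: "0 \<in> \<Omega>" using R by (metis centre_in_ball subsetD)
  have "compact (closure \<Omega>)" using bd by simp
  moreover have "closure \<Omega> \<noteq> {}" using 0 closure_subset by blast
  ultimately obtain y where y: "y \<in> closure \<Omega>" "\<And>x. x \<in> closure \<Omega> \<Longrightarrow> norm x \<le> norm y"
    using continuous_attains_sup[of "closure \<Omega>" norm] by (auto intro: continuous_intros)
  define M where "M = norm y"
  have "\<Omega> \<subseteq> cball 0 M" using y(2) closure_subset[of \<Omega>] by (auto simp: M_def)
  then have sub: "\<Omega> \<subseteq> ball 0 M" using interior_maximal[OF _ op] by (metis interior_cball)
  have MR: "M > R"
  proof (rule ccontr)
    assume "\<not> M > R"
    then have "ball 0 M \<subseteq> ball (0::'a) R" by (intro subset_ball) simp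
    then show False using sub R ne by blast
  qed
  have M: "M > 0" using MR R by simp
  define e where "e = (1 / M) *\<^sub>R y"
  have e: "norm e = 1" using M by (simp add: e_def M_def)
  have ye: "y \<bullet> e = M" using M by (simp add: e_def M_def dot_square_norm power2_eq_square)
  have "\<exists>x\<in>\<Omega>. x \<bullet> e > m" if "m < M" for m
  proof -
    have "open {x. x \<bullet> e > m}" by (intro open_Collect_less continuous_intros)
    moreover have "y \<in> {x. x \<bullet> e > m}" using that ye by simp
    ultimately have "{x. x \<bullet> e > m} \<inter> \<Omega> \<noteq> {}" using y(1) open_Int_closure_eq_empty[of "{x. x \<bullet> e > m}" \<Omega>] by blast
    then show ?thesis by blast
  qed
  then show thesis using that[OF MR sub e] by blast
qed

text \<open>As \<open>m\<close> tends to \<open>M\<close> from below, the left side, the relative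
  loss of volume, tends to 0, while the gain on the right tends to 1 - R^2 / M^2 > 0.\<close>

lemma cut_level_exists:
  fixes R M :: real
  assumes "0 < R" "R < M"
  obtains m where "R < m" "m < M" "(M / m) ^ n - 1 < 1 - R\<^sup>2 / m\<^sup>2"
proof -
  have "((\<lambda>m. (M / m) ^ n + R\<^sup>2 / m\<^sup>2) \<longlongrightarrow> (M / M) ^ n + R\<^sup>2 / M\<^sup>2) (at_left M)"
    using assms by (intro tendsto_intros) auto
  moreover have "(M / M) ^ n + R\<^sup>2 / M\<^sup>2 < 2"
  proof -
    have "R\<^sup>2 < M\<^sup>2" using assms by (intro power_strict_mono) auto
    then have "R\<^sup>2 / M\<^sup>2 < 1" using assms by (simp add: field_simps)
    then show ?thesis using assms by simp
  qed
  ultimately have "\<forall>\<^sub>F m in at_left M. (M / m) ^ n + R\<^sup>2 / m\<^sup>2 < 2" by (rule order_tendstoD(2))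
  moreover have "\<forall>\<^sub>F m in at_left M. m \<in> {R<..<M}" using assms(2) by (rule eventually_at_left_real)
  ultimately have "\<forall>\<^sub>F m in at_left M. (M / m) ^ n + R\<^sup>2 / m\<^sup>2 < 2 \<and> m \<in> {R<..<M}" by eventually_elim simp
  then obtain m where "(M / m) ^ n + R\<^sup>2 / m\<^sup>2 < 2" "m \<in> {R<..<M}"
    using eventually_happens[of _ "at_left M"] by (auto simp: trivial_limit_at_left_real)
  then show thesis using that[of m] by auto
qed

text \<open>
  Truncating \<open>\<Omega>\<close> at the level \<open>m\<close> in the direction \<open>e\<close> of a farthest point creates a flat face at
  distance \<open>m > R\<close> from the origin. On the cone over this face the gauge is linear with gradient of
  norm \<open>1 / m < 1 / R\<close>; for \<open>m\<close> close to \<open>M\<close> this gain is larger than the loss of volume.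
\<close>

lemma lambda2_convex_strict:
  fixes \<Omega> :: "'a::euclidean_space set"
  assumes q: "1 \<le> q" "q \<le> 2" and pos: "lambda2 q (ball (0::'a) 1) > 0"
    and op: "open \<Omega>" and bd: "bounded \<Omega>" and cv: "convex \<Omega>"
    and R: "R > 0" "ball 0 R \<subseteq> \<Omega>" and ne: "\<Omega> \<noteq> ball 0 R"
  shows "lambda2 q \<Omega> * measure lebesgue \<Omega> powr ((2 - q) / q)
    < measure lebesgue (ball (0::'a) 1) powr ((2 - q) / q) * lambda2 q (ball (0::'a) 1) / R\<^sup>2"
proof -
  obtain M and e :: 'a where M: "M > R" "\<Omega> \<subseteq> ball 0 M" and e: "norm e = 1" and far: "\<And>m. m < M \<Longrightarrow> \<exists>x\<in>\<Omega>. x \<bullet> e > m"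
    using farthest_point_direction[OF op bd R ne] by metis
  obtain m where m: "R < m" "m < M" and cut: "(M / m) ^ DIM('a) - 1 < 1 - R\<^sup>2 / m\<^sup>2"
    using cut_level_exists[OF R(1) M(1)] by metis
  have m0: "m > 0" and M0: "M > 0" using m R by auto
  obtain j :: "'a \<Rightarrow> real" where j: "\<And>t x. t > 0 \<Longrightarrow> j (t *\<^sub>R x) = t * j x" "\<And>x y. j (x + y) \<le> j x + j y"
    "\<And>x. j x \<le> norm x / R" "\<And>x. norm x / M \<le> j x" "{x. j x < 1} = \<Omega>"
    using minkowski_gauge[OF op cv R M0 M(2)] by metis
  \<comment> \<open>The maximum of two gauges is the gauge of the intersection, here of \<Omega>
    with the half-space where \<open>x \<bullet> e < m\<close>.\<close>
  define k where "k = (\<lambda>x. max (j x) ((x \<bullet> e) / m))"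
  define G where "G = (\<lambda>x. if j x < (x \<bullet> e) / m then 1 / m else 1 / R)"
  have inner_le: "x \<bullet> e \<le> norm x" for x using norm_cauchy_schwarz[of x e] e by simp
  have sublinear_lip: "\<bar>h x - h y\<bar> \<le> 1 / R * norm (x - y)"
    if h: "\<And>x y. h (x + y) \<le> h x + h y" "\<And>x. h x \<le> norm x / R" for h :: "'a \<Rightarrow> real" and x y
    using h(1)[of "x - y" y] h(1)[of "y - x" x] h(2)[of "x - y"] h(2)[of "y - x"]
    by (simp add: norm_minus_commute abs_le_iff)
  have k_le: "k x \<le> norm x / R" for x
  proof -
    have "(x \<bullet> e) / m \<le> norm x / m" using inner_le[of x] m0 by (simp add: divide_right_mono)
    also have "\<dots> \<le> norm x / R" using m R by (simp add: frac_le)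
    finally show ?thesis using j(3)[of x] by (simp add: k_def)
  qed
  have k_add: "k (x + y) \<le> k x + k y" for x y
    using j(2)[of x y] by (simp add: k_def inner_add_left add_divide_distrib max_def)
  note k_lip = sublinear_lip[of k, OF k_add k_le]
  have cont_j: "continuous_on UNIV j"
  proof -
    have "(1 / R)-lipschitz_on UNIV j"
      using sublinear_lip[of j, OF j(2,3)] R(1) by (intro lipschitz_onI) (auto simp: dist_norm)
    then show ?thesis by (rule lipschitz_on_continuous_on)
  qed
  define P where "P = {x. j x < (x \<bullet> e) / m}"
  have openP: "open P" unfolding P_def
    by (intro open_Collect_less cont_j continuous_intros) (use m0 in auto)
  have [measurable]: "P \<in> sets borel" using openP by simp
  have G_P: "G x = (if x \<in> P then 1 / m else 1 / R)" for x by (simp add: G_def P_def)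
  interpret lipschitz_gauge k G "1 / R" "1 / M"
  proof
    show "k (t *\<^sub>R x) = t * k x" if "t > 0" for t x
      using that by (simp add: k_def j(1) max_mult_distrib_left)
    show "\<bar>k x - k y\<bar> \<le> 1 / R * norm (x - y)" for x y by (rule k_lip)
    show "1 / M > 0" using M0 by simp
    show "1 / M * norm x \<le> k x" for x using j(4)[of x] by (simp add: k_def)
    show "G \<in> borel_measurable borel" unfolding G_P[abs_def] by measurable
    show "0 \<le> G x" for x using m0 R by (simp add: G_def)
    show "G x \<le> 1 / R" for x using m R by (simp add: G_def frac_le)
    show "G (t *\<^sub>R x) = G x" if "t > 0" for t x
      using that mult_less_cancel_left_pos[OF that, of "j x" "(x \<bullet> e) / m"] by (simp add: G_def j(1))
    show "\<exists>d>0. \<forall>y\<in>ball x d. \<forall>z\<in>ball x d. \<bar>k y - k z\<bar> \<le> G x * norm (y - z)" for x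
    proof (cases "x \<in> P")
      case True
      then obtain d where d: "d > 0" "ball x d \<subseteq> P" using openP openE by blast
      have "\<bar>k y - k z\<bar> \<le> G x * norm (y - z)" if "y \<in> ball x d" "z \<in> ball x d" for y z
      proof -
        have "y \<in> P" "z \<in> P" using d that by auto
        then have "k y - k z = ((y - z) \<bullet> e) / m" by (simp add: k_def P_def max_def inner_diff_left diff_divide_distrib)
        moreover have "\<bar>(y - z) \<bullet> e\<bar> \<le> norm (y - z)" using Cauchy_Schwarz_ineq2[of "y - z" e] e by simp
        ultimately show ?thesis using True m0 by (simp add: G_P divide_right_mono)
      qed
      then show ?thesis using d(1) by blast
    next
      case False
      then show ?thesis using k_lip by (intro exI[of _ 1]) (simp add: G_P)
    qed
  qed
  let ?D = "{x. k x < 1}"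
  have D_iff: "x \<in> ?D \<longleftrightarrow> x \<in> \<Omega> \<and> x \<bullet> e < m" for x
    using m0 j(5) by (auto simp: k_def)
  have D_sub: "?D \<subseteq> \<Omega>" using D_iff by blast
  \<comment> \<open>The part of the sublevel set in the cone over the new flat face; there
    \<open>k\<close> is linear and \<open>G\<close> equals \<open>1 / m\<close>.\<close>
  define C where "C = P \<inter> {x. x \<bullet> e < m}"
  have openC: "open C" unfolding C_def by (intro open_Int openP open_Collect_less continuous_intros)
  have C_sub: "C \<subseteq> ?D"
  proof
    fix x assume x: "x \<in> C"
    then have "j x < (x \<bullet> e) / m" "(x \<bullet> e) / m < 1" using m0 by (auto simp: C_def P_def)
    then have "j x < 1" by linarith
    then show "x \<in> ?D" using x D_iff j(5) by (auto simp: C_def)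
  qed
  have D_P: "x \<in> P \<longleftrightarrow> x \<in> C" if "x \<in> ?D" for x using that D_iff by (auto simp: C_def)
  have bC: "bounded C" using C_sub bounded_sublevel bounded_subset by blast
  define V where "V = measure lebesgue ?D"
  define a where "a = measure lebesgue C"
  define \<eta> where "\<eta> = (M / m) ^ DIM('a) - 1"
  define c where "c = 1 - R\<^sup>2 / m\<^sup>2"
  have eV: "emeasure lborel ?D = ennreal V" unfolding V_def by (rule emeasure_lborel_open_bounded[OF open_sublevel bounded_sublevel])
  have ea: "emeasure lborel C = ennreal a" unfolding a_def by (rule emeasure_lborel_open_bounded[OF openC bC])
  have "C \<noteq> {}"
  proof -
    obtain x where x: "x \<in> \<Omega>" "x \<bullet> e > m" using far[OF m(2)] by blast
    then have "j x < 1" using j(5) by blast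
    moreover have "(x \<bullet> e) / m > 1" using x m0 by simp
    ultimately have "j x < (x \<bullet> e) / m" by linarith
    \<comment> \<open>Scales \<open>x\<close> down along its ray to level \<open>m / 2\<close>;
      membership in the cone \<open>P\<close> is invariant under dilations.\<close>
    define t where "t = m / (2 * (x \<bullet> e))"
    have xe: "x \<bullet> e > 0" using x m0 by simp
    have t: "t > 0" using xe m0 by (simp add: t_def)
    have "t *\<^sub>R x \<in> P" using \<open>j x < (x \<bullet> e) / m\<close> t mult_strict_left_mono[of "j x" "(x \<bullet> e) / m" t] by (simp add: P_def j(1))
    moreover have "(t *\<^sub>R x) \<bullet> e < m" using xe m0 by (simp add: t_def)
    ultimately show ?thesis by (auto simp: C_def)
  qed
  then have a: "a > 0" unfolding a_def using openC bC by (intro measure_lebesgue_open_pos)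
  have aV: "a \<le> V" using emeasure_mono[OF C_sub, of lborel] open_sublevel a unfolding ea eV
    by (auto simp: ennreal_le_iff2)
  have \<eta>: "\<eta> \<ge> 0" using m m0 by (simp add: \<eta>_def one_le_power)
  have c: "\<eta> < c" using cut by (simp add: \<eta>_def c_def)
  \<comment> \<open>The removed cap lies in the cone \<open>P\<close> between the levels
    \<open>m\<close> and \<open>M\<close>. Up to level \<open>M\<close> the cone is \<open>C\<close>
    dilated by \<open>M / m\<close>, so the cap has volume at most
    \<open>\<eta> * a\<close>.\<close>
  have vol: "measure lebesgue \<Omega> \<le> V + \<eta> * a"
  proof -
    let ?r = "M / m"
    define C' where "C' = P \<inter> {x. x \<bullet> e < M}"
    have openC': "open C'" unfolding C'_def by (intro open_Int openP open_Collect_less continuous_intros)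
    have r: "?r > 0" using m0 M0 by simp
    have sc: "?r *\<^sub>R x \<in> C' \<longleftrightarrow> x \<in> C" for x
    proof -
      have "?r *\<^sub>R x \<in> P \<longleftrightarrow> x \<in> P"
        using mult_less_cancel_left_pos[OF r, of "j x" "(x \<bullet> e) / m"] by (simp add: P_def j(1)[OF r])
      moreover have "(?r *\<^sub>R x) \<bullet> e < M \<longleftrightarrow> x \<bullet> e < m" using m0 M0 by (simp add: field_simps)
      ultimately show ?thesis by (simp add: C_def C'_def)
    qed
    have [measurable]: "C \<in> sets borel" "C' \<in> sets borel" "?D \<in> sets borel" using openC openC' open_sublevel by auto
    have "emeasure lborel C' = (\<integral>\<^sup>+x. indicator C' x \<partial>lborel)" by simp
    also have "\<dots> = ennreal (?r ^ DIM('a)) * (\<integral>\<^sup>+x. indicator C' (?r *\<^sub>R x) \<partial>lborel)"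
      by (rule nn_integral_lborel_scaleR[OF _ r]) measurable
    also have "(\<integral>\<^sup>+x. indicator C' (?r *\<^sub>R x) \<partial>lborel) = (\<integral>\<^sup>+x. indicator C x \<partial>lborel)"
      by (intro nn_integral_cong) (simp add: sc indicator_def)
    finally have eC': "emeasure lborel C' = ennreal (?r ^ DIM('a) * a)"
      using a r by (simp add: ea ennreal_mult)
    have "C \<subseteq> C'" using m by (auto simp: C_def C'_def)
    have sub: "\<Omega> \<subseteq> ?D \<union> (C' - C)"
    proof
      fix x assume x: "x \<in> \<Omega>"
      show "x \<in> ?D \<union> (C' - C)"
      proof (cases "x \<bullet> e < m")
        case True then show ?thesis using x D_iff by blast
      next
        case False
        have "j x < 1" using x j(5) by blast
        also have "1 \<le> (x \<bullet> e) / m" using False m0 by simp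
        finally have "x \<in> P" by (simp add: P_def)
        moreover have "x \<bullet> e < M" using inner_le[of x] M(2) x by (auto intro: le_less_trans)
        ultimately show ?thesis using False by (simp add: C'_def C_def)
      qed
    qed
    have "ennreal (measure lebesgue \<Omega>) = emeasure lborel \<Omega>" by (rule emeasure_lborel_open_bounded[OF op bd, symmetric])
    also have "\<dots> \<le> emeasure lborel (?D \<union> (C' - C))" using sub by (intro emeasure_mono) auto
    also have "\<dots> \<le> emeasure lborel ?D + emeasure lborel (C' - C)" by (intro emeasure_subadditive) auto
    also have "emeasure lborel (C' - C) = ennreal (?r ^ DIM('a) * a) - ennreal a"
      using \<open>C \<subseteq> C'\<close> ea by (subst emeasure_Diff) (auto simp: eC')
    also have "\<dots> = ennreal (\<eta> * a)"
      using a by (simp add: ennreal_minus \<eta>_def left_diff_distrib)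
    also have "emeasure lborel ?D + ennreal (\<eta> * a) = ennreal (V + \<eta> * a)"
      using a \<eta> by (simp add: eV V_def)
    finally show ?thesis using a aV \<eta> by (subst (asm) ennreal_le_iff) auto
  qed
  define g where "g = (V - a) / R\<^sup>2 + a / m\<^sup>2"
  have V: "V > 0" using a aV by simp
  have g: "g > 0" using a aV m0 R by (simp add: g_def add_nonneg_pos)
  have int_G: "(\<integral>\<^sup>+x. indicator ?D x * ennreal ((G x)\<^sup>2) \<partial>lborel) = ennreal g"
  proof -
    have [measurable]: "C \<in> sets borel" "?D \<in> sets borel" using openC open_sublevel by auto
    have "(\<integral>\<^sup>+x. indicator ?D x * ennreal ((G x)\<^sup>2) \<partial>lborel)
      = (\<integral>\<^sup>+x. ennreal (1 / R\<^sup>2) * indicator (?D - C) x + ennreal (1 / m\<^sup>2) * indicator C x \<partial>lborel)"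
    proof (rule nn_integral_cong)
      fix x
      show "indicator ?D x * ennreal ((G x)\<^sup>2) = ennreal (1 / R\<^sup>2) * indicator (?D - C) x + ennreal (1 / m\<^sup>2) * indicator C x"
      proof (cases "x \<in> ?D")
        case True
        then show ?thesis using D_P[OF True] by (cases "x \<in> C") (simp_all add: G_P power_divide)
      next
        case False
        moreover have "x \<notin> C" using False C_sub by blast
        ultimately show ?thesis by simp
      qed
    qed
    also have "\<dots> = ennreal (1 / R\<^sup>2) * emeasure lborel (?D - C) + ennreal (1 / m\<^sup>2) * emeasure lborel C"
      by (simp add: nn_integral_add nn_integral_cmult_indicator)
    also have "emeasure lborel (?D - C) = ennreal (V - a)"
      using C_sub ea a aV by (subst emeasure_Diff) (auto simp: eV ennreal_minus)
    also have "ennreal (1 / R\<^sup>2) * ennreal (V - a) + ennreal (1 / m\<^sup>2) * emeasure lborel C = ennreal (1 / R\<^sup>2 * (V - a) + 1 / m\<^sup>2 * a)"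
      unfolding ea using a aV by (subst ennreal_mult[symmetric], simp, simp)+ (simp add: ennreal_plus[symmetric] del: ennreal_plus)
    finally show ?thesis by (simp add: g_def)
  qed
  define s where "s = 2 / q"
  define w where "w = measure lebesgue (ball (0::'a) 1)"
  define lB where "lB = lambda2 q (ball (0::'a) 1)"
  have w: "w > 0" unfolding w_def by (rule measure_lebesgue_open_pos) auto
  have q0: "q > 0" and s: "0 \<le> s - 1" "s - 1 \<le> 1" and s': "(2 - q) / q = s - 1"
    using q by (auto simp: s_def field_simps)
  have D_le: "lambda2 q ?D * V powr s * w powr (1 - s) \<le> g * lB"
    unfolding V_def w_def s_def lB_def by (rule lambda2_gauge_le[OF q int_G g])
  have neD: "?D \<noteq> {}" using \<open>C \<noteq> {}\<close> C_sub by blast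
  have lD: "lambda2 q ?D \<ge> 0" by (rule lambda2_nonneg[OF open_sublevel neD q0])
  define x where "x = a / V"
  have x: "x > 0" using a V by (simp add: x_def)
  have "measure lebesgue \<Omega> powr (s - 1) \<le> (V + \<eta> * a) powr (s - 1)"
    using vol s by (intro powr_mono2) auto
  also have "V + \<eta> * a = V * (1 + \<eta> * x)" using V by (simp add: x_def field_simps)
  also have "(V * (1 + \<eta> * x)) powr (s - 1) = V powr (s - 1) * (1 + \<eta> * x) powr (s - 1)"
    by (rule powr_mult)
  \<comment> \<open>The base is at least 1 and \<open>s - 1 \<le> 1\<close> by
    \<open>1 \<le> q\<close>, so the power may be replaced by the base itself.\<close>
  also have "\<dots> \<le> V powr (s - 1) * (1 + \<eta> * x) powr 1"
    using x \<eta> s by (intro mult_left_mono powr_mono) auto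
  also have "\<dots> = V powr s * ((1 + \<eta> * x) / V)" using V x \<eta> by (simp add: powr_diff)
  finally have \<Omega>_le: "measure lebesgue \<Omega> powr (s - 1) \<le> V powr s * ((1 + \<eta> * x) / V)" .
  have "lambda2 q \<Omega> * measure lebesgue \<Omega> powr (s - 1) * w powr (1 - s)
      \<le> lambda2 q ?D * (V powr s * ((1 + \<eta> * x) / V)) * w powr (1 - s)"
    using lambda2_antimono[OF open_sublevel neD q0 D_sub] \<Omega>_le lD by (intro mult_right_mono mult_mono) auto
  also have "\<dots> = (lambda2 q ?D * V powr s * w powr (1 - s)) * ((1 + \<eta> * x) / V)" by (simp add: mult_ac)
  also have "\<dots> \<le> (g * lB) * ((1 + \<eta> * x) / V)"
    using x \<eta> V by (intro mult_right_mono D_le) auto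
  also have "\<dots> = lB / R\<^sup>2 * ((1 - c * x) * (1 + \<eta> * x))"
  proof -
    have "g / V = (1 - c * x) / R\<^sup>2"
      using V R m0 by (simp add: g_def c_def x_def field_simps)
    moreover have "(g * lB) * ((1 + \<eta> * x) / V) = g / V * lB * (1 + \<eta> * x)" by simp
    ultimately show ?thesis by simp
  qed
  \<comment> \<open>The factor \<open>1 - c * x\<close> is the gain in \<open>g\<close> and
    \<open>1 + \<eta> * x\<close> the loss of volume; the cut level was chosen with
    \<open>\<eta> < c\<close>.\<close>
  also have "\<dots> < lB / R\<^sup>2 * 1"
  proof (rule mult_strict_left_mono)
    have "(c - \<eta>) * x > 0" "c * \<eta> * (x * x) \<ge> 0" using c \<eta> x by auto
    moreover have "(1 - c * x) * (1 + \<eta> * x) = 1 - (c - \<eta>) * x - c * \<eta> * (x * x)" by (simp add: algebra_simps)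
    ultimately show "(1 - c * x) * (1 + \<eta> * x) < 1" by linarith
    show "lB / R\<^sup>2 > 0" using pos R by (simp add: lB_def)
  qed
  finally have "lambda2 q \<Omega> * measure lebesgue \<Omega> powr (s - 1) * w powr (1 - s) < lB / R\<^sup>2" by simp
  then have less: "lambda2 q \<Omega> * measure lebesgue \<Omega> powr (s - 1) * w powr (1 - s) * w powr (s - 1) < lB / R\<^sup>2 * w powr (s - 1)"
    using w by (intro mult_strict_right_mono) auto
  have "w powr (1 - s) * w powr (s - 1) = 1" using w by (simp add: powr_add[symmetric])
  then have "lambda2 q \<Omega> * measure lebesgue \<Omega> powr (s - 1) * w powr (1 - s) * w powr (s - 1)
      = lambda2 q \<Omega> * measure lebesgue \<Omega> powr (s - 1)"
    by (simp only: mult.assoc mult_1_right)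
  from less[unfolded this] show ?thesis
    unfolding s' w_def[symmetric] lB_def[symmetric] by (simp add: mult.commute)
qed

section \<open>Comparison with an inscribed ball, translation, and the theorem\<close>

lemma lambda2_le_of_ball_subset:
  fixes \<Omega> :: "'a::euclidean_space set"
  assumes q: "q \<ge> 2" and op: "open \<Omega>" and bd: "bounded \<Omega>" and R: "R > 0" "ball c R \<subseteq> \<Omega>"
  shows "lambda2 q \<Omega> * measure lebesgue \<Omega> powr ((2 - q) / q)
    \<le> measure lebesgue (ball (0::'a) 1) powr ((2 - q) / q) * lambda2 q (ball (0::'a) 1) / R\<^sup>2"
    and "q > 2 \<Longrightarrow> lambda2 q (ball (0::'a) 1) > 0 \<Longrightarrow> \<Omega> \<noteq> ball c R \<Longrightarrow>
    lambda2 q \<Omega> * measure lebesgue \<Omega> powr ((2 - q) / q)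
    < measure lebesgue (ball (0::'a) 1) powr ((2 - q) / q) * lambda2 q (ball (0::'a) 1) / R\<^sup>2"
proof -
  let ?B = "ball c R" and ?p = "(2 - q) / q"
  have q0: "q > 0" and p: "?p \<le> 0" using q by (auto simp: field_simps)
  have B_ne: "?B \<noteq> {}" using R by simp
  have B_pos: "measure lebesgue ?B > 0" using R by (intro measure_lebesgue_open_pos) auto
  have le: "lambda2 q \<Omega> \<le> lambda2 q ?B" by (rule lambda2_antimono[OF open_ball B_ne q0 R(2)])
  have B_le: "measure lebesgue ?B \<le> measure lebesgue \<Omega>"
    using op bd by (intro measure_mono_fmeasurable[OF R(2)]) (auto intro: lmeasurable_open)
  note eq = lambda2_ball[OF q0 R(1), of c]
  have "measure lebesgue \<Omega> powr ?p \<le> measure lebesgue ?B powr ?p"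
    using p B_pos B_le by (intro powr_mono2') auto
  then have "lambda2 q \<Omega> * measure lebesgue \<Omega> powr ?p \<le> lambda2 q ?B * measure lebesgue ?B powr ?p"
    using le lambda2_nonneg[OF open_ball B_ne q0] by (intro mult_mono) auto
  then show "lambda2 q \<Omega> * measure lebesgue \<Omega> powr ?p
    \<le> measure lebesgue (ball (0::'a) 1) powr ?p * lambda2 q (ball (0::'a) 1) / R\<^sup>2"
    using eq by simp
  assume q2: "q > 2" and pos: "lambda2 q (ball (0::'a) 1) > 0" and ne: "\<Omega> \<noteq> ?B"
  have "measure lebesgue ?B < measure lebesgue \<Omega>"
    using open_eq_ball_if_measure_eq[OF op bd R(2)] ne R(1) by fastforce
  moreover have "?p < 0" using q2 by (simp add: divide_neg_pos)
  ultimately have "measure lebesgue \<Omega> powr ?p < measure lebesgue ?B powr ?p"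
    using B_pos powr_less_mono2_neg[of ?p "measure lebesgue ?B" "measure lebesgue \<Omega>"] by simp
  moreover have "lambda2 q ?B > 0"
  proof -
    have "lambda2 q ?B = lambda2 q (ball (0::'a) 1) * R powr (real DIM('a) - 2 - real DIM('a) * (2 / q))"
      unfolding ball_affine[OF R(1), of c] by (rule lambda2_affine[OF _ _ q0 R(1)]) auto
    then show ?thesis using pos R(1) by simp
  qed
  ultimately have "lambda2 q ?B * measure lebesgue \<Omega> powr ?p < lambda2 q ?B * measure lebesgue ?B powr ?p"
    by (intro mult_strict_left_mono)
  moreover have "lambda2 q \<Omega> * measure lebesgue \<Omega> powr ?p \<le> lambda2 q ?B * measure lebesgue \<Omega> powr ?p"
    using le by (intro mult_right_mono) auto
  ultimately show "lambda2 q \<Omega> * measure lebesgue \<Omega> powr ?p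
    < measure lebesgue (ball (0::'a) 1) powr ?p * lambda2 q (ball (0::'a) 1) / R\<^sup>2"
    using eq by simp
qed

lemma lambda2_convex_strict_translated:
  fixes \<Omega> :: "'a::euclidean_space set"
  assumes q: "1 \<le> q" "q \<le> 2" and pos: "lambda2 q (ball (0::'a) 1) > 0"
    and op: "open \<Omega>" and bd: "bounded \<Omega>" and cv: "convex \<Omega>"
    and R: "R > 0" "ball c R \<subseteq> \<Omega>" and ne: "\<Omega> \<noteq> ball c R"
  shows "lambda2 q \<Omega> * measure lebesgue \<Omega> powr ((2 - q) / q)
    < measure lebesgue (ball (0::'a) 1) powr ((2 - q) / q) * lambda2 q (ball (0::'a) 1) / R\<^sup>2"
proof -
  let ?T = "(+) (- c)"
  have T_eq: "?T ` \<Omega> = (\<lambda>x. - c + 1 *\<^sub>R x) ` \<Omega>" by simp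
  have inv: "(+) c ` ?T ` S = S" for S :: "'a set" by (simp add: image_image)
  have ball: "?T ` ball c R = ball 0 R" using ball_translation[of "- c" c R] by simp
  have "\<Omega> \<noteq> {}" using R by auto
  then have "lambda2 q (?T ` \<Omega>) = lambda2 q \<Omega>"
    unfolding T_eq using lambda2_affine[OF op, of q 1 "- c"] q by simp
  moreover have "measure lebesgue (?T ` \<Omega>) = measure lebesgue \<Omega>" by (rule measure_translation)
  moreover have "ball 0 R \<subseteq> ?T ` \<Omega>" using image_mono[OF R(2), of ?T] ball by simp
  moreover have "?T ` \<Omega> \<noteq> ball 0 R" using ne ball inv by metis
  moreover have "open (?T ` \<Omega>)" "bounded (?T ` \<Omega>)" "convex (?T ` \<Omega>)"
    using op bd cv open_translation bounded_translation convex_translation by blast+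
  ultimately show ?thesis using lambda2_convex_strict[OF q pos, of "?T ` \<Omega>" R] R(1) by simp
qed

theorem theorem1p2:
  fixes q :: real
  assumes "DIM('a::euclidean_space) \<ge> 2"
    and "1 \<le> q" and "ereal q < critical_exponent DIM('a)"
  shows "(\<forall>\<Omega>::'a set. \<Omega> \<noteq> {} \<and> open \<Omega> \<and> bounded \<Omega> \<and> convex \<Omega> \<longrightarrow>
            lambda2 q \<Omega> * measure lebesgue \<Omega> powr ((2 - q) / q)
              \<le> measure lebesgue (ball (0::'a) 1) powr ((2 - q) / q) * lambda2 q (ball (0::'a) 1)
                  / (inradius \<Omega>)\<^sup>2 \<and>
            (lambda2 q \<Omega> * measure lebesgue \<Omega> powr ((2 - q) / q)
              = measure lebesgue (ball (0::'a) 1) powr ((2 - q) / q) * lambda2 q (ball (0::'a) 1)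
                  / (inradius \<Omega>)\<^sup>2
             \<longleftrightarrow> (\<exists>c r. \<Omega> = ball c r))) \<and>
         (2 \<le> q \<longrightarrow> (\<forall>\<Omega>::'a set. \<Omega> \<noteq> {} \<and> open \<Omega> \<and> bounded \<Omega> \<longrightarrow>
            lambda2 q \<Omega> * measure lebesgue \<Omega> powr ((2 - q) / q)
              \<le> measure lebesgue (ball (0::'a) 1) powr ((2 - q) / q) * lambda2 q (ball (0::'a) 1)
                  / (inradius \<Omega>)\<^sup>2))"
proof (intro conjI allI impI)
  let ?F = "\<lambda>\<Omega>::'a set. lambda2 q \<Omega> * measure lebesgue \<Omega> powr ((2 - q) / q)"
  let ?G = "\<lambda>\<Omega>::'a set. measure lebesgue (ball (0::'a) 1) powr ((2 - q) / q) * lambda2 q (ball (0::'a) 1) / (inradius \<Omega>)\<^sup>2"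
  have q0: "q > 0" using assms(2) by simp
  note pos = lambda2_ball_pos[OF assms]
  {
    fix \<Omega> :: "'a set"
    assume *: "\<Omega> \<noteq> {} \<and> open \<Omega> \<and> bounded \<Omega> \<and> convex \<Omega>"
    have eq: "?F \<Omega> = ?G \<Omega>" if "\<Omega> = ball c r" for c r
    proof -
      \<comment> \<open>The statement admits every real \<open>r\<close>; balls with
        \<open>r \<le> 0\<close> are empty and excluded because \<Omega> is not.\<close>
      have "r > 0" using * that by (metis ball_eq_empty not_le)
      then show ?thesis unfolding that using lambda2_ball[OF q0, of r c] inradius_ball[of r c] by simp
    qed
    have strict: "?F \<Omega> < ?G \<Omega>" if "\<nexists>c r. \<Omega> = ball c r"
    proof -
      have R: "inradius \<Omega> > 0" using ball_inradius(1) * by blast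
      obtain c where c: "ball c (inradius \<Omega>) \<subseteq> \<Omega>" using ball_inradius(2) * by blast
      have ne: "\<Omega> \<noteq> ball c (inradius \<Omega>)" using that by blast
      show ?thesis
      proof (cases "q \<le> 2")
        case True
        then show ?thesis using lambda2_convex_strict_translated[OF assms(2) _ pos _ _ _ R c ne] * by blast
      next
        case False
        then show ?thesis using lambda2_le_of_ball_subset(2)[OF _ _ _ R c _ pos ne] * by simp
      qed
    qed
    show "?F \<Omega> \<le> ?G \<Omega>" using eq strict by (metis order.order_iff_strict)
    show "?F \<Omega> = ?G \<Omega> \<longleftrightarrow> (\<exists>c r. \<Omega> = ball c r)" using eq strict by (metis less_irrefl)
  next
    fix \<Omega> :: "'a set"
    assume "2 \<le> q" and *: "\<Omega> \<noteq> {} \<and> open \<Omega> \<and> bounded \<Omega>"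
    obtain c where c: "ball c (inradius \<Omega>) \<subseteq> \<Omega>" using ball_inradius(2) * by blast
    show "?F \<Omega> \<le> ?G \<Omega>"
      using lambda2_le_of_ball_subset(1)[OF \<open>2 \<le> q\<close> _ _ _ c] ball_inradius(1) * by blast
  }
qed

end
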